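(* Let $k\in\{4,6,8,10,14\}$ and let $p\in\{2,3,5\}$. Define $$\epsilon_{k,p}=\begin{cases}7&\text{if } p=2,\ k=4,6,14,\\ 8&\text{if } p=2,\ k=8,10,\\ 2&\text{if } p=3,\ k=4,10,\\ 3&\text{if } p=3,\ k=6,8,14,\\ 1&\text{if } p=5.\end{cases}$$ Then for all integers $m,n>0$, $$v_p(a_k(m,n))\geq\begin{cases}\epsilon_{k,p}&\text{if } v_p(m)>v_p(n),\\ (v_p(n)-v_p(m))(k-1)+\epsilon_{k,p}&\text{if } v_p(n)>v_p(m).\end{cases}$$
   Context: Let $q=e^{2\pi i\tau}$ with $\tau$ in the upper half plane. For an even integer $k$, $M_k^!$ denotes the space of weakly holomorphic modular forms of weight $k$ for $\mathrm{SL}_2(\mathbb Z)$ (holomorphic on the upper half plane, possibly with a pole at the cusp $\infty$). Write $k=12\ell+k'$ with $\ell\in\mathbb Z$ and $k'\in\{0,4,6,8,10,14\}$. For every integer $m\geq-\ell$ there is a unique form $f_{k,m}\in M_k^!$ whose $q$-expansion has the form $f_{k,m}(\tau)=q^{-m}+O(q^{\ell+1})$. The integers $a_k(m,n)$ are defined by $f_{k,m}(\tau)=q^{-m}+\sum_{n}a_k(m,n)q^n$, where $a_k(m,n)=0$ when $m<-\ell$, or $n\leq\ell$, or $m$ or $n$ is not an integer. (For $k\in\{4,6,8,10,14\}$ one has $\ell=0$.) For an integer $N$, $v_p(N)$ is the largest integer $s$ such that $p^s\mid N$ (with $v_p(0)=\infty$). *)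

theory Defs
  imports "HOL-Complex_Analysis.Complex_Analysis" "HOL-Library.Extended_Nat"
begin

definition upper_half_plane :: "complex set" where
  "upper_half_plane = {\<tau>. Im \<tau> > 0}"

text \<open>
  \<open>F\<close> is the expansion of \<open>f\<close> in powers of \<open>q = exp (2 * pi * \<i> * \<tau>)\<close>.  As a
  \<open>complex fls\<close> has only finitely many terms of negative exponent, the existence of such an
  expansion says that \<open>f\<close> is meromorphic at the cusp \<open>\<infinity>\<close>.
\<close>
definition has_q_expansion :: "(complex \<Rightarrow> complex) \<Rightarrow> complex fls \<Rightarrow> bool" where
  "has_q_expansion f F \<longleftrightarrow>
     (\<exists>g. g has_laurent_expansion F \<and>
          (\<forall>\<tau>\<in>upper_half_plane. f \<tau> = g (exp (2 * of_real pi * \<i> * \<tau>))))"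

definition q_expansion :: "(complex \<Rightarrow> complex) \<Rightarrow> complex fls" where
  "q_expansion f = (THE F. has_q_expansion f F)"

text \<open>
  The space \<open>M\<^sub>k\<^sup>!\<close> for \<open>SL\<^sub>2(\<int>)\<close>.  Functions on the upper half plane are represented by total
  functions that vanish outside it, so that equality of forms is equality in HOL.
\<close>
definition weakly_holomorphic_forms :: "int \<Rightarrow> (complex \<Rightarrow> complex) set" where
  "weakly_holomorphic_forms k = {f.
     (\<forall>\<tau>. \<tau> \<notin> upper_half_plane \<longrightarrow> f \<tau> = 0) \<and>
     f holomorphic_on upper_half_plane \<and>
     (\<forall>a b c d :: int. a * d - b * c = 1 \<longrightarrow>
        (\<forall>\<tau>\<in>upper_half_plane.
           f ((of_int a * \<tau> + of_int b) / (of_int c * \<tau> + of_int d)) =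
           (of_int c * \<tau> + of_int d) powi k * f \<tau>)) \<and>
     (\<exists>F. has_q_expansion f F)}"

text \<open>The integer \<open>\<ell>\<close> in \<open>k = 12 \<ell> + k'\<close>, for even \<open>k\<close>.\<close>
definition ell :: "int \<Rightarrow> int" where
  "ell k = (THE l. k - 12 * l \<in> {0, 4, 6, 8, 10, 14})"

text \<open>
  The unique form \<open>f\<^bsub>k,m\<^esub> = q\<^bsup>-m\<^esup> + O(q\<^bsup>\<ell>+1\<^esup>)\<close> of weight \<open>k\<close>, for \<open>m \<ge> -\<ell>\<close>.
\<close>
definition basis_form :: "int \<Rightarrow> int \<Rightarrow> complex \<Rightarrow> complex" where
  "basis_form k m = (THE f. f \<in> weakly_holomorphic_forms k \<and>
     (\<forall>n\<le>ell k. fls_nth (q_expansion f) n = (if n = - m then 1 else 0)))"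

text \<open>
  The integers \<open>a\<^sub>k(m,n)\<close>.  In the second branch \<open>n > \<ell> \<ge> -m\<close>, so the leading term
  \<open>q\<^bsup>-m\<^esup>\<close> does not contribute to the coefficient of \<open>q\<^sup>n\<close>.
\<close>
definition coeff_a :: "int \<Rightarrow> int \<Rightarrow> int \<Rightarrow> int" where
  "coeff_a k m n =
     (if m < - ell k \<or> n \<le> ell k then 0
      else (THE c. of_int c = fls_nth (q_expansion (basis_form k m)) n))"

text \<open>The library function \<^const>\<open>multiplicity\<close> is \<open>0\<close> at \<open>0\<close>, whereas \<open>v\<^sub>p(0) = \<infinity>\<close>.\<close>
definition vp :: "int \<Rightarrow> int \<Rightarrow> enat" where
  "vp p N = (if N = 0 then \<infinity> else enat (multiplicity p N))"

text \<open>Only meaningful for \<open>k \<in> {4, 6, 8, 10, 14}\<close> and \<open>p \<in> {2, 3, 5}\<close>.\<close>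
definition eps :: "int \<Rightarrow> int \<Rightarrow> nat" where
  "eps k p =
     (if p = 2 then (if k \<in> {4, 6, 14} then 7 else 8)
      else if p = 3 then (if k \<in> {4, 10} then 2 else 3)
      else 1)"

end

theory Submission
  imports Defs "HOL-Real_Asymp.Real_Asymp"
begin

text \<open>
  All forms of the weights in question are \<open>E\<^sub>k P(j)\<close> with a polynomial \<open>P\<close>, where \<open>E\<^sub>8 = E\<^sub>4\<^sup>2\<close>,
  \<open>E\<^sub>1\<^sub>0 = E\<^sub>4 E\<^sub>6\<close> and \<open>E\<^sub>1\<^sub>4 = E\<^sub>4\<^sup>2 E\<^sub>6\<close>.  The modular equations of level 2 and 3 express \<open>j(q\<^sup>p)\<close> and
  \<open>E\<^sub>k(q\<^sup>p)/E\<^sub>k(q)\<close> through a Hauptmodul that is congruent to \<open>j\<close> modulo \<open>2\<^sup>8\<close> and \<open>3\<^sup>3\<close>, respectively, and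
  for \<open>p = 5\<close> one has \<open>f(q\<^sup>5) \<equiv> f(q)\<^sup>5\<close> modulo 5.  Hence \<open>j(q\<^sup>p)\<close> is congruent to a polynomial in \<open>j\<close>, and
  \<open>E\<^sub>k(q\<^sup>p)\<close> to \<open>E\<^sub>k\<close> times a polynomial in \<open>1/j\<close>.  The denominators disappear in
  \<open>f\<^bsub>k,m\<^esub>(q\<^sup>p) = E\<^sub>k(q\<^sup>p) P(j(q\<^sup>p))\<close>, because \<open>P(0)\<close> is sufficiently divisible: the constant term of
  \<open>E\<^sub>1\<^sub>4 j\<^sup>s/\<Delta>\<close> vanishes, and \<open>j \<equiv> E\<^bsub>14-k\<^esub>/\<Delta>\<close> modulo a suitable power of \<open>p\<close>.  Comparison of principal parts
  gives \<open>f\<^bsub>k,pm\<^esub>(q) \<equiv> f\<^bsub>k,m\<^esub>(q\<^sup>p)\<close> modulo \<open>p\<^sup>\<epsilon>\<close>, that is, \<open>a\<^sub>k(pm, n) \<equiv> a\<^sub>k(m, n/p)\<close>, and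
  iteration yields the case \<open>v\<^sub>p(m) > v\<^sub>p(n)\<close>.  The other case follows from the symmetry
  \<open>m\<^bsup>k-1\<^esup> a\<^sub>k(m,n) = n\<^bsup>k-1\<^esup> a\<^sub>k(n,m)\<close>, a consequence of duality and of Bol's identity in weight \<open>2 - k\<close>.
\<close>

section \<open>Functions on the upper half plane\<close>

text \<open>The exponents \<open>eps k p\<close> measure denominators. Write f = U P(j) with U =
  \<open>eis k\<close>. Modulo a power of p one has U(q^p) = U (1 + alpha/j + beta/j^2), so U(q^p)
  P(j(q^p)) acquires terms with a pole at j = 0: alpha P(0)/j, beta P(0)/j^2, and one from beta
  times the linear coefficient kappa of j(q^p) as a polynomial in j. They have to vanish, because
  the comparison of principal parts is available only inside U Z[j]. If d is the divisor known for
  P(0), then N must divide alpha d, beta d and beta kappa; for p = 2 and k = 4, alpha = 16 and d = 8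
  give 2^7.

  The analytic basis is one vanishing criterion with 21/2 in place of the 12 of the valence formula.
  It needs the maximum modulus principle only, no contour integral, and with one vanishing
  coefficient it still covers weights up to 10. Weight 14 is reduced to weight 2 by division by
  Delta. That Delta has no zeros is derived from a differential identity instead of the infinite
  product.\<close>

definition qq :: "complex \<Rightarrow> complex" where
  "qq \<tau> = exp (2 * of_real pi * \<i> * \<tau>)"

lemma norm_qq: "norm (qq \<tau>) = exp (- (2 * pi * Im \<tau>))"
  by (simp add: qq_def)

lemma invariant_shift_int:
  fixes h :: "complex \<Rightarrow> 'a"
  assumes "\<And>\<sigma>. Im \<sigma> = Im \<tau> \<Longrightarrow> h (\<sigma> + 1) = h \<sigma>"
  shows "h (\<tau> + of_int n) = h \<tau>"
proof (induction n rule: int_induct[where k = 0])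
  case base
  then show ?case by simp
next
  case (step1 i)
  have "h (\<tau> + of_int i + 1) = h (\<tau> + of_int i)"
    by (rule assms) simp
  with step1 show ?case by (simp add: add_ac)
next
  case (step2 i)
  have "h (\<tau> + of_int (i - 1) + 1) = h (\<tau> + of_int (i - 1))"
    by (rule assms) simp
  with step2 show ?case by (simp add: add_ac)
qed

lemma Im_minus_inverse: "Im (- 1 / \<tau>) = Im \<tau> / (norm \<tau>)\<^sup>2"
  by (simp add: Im_divide cmod_power2)

lemma minus_inverse_upper: "Im \<tau> > 0 \<Longrightarrow> Im (- 1 / \<tau>) > 0"
proof -
  assume "Im \<tau> > 0"
  hence "norm \<tau> > 0" by auto
  with \<open>Im \<tau> > 0\<close> show ?thesis by (simp only: Im_minus_inverse) simp
qed

lemma shift_to_strip: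
  obtains n :: int where "\<bar>Re (\<tau> + of_int n)\<bar> \<le> 1/2"
proof
  show "\<bar>Re (\<tau> + of_int (- round (Re \<tau>)))\<bar> \<le> 1/2"
    using of_int_round_abs_le[of "Re \<tau>"] by (simp add: abs_minus_commute)
qed

text \<open>If |Re \<sigma>| \<le> 1/2 and Im \<sigma> < 17/20, then |\<sigma>|^2 \<le> 1/4 +
  (17/20)^2 < 50/51, so passing to -1/\<sigma> raises the height at least by the factor 51/50.
  Taking 17/20 just below sqrt 3 / 2 gives this uniform gain, and finitely many steps suffice
  without a discreteness argument.\<close>

lemma reduction_to_fundamental_domain:
  fixes h :: "complex \<Rightarrow> 'a"
  assumes T: "\<And>\<tau>. Im \<tau> > 0 \<Longrightarrow> h (\<tau> + 1) = h \<tau>"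
    and S: "\<And>\<tau>. Im \<tau> > 0 \<Longrightarrow> h (- 1 / \<tau>) = h \<tau>"
    and \<tau>: "Im \<tau> > 0"
  shows "\<exists>\<sigma>. \<bar>Re \<sigma>\<bar> \<le> 1/2 \<and> Im \<sigma> \<ge> 17/20 \<and> h \<sigma> = h \<tau>"
proof -
  have *: "\<exists>\<sigma>. \<bar>Re \<sigma>\<bar> \<le> 1/2 \<and> Im \<sigma> \<ge> 17/20 \<and> h \<sigma> = h \<tau>"
    if "Im \<tau> > 0" "Im \<tau> * (51/50) ^ n \<ge> 17/20" for \<tau> n
    using that
  proof (induction n arbitrary: \<tau>)
    case 0
    obtain n :: int where "\<bar>Re (\<tau> + of_int n)\<bar> \<le> 1/2" by (rule shift_to_strip)
    moreover have "h (\<tau> + of_int n) = h \<tau>" by (rule invariant_shift_int) (use T 0 in simp)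
    ultimately show ?case using 0 by (intro exI[of _ "\<tau> + of_int n"]) auto
  next
    case (Suc n)
    obtain m :: int where m: "\<bar>Re (\<tau> + of_int m)\<bar> \<le> 1/2" by (rule shift_to_strip)
    define \<sigma> where "\<sigma> = \<tau> + of_int m"
    have h\<sigma>: "h \<sigma> = h \<tau>" unfolding \<sigma>_def by (rule invariant_shift_int) (use T Suc(2) in simp)
    have Im\<sigma>: "Im \<sigma> = Im \<tau>" by (simp add: \<sigma>_def)
    show ?case
    proof (cases "Im \<tau> \<ge> 17/20")
      case True
      with m h\<sigma> Im\<sigma> show ?thesis by (intro exI[of _ \<sigma>]) (auto simp: \<sigma>_def)
    next
      case False
      have "(Re \<sigma>)\<^sup>2 \<le> (1/2)\<^sup>2" using m by (intro abs_le_square_iff[THEN iffD1]) (simp add: \<sigma>_def)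
      moreover have "(Im \<sigma>)\<^sup>2 \<le> (17/20)\<^sup>2" using False Suc(2) Im\<sigma> by (intro power_mono) auto
      ultimately have n2: "(norm \<sigma>)\<^sup>2 \<le> 50/51"
        unfolding cmod_power2 by (simp add: power_divide)
      have pos: "(norm \<sigma>)\<^sup>2 > 0" using Suc(2) Im\<sigma> by auto
      have "Im (-1 / \<sigma>) \<ge> Im \<tau> * (51/50)"
      proof -
        have "Im \<tau> * (51/50) * (norm \<sigma>)\<^sup>2 \<le> Im \<tau> * (51/50) * (50/51)"
          using n2 Suc(2) by (intro mult_left_mono) auto
        thus ?thesis using pos by (simp only: Im_minus_inverse) (simp add: Im\<sigma> field_simps)
      qed
      moreover from this have "Im (-1 / \<sigma>) * (51/50) ^ n \<ge> Im \<tau> * (51/50) * (51/50) ^ n"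
        by (intro mult_right_mono) auto
      ultimately have "\<exists>\<rho>. \<bar>Re \<rho>\<bar> \<le> 1/2 \<and> Im \<rho> \<ge> 17/20 \<and> h \<rho> = h (-1/\<sigma>)"
        using Suc(2,3) by (intro Suc.IH) (auto simp: mult_ac)
      moreover have "h (-1/\<sigma>) = h \<tau>" using S[of \<sigma>] h\<sigma> Suc(2) Im\<sigma> by simp
      ultimately show ?thesis by simp
    qed
  qed
  obtain n where "(51/50::real) ^ n > 17/20 / Im \<tau>"
    using real_arch_pow[of "51/50::real"] by auto
  hence "Im \<tau> * (51/50) ^ n \<ge> 17/20" using \<tau> by (simp add: field_simps)
  with * \<tau> show ?thesis by blast
qed

section \<open>Maximum modulus and the vanishing criterion\<close>

lemma periodic_attains_max:
  fixes h :: "complex \<Rightarrow> real"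
  assumes cont: "continuous_on {\<tau>. Im \<tau> \<ge> y} h"
    and T: "\<And>\<tau>. Im \<tau> \<ge> y \<Longrightarrow> h (\<tau> + 1) = h \<tau>"
    and y0: "Im \<rho> \<ge> y"
    and small: "\<And>\<tau>. Im \<tau> > Y \<Longrightarrow> h \<tau> < h \<rho>"
  obtains \<tau>1 where "Im \<tau>1 \<ge> y" "\<And>\<tau>. Im \<tau> \<ge> y \<Longrightarrow> h \<tau> \<le> h \<tau>1"
proof -
  have Tn: "h (\<tau> + of_int n) = h \<tau>" if "Im \<tau> \<ge> y" for \<tau> n
    by (rule invariant_shift_int) (use that T in simp)
  have Y0: "Im \<rho> \<le> Y" using small[of \<rho>] by force
  define K where "K = cbox (Complex (-1/2) y) (Complex (1/2) Y)"
  have K: "\<tau> \<in> K \<longleftrightarrow> \<bar>Re \<tau>\<bar> \<le> 1/2 \<and> y \<le> Im \<tau> \<and> Im \<tau> \<le> Y" for \<tau>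
    by (auto simp: K_def in_cbox_complex_iff)
  obtain m :: int where m: "\<bar>Re (\<rho> + of_int m)\<bar> \<le> 1/2" by (rule shift_to_strip)
  have in0: "\<rho> + of_int m \<in> K" using m y0 Y0 by (subst K) auto
  have "continuous_on K h" by (rule continuous_on_subset[OF cont]) (auto simp: K)
  then obtain \<tau>1 where \<tau>1: "\<tau>1 \<in> K" "\<And>\<tau>. \<tau> \<in> K \<Longrightarrow> h \<tau> \<le> h \<tau>1"
    using continuous_attains_sup[of K h] in0 compact_cbox unfolding K_def by blast
  have "h \<tau> \<le> h \<tau>1" if "Im \<tau> \<ge> y" for \<tau>
  proof (cases "Im \<tau> \<le> Y")
    case True
    obtain m :: int where "\<bar>Re (\<tau> + of_int m)\<bar> \<le> 1/2" by (rule shift_to_strip)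
    hence "\<tau> + of_int m \<in> K" using True that by (subst K) auto
    from \<tau>1(2)[OF this] Tn[OF that] show ?thesis by simp
  next
    case False
    with small[of \<tau>] \<tau>1(2)[OF in0] Tn[OF y0, of m] show ?thesis by simp
  qed
  with \<tau>1(1) show ?thesis by (intro that[of \<tau>1]) (auto simp: K)
qed

text \<open>
  The function \<open>\<bar>f \<tau>\<bar> * Im \<tau> powr (k/2)\<close> is invariant and attains its maximum at some point of
  height at least \<open>17/20 < sqrt 3 / 2\<close>.  If the order of vanishing at the cusp is too large in
  comparison with \<open>k\<close>, this contradicts the maximum modulus principle for
  \<open>f \<tau> * exp (- 2 \<pi> \<i> s \<tau>)\<close> on a half plane containing that point.
\<close>
lemma modular_function_eq_0:
  fixes f :: "complex \<Rightarrow> complex" and k :: int and n :: nat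
  assumes holo: "f holomorphic_on {\<tau>. Im \<tau> > 0}"
    and T: "\<And>\<tau>. Im \<tau> > 0 \<Longrightarrow> f (\<tau> + 1) = f \<tau>"
    and S: "\<And>\<tau>. Im \<tau> > 0 \<Longrightarrow> f (- 1 / \<tau>) = \<tau> powi k * f \<tau>"
    and bound: "\<And>\<tau>. Im \<tau> > Y \<Longrightarrow> norm (f \<tau>) \<le> C * exp (- (2 * pi * real n * Im \<tau>))"
    and k: "2 * k \<le> 21 * int n" and n: "n > 0" and \<tau>: "Im \<tau> > 0"
  shows "f \<tau> = 0"
proof (rule ccontr)
  assume "f \<tau> \<noteq> 0"
  \<comment> \<open>Below n, so that \<open>g\<close> still tends to 0 at the cusp, but close enough
    to n for the slope estimate at the maximum of \<open>h\<close>.\<close>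
  define s where "s = 99/100 * real n"
  have s0: "s > 0" "s < real n" using n by (auto simp: s_def)
  define h where "h = (\<lambda>\<tau>. norm (f \<tau>) * Im \<tau> powr (k/2))"
  define g where "g = (\<lambda>\<tau>. f \<tau> * exp (- (2 * pi * s) * \<i> * \<tau>))"
  have ng: "norm (g \<tau>) = norm (f \<tau>) * exp (2 * pi * s * Im \<tau>)" for \<tau>
    by (simp add: g_def norm_mult)
  have C0: "C \<ge> 0"
  proof -
    have "0 \<le> C * exp (- (2 * pi * real n * (Y+1)))"
      using order_trans[OF norm_ge_zero bound[of "Complex 0 (Y+1)"]] by simp
    thus ?thesis by (simp add: zero_le_mult_iff)
  qed
  have hT: "h (\<tau> + 1) = h \<tau>" if "Im \<tau> > 0" for \<tau>
    using that by (simp add: h_def T)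
  have hS: "h (- 1 / \<tau>) = h \<tau>" if "Im \<tau> > 0" for \<tau>
  proof -
    have nz: "norm \<tau> > 0" using that by auto
    have "(norm \<tau>)\<^sup>2 powr (k/2) = (norm \<tau> powr 2) powr (k/2)"
      using nz by (subst powr_numeral) auto
    also have "\<dots> = norm \<tau> powr k" by (subst powr_powr) simp
    also have "\<dots> = norm \<tau> powi k" using nz by (simp add: powr_real_of_int')
    finally have eq: "(norm \<tau>)\<^sup>2 powr (k/2) = norm \<tau> powi k" .
    have "h (-1/\<tau>) = norm \<tau> powi k * norm (f \<tau>) * (Im \<tau> / (norm \<tau>)\<^sup>2) powr (k/2)"
      using that unfolding h_def S[OF that] Im_minus_inverse by (simp add: norm_mult norm_power_int)
    also have "\<dots> = norm \<tau> powi k * norm (f \<tau>) * (Im \<tau> powr (k/2) / norm \<tau> powi k)"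
      using that by (simp add: powr_divide eq)
    also have "\<dots> = h \<tau>" using nz by (simp add: h_def)
    finally show ?thesis .
  qed
  have holo_g: "g holomorphic_on {\<tau>. Im \<tau> > 0}"
    unfolding g_def by (intro holomorphic_intros holo)
  have contf: "continuous_on {\<tau>. Im \<tau> > 0} f" by (rule holomorphic_on_imp_continuous_on[OF holo])
  have contg: "continuous_on {\<tau>. Im \<tau> > 0} (\<lambda>\<tau>. norm (g \<tau>))"
    by (intro continuous_intros holomorphic_on_imp_continuous_on[OF holo_g])
  have conth: "continuous_on {\<tau>. Im \<tau> > 0} h"
    unfolding h_def by (intro continuous_intros contf) auto
  have lim1: "((\<lambda>y. C * exp (- (2 * pi * real n * y)) * y powr (k/2)) \<longlongrightarrow> 0) at_top"
  proof -
    have "((\<lambda>y. exp (- (b * y)) * y powr a) \<longlongrightarrow> 0) at_top" if "b > 0" for a b :: real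
      using that by real_asymp
    from tendsto_mult_right_zero[OF this[of "2 * pi * n" "k/2"], of C] n
    show ?thesis by (simp add: mult_ac)
  qed
  have lim2: "((\<lambda>y. C * exp (- (2 * pi * real n * y)) * exp (2 * pi * s * y)) \<longlongrightarrow> 0) at_top"
  proof -
    have "((\<lambda>y. exp (- (b * y))) \<longlongrightarrow> 0) at_top" if "b > 0" for b :: real
      using that by real_asymp
    from tendsto_mult_right_zero[OF this[of "2 * pi * (n - s)"], of C] s0
    show ?thesis by (simp add: algebra_simps flip: exp_add)
  qed
  have small_h: "\<exists>Y'. \<forall>\<tau>. Im \<tau> > Y' \<longrightarrow> h \<tau> < c" if "c > 0" for c
  proof -
    from order_tendstoD(2)[OF lim1 that] obtain N where
      N: "\<And>y. y \<ge> N \<Longrightarrow> C * exp (- (2 * pi * real n * y)) * y powr (k/2) < c"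
      by (auto simp: eventually_at_top_linorder)
    have "h \<tau> < c" if "Im \<tau> > max N (max Y 0)" for \<tau>
    proof -
      have "h \<tau> \<le> C * exp (- (2 * pi * real n * Im \<tau>)) * Im \<tau> powr (k/2)"
        unfolding h_def by (intro mult_right_mono bound) (use that in auto)
      also have "\<dots> < c" using that by (intro N) auto
      finally show ?thesis .
    qed
    thus ?thesis by blast
  qed
  have small_g: "\<exists>Y'. \<forall>\<tau>. Im \<tau> > Y' \<longrightarrow> norm (g \<tau>) < c" if "c > 0" for c
  proof -
    from order_tendstoD(2)[OF lim2 that] obtain N where
      N: "\<And>y. y \<ge> N \<Longrightarrow> C * exp (- (2 * pi * real n * y)) * exp (2 * pi * s * y) < c"
      by (auto simp: eventually_at_top_linorder)
    have "norm (g \<tau>) < c" if "Im \<tau> > max N (max Y 0)" for \<tau>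
    proof -
      have "norm (g \<tau>) \<le> C * exp (- (2 * pi * real n * Im \<tau>)) * exp (2 * pi * s * Im \<tau>)"
        unfolding ng by (intro mult_right_mono bound) (use that in auto)
      also have "\<dots> < c" using that by (intro N) auto
      finally show ?thesis .
    qed
    thus ?thesis by blast
  qed
  obtain \<tau>0 where \<tau>0: "Im \<tau>0 \<ge> 17/20" "h \<tau>0 = h \<tau>"
    using reduction_to_fundamental_domain[where h = h, OF hT hS \<tau>] by auto
  have "h \<tau> > 0" using \<tau> \<open>f \<tau> \<noteq> 0\<close> by (simp add: h_def)
  obtain Y1 where Y1: "\<And>\<sigma>. Im \<sigma> > Y1 \<Longrightarrow> h \<sigma> < h \<tau>0"
    using small_h[OF \<open>h \<tau> > 0\<close>] \<tau>0 by auto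
  obtain \<tau>1 where \<tau>1: "Im \<tau>1 \<ge> 17/20" "\<And>\<sigma>. Im \<sigma> \<ge> 17/20 \<Longrightarrow> h \<sigma> \<le> h \<tau>1"
    by (rule periodic_attains_max[where h = h and y = "17/20" and \<rho> = \<tau>0 and Y = Y1])
       (use Y1 \<tau>0 in \<open>auto intro!: hT continuous_on_subset[OF conth]\<close>)
  have hmax: "h \<sigma> \<le> h \<tau>1" if \<sigma>: "Im \<sigma> > 0" for \<sigma>
    using reduction_to_fundamental_domain[where h = h, OF hT hS \<sigma>] \<tau>1(2) by force
  have h1: "h \<tau>1 > 0" using hmax[OF \<tau>] \<open>h \<tau> > 0\<close> by linarith
  hence f1: "f \<tau>1 \<noteq> 0" by (auto simp: h_def)
  \<comment> \<open>|g| is h times exp of \<open>\<psi>\<close> at the height. As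
    \<open>\<psi>\<close> increases at the height of \<open>\<tau>1\<close>, where \<open>h\<close>
    is maximal, |g| is smaller on a line just below \<open>\<tau>1\<close> than at
    \<open>\<tau>1\<close>.\<close>
  define \<psi> where "\<psi> = (\<lambda>y::real. 2 * pi * s * y - k/2 * ln y)"
  have gh: "norm (g \<sigma>) = h \<sigma> * exp (\<psi> (Im \<sigma>))" if "Im \<sigma> > 0" for \<sigma>
    using that by (simp add: ng h_def \<psi>_def powr_def exp_diff)
  have "(\<psi> has_real_derivative 2 * pi * s - k/2 * (1 / Im \<tau>1)) (at (Im \<tau>1))"
    unfolding \<psi>_def using \<tau>1(1) by (auto intro!: derivative_eq_intros)
  \<comment> \<open>The constant 21 is calibrated here: at height 17/20 or more the second term is
    at most 21/4 times 20/17, that is 105/17 < 6.18, times n, while 2 times 3.14 times 0.99 exceeds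
    6.21.\<close>
  moreover have "2 * pi * s - k/2 * (1 / Im \<tau>1) > 0"
  proof -
    have "pi \<ge> 314/100" using pi_approx by simp
    hence "pi * real n \<ge> 314/100 * real n" by (intro mult_right_mono) auto
    hence 1: "2 * pi * s > 105/17 * real n" unfolding s_def using n by simp
    have "real_of_int (2 * k) \<le> real_of_int (21 * int n)" using k by (subst of_int_le_iff)
    hence kn: "k/2 \<le> 21/4 * real n" by simp
    have "k/2 * (1 / Im \<tau>1) \<le> 21/4 * real n * (1 / Im \<tau>1)"
      by (intro mult_right_mono kn) (use \<tau>1(1) in auto)
    also have "\<dots> \<le> 21/4 * real n * (20/17)"
      by (intro mult_left_mono) (use \<tau>1(1) in \<open>auto simp: field_simps\<close>)
    finally show ?thesis using 1 by simp
  qed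
  ultimately obtain d where d: "d > 0" "\<And>t. t > 0 \<Longrightarrow> t < d \<Longrightarrow> \<psi> (Im \<tau>1 - t) < \<psi> (Im \<tau>1)"
    using DERIV_pos_inc_left by blast
  define t where "t = min (d/2) (1/2)"
  define y where "y = Im \<tau>1 - t"
  have y: "y > 0" "y < Im \<tau>1" "\<psi> y < \<psi> (Im \<tau>1)"
    using d \<tau>1(1) by (auto simp: y_def t_def min_def)
  have g1: "norm (g \<tau>1) > 0" using f1 by (simp add: ng)
  obtain Y2 where Y2: "\<And>\<sigma>. Im \<sigma> > Y2 \<Longrightarrow> norm (g \<sigma>) < norm (g \<tau>1)"
    using small_g[OF g1] by blast
  have gT: "norm (g (\<sigma> + 1)) = norm (g \<sigma>)" if "Im \<sigma> > 0" for \<sigma>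
    using that by (simp add: ng T)
  obtain \<tau>2 where \<tau>2: "Im \<tau>2 \<ge> y" "\<And>\<sigma>. Im \<sigma> \<ge> y \<Longrightarrow> norm (g \<sigma>) \<le> norm (g \<tau>2)"
    by (rule periodic_attains_max[where h = "\<lambda>\<sigma>. norm (g \<sigma>)" and y = y and \<rho> = \<tau>1 and Y = Y2])
       (use Y2 y gT in \<open>auto intro!: continuous_on_subset[OF contg]\<close>)
  have g12: "norm (g \<tau>1) \<le> norm (g \<tau>2)" using y by (intro \<tau>2) auto
  show False
  \<comment> \<open>The maximum of |g| on Im \<ge> y lies on the lower edge, which the choice of
    \<open>y\<close> excludes, or inside; then \<open>g\<close> is constant, against its decay at
    the cusp.\<close>
  proof (cases "Im \<tau>2 = y")
    case True
    have "norm (g \<tau>2) \<le> h \<tau>1 * exp (\<psi> y)"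
      using gh[of \<tau>2] True y hmax[of \<tau>2] by (auto intro!: mult_right_mono)
    also have "\<dots> < h \<tau>1 * exp (\<psi> (Im \<tau>1))" using y h1 by simp
    also have "\<dots> = norm (g \<tau>1)" using gh[of \<tau>1] y by simp
    finally show False using g12 by simp
  next
    case False
    let ?U = "{\<sigma>. Im \<sigma> > y}"
    have opn: "open ?U" by (rule open_halfspace_Im_gt)
    have conn: "connected ?U" by (intro convex_connected convex_halfspace_Im_gt)
    have "g constant_on ?U"
      by (rule maximum_modulus_principle[of g ?U ?U \<tau>2])
         (use opn conn False \<tau>2 y in \<open>auto intro!: holomorphic_on_subset[OF holo_g]\<close>)
    then obtain c where c: "\<And>\<sigma>. Im \<sigma> > y \<Longrightarrow> g \<sigma> = c" by (auto simp: constant_on_def)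
    have "norm (g (Complex 0 (max Y2 y + 1))) < norm (g \<tau>1)" by (intro Y2) auto
    moreover have "g (Complex 0 (max Y2 y + 1)) = c" by (intro c) auto
    moreover have "g \<tau>1 = c" using y by (intro c) auto
    ultimately show False by simp
  qed
qed

section \<open>Eisenstein series\<close>

text \<open>The case distinction matters for n = 0 only, where \<open>0 ^ 0 = 1\<close> would add a
  constant term. Thus \<open>pow_fps 0\<close> is q/(1 - q), and each application of q d/dq raises
  the exponent by one.\<close>

definition pow_fps :: "nat \<Rightarrow> complex fps" where
  "pow_fps n = Abs_fps (\<lambda>d. if d = 0 then 0 else of_nat d ^ n)"

lemma in_unit_conv_radius:
  "norm (z :: complex) < 1 \<Longrightarrow> fps_conv_radius f \<ge> 1 \<Longrightarrow> ereal (norm z) < fps_conv_radius f"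
  using less_le_trans[of "ereal (norm z)" 1 "fps_conv_radius f"] by simp

lemma X_deriv_pow_fps: "fps_X * fps_deriv (pow_fps n) = pow_fps (Suc n)"
  by (rule fps_ext) (auto simp: pow_fps_def)

lemma conv_radius_pow_fps: "fps_conv_radius (pow_fps n) \<ge> 1"
proof (induction n)
  case 0
  have "summable (\<lambda>d. (if d = 0 then 0 else of_nat d ^ 0) * complex_of_real r ^ d)"
    if "0 < r" "ereal r < 1" for r
    by (rule summable_comparison_test'[of "\<lambda>d. r ^ d" 0])
       (use that in \<open>auto intro!: summable_geometric simp: norm_power\<close>)
  thus ?case unfolding fps_conv_radius_def pow_fps_def
    by (intro conv_radius_geI_ex') simp
next
  case (Suc n)
  have "min \<infinity> (fps_conv_radius (pow_fps n)) \<le>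
          min (fps_conv_radius (fps_X :: complex fps)) (fps_conv_radius (fps_deriv (pow_fps n)))"
    by (intro min.mono fps_conv_radius_deriv) auto
  also have "\<dots> \<le> fps_conv_radius (fps_X * fps_deriv (pow_fps n))"
    by (rule fps_conv_radius_mult)
  finally show ?case using Suc by (simp add: X_deriv_pow_fps)
qed

lemma conv_radius_ge_1I:
  fixes f :: "complex fps"
  assumes "\<And>d. norm (fps_nth f d) \<le> real d ^ n"
  shows "fps_conv_radius f \<ge> 1"
proof -
  have "summable (\<lambda>d. fps_nth f d * complex_of_real r ^ d)" if r: "0 < r" "ereal r < 1" for r
  proof (rule summable_comparison_test')
    have "ereal (norm r) < fps_conv_radius (pow_fps n)"
      using r in_unit_conv_radius[OF _ conv_radius_pow_fps[of n], of "complex_of_real r"] by simp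
    hence "norm (complex_of_real r) < conv_radius (fps_nth (pow_fps n))"
      by (simp add: fps_conv_radius_def)
    from abs_summable_in_conv_radius[OF this]
    show "summable (\<lambda>d. norm (fps_nth (pow_fps n) d * complex_of_real r ^ d))" .
    fix d :: nat assume "d \<ge> 1"
    thus "norm (fps_nth f d * complex_of_real r ^ d) \<le> norm (fps_nth (pow_fps n) d * complex_of_real r ^ d)"
      using assms[of d] unfolding norm_mult
      by (intro mult_right_mono) (auto simp: pow_fps_def norm_power)
  qed
  thus ?thesis unfolding fps_conv_radius_def by (intro conv_radius_geI_ex') simp
qed

lemma norm_qq_less_1: "Im \<tau> > 0 \<Longrightarrow> norm (qq \<tau>) < 1"
  by (simp add: norm_qq)

lemma qq_nonzero [simp]: "qq \<tau> \<noteq> 0"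
  by (simp add: qq_def)

lemma qq_plus_1 [simp]: "qq (\<tau> + 1) = qq \<tau>"
  by (simp add: qq_def ring_distribs exp_add mult_ac)

lemma qq_of_nat_mult: "qq (of_nat n * \<tau>) = qq \<tau> ^ n"
  by (simp add: qq_def exp_of_nat_mult [symmetric] mult_ac)

lemma has_field_derivative_qq:
  "(qq has_field_derivative 2 * of_real pi * \<i> * qq \<tau>) (at \<tau> within A)"
  unfolding qq_def by (auto intro!: derivative_eq_intros)

lemma holomorphic_qq: "qq holomorphic_on A"
  unfolding qq_def by (intro holomorphic_intros)

section \<open>The cotangent series through polygamma functions\<close>

lemma not_nonpos_Int_upper: "Im z \<noteq> 0 \<Longrightarrow> z \<notin> \<int>\<^sub>\<le>\<^sub>0"
  by (auto elim!: nonpos_Ints_cases)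

text \<open>The logarithmic derivative of Gamma(z) Gamma(1 - z) sin(pi z) = pi yields -pi cot(pi z),
  and on the upper half plane the cotangent is a geometric series in e^(2 pi i z).\<close>

lemma Polygamma_reflection_0:
  assumes z: "Im z > 0"
  shows "Polygamma 0 z - Polygamma 0 (1 - z) =
           2 * of_real pi * \<i> * eval_fps (pow_fps 0) (qq z) + of_real pi * \<i>"
proof -
  have ni: "z \<notin> \<int>\<^sub>\<le>\<^sub>0" "1 - z \<notin> \<int>\<^sub>\<le>\<^sub>0" using z by (auto intro!: not_nonpos_Int_upper)
  have sin0: "sin (of_real pi * w) \<noteq> 0" if "Im w > 0" for w
  proof
    assume "sin (of_real pi * w) = 0"
    then obtain n :: int where "of_real pi * w = of_real (of_int n * pi)"
      by (auto simp: sin_eq_0)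
    hence "Im (of_real pi * w) = 0" by simp
    thus False using that by simp
  qed
  have "((\<lambda>w. Gamma w * Gamma (1 - w) * sin (of_real pi * w)) has_field_derivative
          (Gamma z * Polygamma 0 z * Gamma (1 - z) - Gamma z * (Gamma (1 - z) * Polygamma 0 (1 - z)))
             * sin (of_real pi * z) + Gamma z * Gamma (1 - z) * (cos (of_real pi * z) * of_real pi)) (at z)"
    using ni by (auto intro!: derivative_eq_intros simp: algebra_simps)
  moreover have "((\<lambda>w. Gamma w * Gamma (1 - w) * sin (of_real pi * w)) has_field_derivative 0) (at z)"
  proof (rule has_field_derivative_transform_within_open)
    show "((\<lambda>_. of_real pi) has_field_derivative (0::complex)) (at z)" by simp
    show "open {w. Im w > 0}" by (rule open_halfspace_Im_gt)
  qed (use z sin0 in \<open>auto simp: Gamma_reflection_complex\<close>)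
  ultimately have eq: "(Gamma z * Polygamma 0 z * Gamma (1 - z) - Gamma z * (Gamma (1 - z) * Polygamma 0 (1 - z)))
             * sin (of_real pi * z) + Gamma z * Gamma (1 - z) * (cos (of_real pi * z) * of_real pi) = 0"
    by (rule DERIV_unique)
  have "Gamma z * Gamma (1 - z) \<noteq> 0" using ni by (simp add: Gamma_eq_zero_iff)
  moreover from eq have "Gamma z * Gamma (1 - z) *
     ((Polygamma 0 z - Polygamma 0 (1 - z)) * sin (of_real pi * z) + cos (of_real pi * z) * of_real pi) = 0"
    by (simp add: algebra_simps)
  ultimately have eq2: "(Polygamma 0 z - Polygamma 0 (1 - z)) * sin (of_real pi * z) =
      - (of_real pi * cos (of_real pi * z))"
    by (simp add: add_eq_0_iff2 mult_ac)
  define e where "e = exp (\<i> * (of_real pi * z))"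
  have e0: "e \<noteq> 0" by (simp add: e_def)
  have qe: "qq z = e\<^sup>2" by (simp add: qq_def e_def exp_double [symmetric] mult_ac)
  have s: "sin (of_real pi * z) = (e - 1 / e) / (2 * \<i>)"
    by (simp add: sin_exp_eq e_def exp_minus inverse_eq_divide)
  have c: "cos (of_real pi * z) = (e + 1 / e) / 2"
    by (simp add: cos_exp_eq e_def exp_minus inverse_eq_divide)
  have q1: "qq z \<noteq> 1" using norm_qq_less_1[OF z] by auto
  have val: "eval_fps (pow_fps 0) (qq z) = qq z / (1 - qq z)"
  proof -
    have "(\<lambda>d. qq z * qq z ^ d) sums (qq z * (1 / (1 - qq z)))"
      by (intro sums_mult geometric_sums norm_qq_less_1 z)
    moreover have "(\<lambda>d. fps_nth (pow_fps 0) d * qq z ^ d) sums eval_fps (pow_fps 0) (qq z)"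
      by (intro sums_eval_fps in_unit_conv_radius norm_qq_less_1 z conv_radius_pow_fps)
    hence "(\<lambda>d. fps_nth (pow_fps 0) (Suc d) * qq z ^ Suc d) sums eval_fps (pow_fps 0) (qq z)"
      by (subst sums_Suc_iff) (simp add: pow_fps_def)
    ultimately show ?thesis by (auto simp: pow_fps_def dest: sums_unique2)
  qed
  have "2 * of_real pi * \<i> * eval_fps (pow_fps 0) (qq z) + of_real pi * \<i> =
          of_real pi * \<i> * (1 + e\<^sup>2) / (1 - e\<^sup>2)"
    using q1 unfolding val unfolding qe by (simp add: field_simps)
  moreover have "Polygamma 0 z - Polygamma 0 (1 - z) = of_real pi * \<i> * (1 + e\<^sup>2) / (1 - e\<^sup>2)"
  proof -
    define X where "X = Polygamma 0 z - Polygamma 0 (1 - z)"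
    have eq3: "X * ((e - 1 / e) / (2 * \<i>)) = - (of_real pi * ((e + 1 / e) / 2))"
      using eq2 unfolding X_def by (simp only: s c)
    have "X * (1 - e\<^sup>2) = - (X * ((e - 1 / e) / (2 * \<i>))) * (2 * \<i> * e)"
      using e0 by (simp add: field_simps power2_eq_square)
    also have "\<dots> = of_real pi * \<i> * (1 + e\<^sup>2)"
      unfolding eq3 using e0 by (simp add: field_simps power2_eq_square)
    finally have "(Polygamma 0 z - Polygamma 0 (1 - z)) * (1 - e\<^sup>2) = of_real pi * \<i> * (1 + e\<^sup>2)"
      unfolding X_def .
    thus ?thesis using q1 by (simp add: qe eq_divide_eq)
  qed
  ultimately show ?thesis by simp
qed

text \<open>Induction by differentiation: d/dz acts on series in \<open>qq z\<close> as 2 pi i q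
  d/dq, the sign comes from the inner derivative of 1 - z, and the constant pi i disappears after
  one step.\<close>

lemma Polygamma_reflection:
  assumes "Im z > 0"
  shows "Polygamma n z - (-1) ^ n * Polygamma n (1 - z) =
           (2 * of_real pi * \<i>) ^ Suc n * eval_fps (pow_fps n) (qq z) + (if n = 0 then of_real pi * \<i> else 0)"
  using assms
proof (induction n arbitrary: z)
  case 0
  thus ?case using Polygamma_reflection_0[of z] by simp
next
  case (Suc n)
  have ni: "z \<notin> \<int>\<^sub>\<le>\<^sub>0" "1 - z \<notin> \<int>\<^sub>\<le>\<^sub>0" using Suc(2) by (auto intro!: not_nonpos_Int_upper)
  have q: "ereal (norm (qq z)) < fps_conv_radius (pow_fps n)"
    by (intro in_unit_conv_radius norm_qq_less_1 conv_radius_pow_fps Suc)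
  have q': "ereal (norm (qq z)) < fps_conv_radius (fps_deriv (pow_fps n))"
    using q fps_conv_radius_deriv[of "pow_fps n"] by (rule less_le_trans)
  let ?L = "\<lambda>w. Polygamma n w - (-1) ^ n * Polygamma n (1 - w)"
  let ?R = "\<lambda>w. (2 * of_real pi * \<i>) ^ Suc n * eval_fps (pow_fps n) (qq w) + (if n = 0 then of_real pi * \<i> else 0)"
  have "(?L has_field_derivative Polygamma (Suc n) z - (-1) ^ Suc n * Polygamma (Suc n) (1 - z)) (at z)"
    using ni by (auto intro!: derivative_eq_intros)
  moreover have "(?R has_field_derivative (2 * of_real pi * \<i>) ^ Suc n *
      (eval_fps (fps_deriv (pow_fps n)) (qq z) * (2 * of_real pi * \<i> * qq z)) + 0) (at z)"
    by (intro DERIV_add DERIV_cmult DERIV_chain2[OF has_field_derivative_eval_fps has_field_derivative_qq] q DERIV_const)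
  hence "(?L has_field_derivative (2 * of_real pi * \<i>) ^ Suc n *
      (eval_fps (fps_deriv (pow_fps n)) (qq z) * (2 * of_real pi * \<i> * qq z)) + 0) (at z)"
    by (rule has_field_derivative_transform_within_open[OF _ open_halfspace_Im_gt[of 0]])
       (use Suc.IH Suc(2) in auto)
  ultimately have "Polygamma (Suc n) z - (-1) ^ Suc n * Polygamma (Suc n) (1 - z) =
     (2 * of_real pi * \<i>) ^ Suc n * (eval_fps (fps_deriv (pow_fps n)) (qq z) * (2 * of_real pi * \<i> * qq z)) + 0"
    by (rule DERIV_unique)
  also have "eval_fps (pow_fps (Suc n)) (qq z) = qq z * eval_fps (fps_deriv (pow_fps n)) (qq z)"
    using q' by (subst X_deriv_pow_fps [symmetric], subst eval_fps_mult) auto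
  hence "(2 * of_real pi * \<i>) ^ Suc n * (eval_fps (fps_deriv (pow_fps n)) (qq z) * (2 * of_real pi * \<i> * qq z)) + 0
     = (2 * of_real pi * \<i>) ^ Suc (Suc n) * eval_fps (pow_fps (Suc n)) (qq z) + (if Suc n = 0 then of_real pi * \<i> else 0)"
    by simp
  finally show ?case .
qed

section \<open>Absolute convergence of the lattice sum\<close>

lemma quadratic_form_lower_bound:
  assumes "Im \<tau> > 0"
  obtains c :: real where "c > 0"
    "\<And>m n :: int. c * (of_int m ^ 2 + of_int n ^ 2) \<le> (norm (of_int m * \<tau> + of_int n)) ^ 2"
proof
  define x y where "x = Re \<tau>" and "y = Im \<tau>"
  \<comment> \<open>\<open>K\<close> collects the constants in b^2 \<le> 2 (a x + b)^2 + 2 (a x)^2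
    and a^2 (1 + 2 x^2) = (1 + 2 x^2)/y^2 (a y)^2.\<close>
  define K where "K = 2 + (1 + 2 * x\<^sup>2) / y\<^sup>2"
  have y: "y > 0" using assms by (simp add: y_def)
  have K: "K > 0" unfolding K_def by (intro add_pos_nonneg) auto
  show "1 / K > 0" using K by simp
  fix m n :: int
  define a b :: real where "a = of_int m" and "b = of_int n"
  have "(norm (of_int m * \<tau> + of_int n)) ^ 2 = (a * x + b)\<^sup>2 + (a * y)\<^sup>2"
    by (simp add: cmod_power2 a_def b_def x_def y_def)
  moreover have "a\<^sup>2 + b\<^sup>2 \<le> K * ((a * x + b)\<^sup>2 + (a * y)\<^sup>2)"
  proof -
    have "b\<^sup>2 \<le> 2 * (a * x + b)\<^sup>2 + 2 * (a * x)\<^sup>2"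
      using zero_le_power2[of "2 * a * x + b"] by (simp add: power2_eq_square algebra_simps)
    hence "a\<^sup>2 + b\<^sup>2 \<le> 2 * (a * x + b)\<^sup>2 + (1 + 2 * x\<^sup>2) / y\<^sup>2 * (a * y)\<^sup>2"
    proof -
      have "(1 + 2 * x\<^sup>2) / y\<^sup>2 * (a * y)\<^sup>2 = a\<^sup>2 + 2 * (a * x)\<^sup>2"
        using y by (simp add: power_mult_distrib field_simps)
      thus ?thesis using \<open>b\<^sup>2 \<le> _\<close> by linarith
    qed
    also have "\<dots> \<le> K * (a * x + b)\<^sup>2 + K * (a * y)\<^sup>2"
      unfolding K_def by (intro add_mono mult_right_mono) auto
    finally show ?thesis by (simp add: algebra_simps)
  qed
  ultimately show "1 / K * (of_int m ^ 2 + of_int n ^ 2) \<le> (norm (of_int m * \<tau> + of_int n)) ^ 2"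
    using K by (simp add: a_def b_def field_simps)
qed

lemma summable_on_int_inverse_square: "(\<lambda>n :: int. 1 / (1 + real_of_int n ^ 2)) summable_on UNIV"
proof -
  have nat: "(\<lambda>n :: nat. 1 / (1 + real n ^ 2)) summable_on UNIV"
  proof (rule norm_summable_imp_summable_on, rule summable_comparison_test')
    show "summable (\<lambda>n. inverse (real n ^ 2))" by (rule inverse_power_summable) simp
    fix n :: nat assume "n \<ge> 1"
    thus "norm (norm (1 / (1 + real n ^ 2))) \<le> inverse (real n ^ 2)"
      using divide_left_mono[of "real n ^ 2" "1 + real n ^ 2" 1]
      by (simp add: inverse_eq_divide add_pos_nonneg)
  qed
  have "(\<lambda>n :: int. 1 / (1 + real_of_int n ^ 2)) summable_on (range int)"
    using nat by (subst summable_on_reindex) (auto simp: o_def)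
  moreover have "(\<lambda>n :: int. 1 / (1 + real_of_int n ^ 2)) summable_on ((\<lambda>n. - int n) ` {1..})"
    using summable_on_subset[OF nat, of "{1..}"]
    by (subst summable_on_reindex) (auto simp: o_def inj_on_def)
  moreover have "range int \<inter> (\<lambda>n. - int n) ` {1..} = {}" by auto
  ultimately have "(\<lambda>n :: int. 1 / (1 + real_of_int n ^ 2)) summable_on (range int \<union> (\<lambda>n. - int n) ` {1..})"
    by (rule summable_on_Un_disjoint)
  also have "range int \<union> (\<lambda>n. - int n) ` {1..} = UNIV"
  proof (rule UNIV_eq_I [symmetric])
    fix n :: int
    show "n \<in> range int \<union> (\<lambda>n. - int n) ` {1..}"
    proof (cases "n \<ge> 0")
      case True
      then show ?thesis by (auto simp: image_iff intro!: exI[of _ "nat n"])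
    next
      case False
      then show ?thesis by (auto simp: image_iff intro!: bexI[of _ "nat (-n)"])
    qed
  qed
  finally show ?thesis .
qed

text \<open>For a = m^2 and b = n^2 with a + b \<ge> 1 one has (1 + a)(1 + b) \<le> 3 (a + b)^2. The
  summand is thus dominated by a product of functions of m and of n, and summability over pairs
  reduces to one-dimensional series. The pair (0, 0) contributes 1/0 = 0.\<close>

lemma summable_on_lattice:
  assumes \<tau>: "Im \<tau> > 0" and j: "j \<ge> 2"
  shows "(\<lambda>(m :: int, n :: int). 1 / (of_int m * \<tau> + of_int n) ^ (2 * j)) summable_on UNIV"
proof -
  obtain c :: real where c: "c > 0"
    "\<And>m n :: int. c * (of_int m ^ 2 + of_int n ^ 2) \<le> (norm (of_int m * \<tau> + of_int n)) ^ 2"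
    using quadratic_form_lower_bound[OF \<tau>] by metis
  define g where "g = (\<lambda>n :: int. 1 / (1 + real_of_int n ^ 2))"
  define S where "S = infsum g UNIV"
  have gs: "(g has_sum S) UNIV"
    unfolding S_def g_def by (intro has_sum_infsum summable_on_int_inverse_square)
  have "(\<lambda>(m, n). g m * g n) summable_on (UNIV \<times> UNIV)"
  proof (rule summable_on_SigmaI)
    show "((\<lambda>n. case (m, n) of (m, n) \<Rightarrow> g m * g n) has_sum g m * S) UNIV" for m
      using has_sum_cmult_right[OF gs, of "g m"] by simp
    show "(\<lambda>m. g m * S) summable_on UNIV"
      using has_sum_cmult_left[OF gs, of S] by (rule has_sum_imp_summable)
  qed (auto simp: g_def)
  hence "(\<lambda>p. (3 / c ^ j) * (case p of (m, n) \<Rightarrow> g m * g n)) summable_on UNIV"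
    by (intro summable_on_cmult_right) simp
  hence "(\<lambda>p. norm (case p of (m :: int, n :: int) \<Rightarrow> 1 / (of_int m * \<tau> + of_int n) ^ (2 * j))) summable_on UNIV"
  proof (rule Infinite_Sum.abs_summable_on_comparison_test')
    fix p :: "int \<times> int"
    obtain m n where p: "p = (m, n)" by force
    show "norm (case p of (m, n) \<Rightarrow> 1 / (of_int m * \<tau> + of_int n) ^ (2 * j)) \<le>
            (3 / c ^ j) * (case p of (m, n) \<Rightarrow> g m * g n)"
    proof (cases "m = 0 \<and> n = 0")
      case True
      thus ?thesis using c j by (simp add: p g_def power_0_left)
    next
      case False
      define r :: real where "r = of_int m ^ 2 + of_int n ^ 2"
      have "m\<^sup>2 + n\<^sup>2 \<ge> 1" using False by (smt (verit) zero_less_power2 zero_le_power2)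
      hence "real_of_int (m\<^sup>2 + n\<^sup>2) \<ge> 1" by linarith
      hence r: "r \<ge> 1" by (simp add: r_def)
      have "c ^ j * r ^ 2 \<le> c ^ j * r ^ j"
        using r j c by (intro mult_left_mono power_increasing) auto
      also have "\<dots> = (c * r) ^ j" by (simp add: power_mult_distrib)
      also have "\<dots> \<le> ((norm (of_int m * \<tau> + of_int n)) ^ 2) ^ j"
        using c(1) r c(2)[of m n] by (intro power_mono) (auto simp: r_def)
      finally have 1: "c ^ j * r ^ 2 \<le> (norm (of_int m * \<tau> + of_int n)) ^ (2 * j)"
        by (simp add: power_mult)
      have "1 / (norm (of_int m * \<tau> + of_int n)) ^ (2 * j) \<le> 1 / (c ^ j * r ^ 2)"
        using 1 c(1) r by (intro divide_left_mono mult_pos_pos) (auto intro: less_le_trans[OF _ 1])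
      also have "\<dots> \<le> (3 / c ^ j) * (g m * g n)"
      proof -
        define a b :: real where "a = of_int m ^ 2" and "b = of_int n ^ 2"
        have ab: "a \<ge> 0" "b \<ge> 0" "a + b \<ge> 1" using r by (auto simp: a_def b_def r_def)
        have "(1 + a) * (1 + b) \<le> 3 * (a + b)\<^sup>2"
        proof -
          have "a + b \<le> (a + b)\<^sup>2" using ab by (simp add: power2_eq_square)
          moreover have "a * b \<le> (a + b)\<^sup>2" using ab by (simp add: power2_eq_square algebra_simps)
          ultimately show ?thesis using ab by (simp add: algebra_simps)
        qed
        hence "3 / (3 * (a + b)\<^sup>2) \<le> 3 / ((1 + a) * (1 + b))"
          using ab by (intro divide_left_mono mult_pos_pos) auto
        hence "1 / (a + b)\<^sup>2 \<le> 3 / ((1 + a) * (1 + b))" by simp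
        hence "1 / c ^ j * (1 / (a + b)\<^sup>2) \<le> 1 / c ^ j * (3 / ((1 + a) * (1 + b)))"
          using c by (intro mult_left_mono) auto
        thus ?thesis by (simp add: g_def a_def b_def r_def)
      qed
      finally show ?thesis by (simp add: p norm_divide norm_power)
    qed
  qed
  thus ?thesis by (rule Infinite_Sum.abs_summable_summable)
qed

section \<open>Lipschitz's formula and Lambert series\<close>

definition lipschitz_const :: "nat \<Rightarrow> complex" where
  "lipschitz_const k = (2 * of_real pi * \<i>) ^ k / fact (k - 1)"

text \<open>The terms with n \<ge> 0 and with n < 0 are the polygamma series of order 2 j - 1 at z
  and at 1 - z. As this order is odd, the reflection formula evaluates their sum.\<close>

lemma lipschitz_formula:
  assumes z: "Im z > 0" and j: "j \<ge> 2"
  shows "((\<lambda>n :: int. 1 / (z + of_int n) ^ (2 * j)) has_sum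
           lipschitz_const (2 * j) * eval_fps (pow_fps (2 * j - 1)) (qq z)) UNIV"
proof -
  define f where "f = (\<lambda>n :: int. 1 / (z + of_int n) ^ (2 * j))"
  define N where "N = 2 * j - 1"
  have N: "2 * j = Suc N" "odd N" "N > 0" using j by (auto simp: N_def)
  have "(\<lambda>(m :: int, n :: int). 1 / (of_int m * z + of_int n) ^ (2 * j)) summable_on (Sigma UNIV (\<lambda>_. UNIV))"
    using summable_on_lattice[OF z j] by simp
  from summable_on_SigmaD1[OF this, of 1] have "f summable_on UNIV"
    by (simp add: f_def)
  hence sub: "f summable_on A" for A by (rule summable_on_subset) auto
  have ni: "z \<noteq> 0" "1 - z \<noteq> 0" using z by (auto simp: complex_eq_iff)
  have "infsum f (range int) = (-1) ^ Suc N * Polygamma N z / fact N"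
  proof -
    have "((\<lambda>n. f (int n)) has_sum infsum f (range int)) UNIV"
      using has_sum_infsum[OF sub, of "range int"] by (subst (asm) has_sum_reindex) (auto simp: o_def)
    hence "(\<lambda>n. f (int n)) sums infsum f (range int)" by (rule has_sum_imp_sums)
    moreover have "(\<lambda>n. f (int n)) sums ((-1) ^ Suc N * Polygamma N z / fact N)"
      using Polygamma_LIMSEQ[OF ni(1) N(3)] by (simp add: f_def N inverse_eq_divide)
    ultimately show ?thesis by (rule sums_unique2)
  qed
  moreover have "infsum f (range (\<lambda>n. - 1 - int n)) = (-1) ^ Suc N * Polygamma N (1 - z) / fact N"
  proof -
    have "((\<lambda>n. f (- 1 - int n)) has_sum infsum f (range (\<lambda>n. - 1 - int n))) UNIV"
      using has_sum_infsum[OF sub, of "range (\<lambda>n. - 1 - int n)"]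
      by (subst (asm) has_sum_reindex) (auto simp: o_def inj_on_def)
    hence "(\<lambda>n. f (- 1 - int n)) sums infsum f (range (\<lambda>n. - 1 - int n))" by (rule has_sum_imp_sums)
    moreover have "f (- 1 - int n) = inverse ((1 - z + of_nat n) ^ Suc N)" for n
    proof -
      have "(z + of_int (- 1 - int n)) ^ (2 * j) = (- (z + of_int (- 1 - int n))) ^ (2 * j)"
        by (metis even_mult_iff even_numeral power_minus_even)
      also have "- (z + of_int (- 1 - int n)) = 1 - z + of_nat n" by simp
      finally show ?thesis by (simp add: f_def N(1) inverse_eq_divide)
    qed
    hence "(\<lambda>n. f (- 1 - int n)) sums ((-1) ^ Suc N * Polygamma N (1 - z) / fact N)"
      using Polygamma_LIMSEQ[OF ni(2) N(3)] by simp
    ultimately show ?thesis by (rule sums_unique2)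
  qed
  moreover have "infsum f (range int \<union> range (\<lambda>n. - 1 - int n)) =
      infsum f (range int) + infsum f (range (\<lambda>n. - 1 - int n))"
    by (rule infsum_Un_disjoint) (auto intro: sub)
  moreover have "range int \<union> range (\<lambda>n. - 1 - int n) = UNIV"
  proof (rule UNIV_eq_I [symmetric])
    fix n :: int
    show "n \<in> range int \<union> range (\<lambda>n. - 1 - int n)"
    proof (cases "n \<ge> 0")
      case True
      then show ?thesis by (auto simp: image_iff intro!: exI[of _ "nat n"])
    next
      case False
      then show ?thesis by (auto simp: image_iff intro!: exI[of _ "nat (-n - 1)"])
    qed
  qed
  ultimately have "infsum f UNIV = (Polygamma N z + Polygamma N (1 - z)) / fact N"
    using N by (simp add: add_divide_distrib)
  also have "Polygamma N z + Polygamma N (1 - z) = (2 * of_real pi * \<i>) ^ Suc N * eval_fps (pow_fps N) (qq z)"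
    using Polygamma_reflection[OF z, of N] N by simp
  also have "\<dots> / fact N = lipschitz_const (2 * j) * eval_fps (pow_fps N) (qq z)"
    unfolding lipschitz_const_def N(1) by simp
  finally have "infsum f UNIV = lipschitz_const (2 * j) * eval_fps (pow_fps N) (qq z)" .
  thus ?thesis using has_sum_infsum[OF sub, of UNIV] unfolding f_def N_def by simp
qed

text \<open>Every number divides 0, so for n = 0 the sum ranges over an infinite set and is 0; hence
  \<open>sigma_fps\<close> has no constant term.\<close>

definition divisor_sum :: "nat \<Rightarrow> nat \<Rightarrow> nat" where
  "divisor_sum k n = (\<Sum>d | d dvd n. d ^ k)"

lemma divisor_sum_0 [simp]: "divisor_sum k 0 = 0"
  by (simp add: divisor_sum_def)

definition sigma_fps :: "nat \<Rightarrow> complex fps" where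
  "sigma_fps k = Abs_fps (\<lambda>n. of_nat (divisor_sum k n))"

lemma divisor_sum_le: "divisor_sum k n \<le> n ^ Suc k"
proof (cases "n = 0")
  case False
  have "divisor_sum k n \<le> (\<Sum>d | d dvd n. n ^ k)"
    unfolding divisor_sum_def using False by (intro sum_mono power_mono) (auto dest: dvd_imp_le)
  also have "\<dots> \<le> n * n ^ k"
  proof -
    have "card {d. d dvd n} \<le> card {1..n}"
      using False by (intro card_mono) (auto dest: dvd_imp_le intro: Nat.gr0I)
    thus ?thesis by simp
  qed
  finally show ?thesis by simp
qed auto

lemma conv_radius_sigma_fps: "fps_conv_radius (sigma_fps k) \<ge> 1"
proof (rule conv_radius_ge_1I)
  fix d
  show "norm (fps_nth (sigma_fps k) d) \<le> real d ^ Suc k"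
    using of_nat_mono[OF divisor_sum_le[of k d], where ?'a = real] by (simp add: sigma_fps_def)
qed

text \<open>Both sides sum d^k q^(m d) over m, d \<ge> 1, once row by row in m and once by the
  product n = m d.\<close>

lemma lambert_series:
  fixes q :: complex
  assumes q: "norm q < 1"
  shows "((\<lambda>m. eval_fps (pow_fps k) (q ^ m)) has_sum eval_fps (sigma_fps k) q) {1..}"
proof -
  \<comment> \<open>From m + d \<le> 2 m d follows |q|^(m d) \<le> s^m s^d, a majorant that
    factors.\<close>
  define s where "s = sqrt (norm q)"
  have s: "s \<ge> 0" "s < 1" "s\<^sup>2 = norm q" using q by (auto simp: s_def)
  have cr: "ereal (norm z) < fps_conv_radius (pow_fps k)" if "norm z < 1" for z :: complex
    using that by (intro in_unit_conv_radius conv_radius_pow_fps)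
  have rows: "((\<lambda>d. of_nat d ^ k * z ^ d) has_sum eval_fps (pow_fps k) z) {1..}" if "norm z < 1" for z :: complex
  proof -
    have "summable (\<lambda>d. norm (fps_nth (pow_fps k) d * z ^ d))"
      using cr[OF that] by (intro abs_summable_in_conv_radius) (simp add: fps_conv_radius_def)
    moreover have "(\<lambda>d. fps_nth (pow_fps k) d * z ^ d) sums eval_fps (pow_fps k) z"
      by (intro sums_eval_fps cr that)
    ultimately have "((\<lambda>d. fps_nth (pow_fps k) d * z ^ d) has_sum eval_fps (pow_fps k) z) UNIV"
      by (rule norm_summable_imp_has_sum)
    also have "?this \<longleftrightarrow> ?thesis"
      by (rule has_sum_cong_neutral) (auto simp: pow_fps_def)
    finally show ?thesis .
  qed
  define t where "t = (\<lambda>(m :: nat, d :: nat). of_nat d ^ k * q ^ (m * d))"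
  have "(\<lambda>p. norm (t p)) summable_on ({1..} \<times> {1..})"
  proof (rule Infinite_Sum.abs_summable_on_comparison_test')
    have rs: "((\<lambda>d. real d ^ k * s ^ d) has_sum infsum (\<lambda>d. real d ^ k * s ^ d) {1..}) {1..}"
    proof (rule has_sum_infsum)
      have "(\<lambda>d. of_nat d ^ k * complex_of_real s ^ d) summable_on {1..}"
        using rows[of "complex_of_real s"] s by (auto intro: has_sum_imp_summable)
      hence "(\<lambda>d. complex_of_real (real d ^ k * s ^ d)) summable_on {1..}" by simp
      from summable_on_Re[OF this] show "(\<lambda>d. real d ^ k * s ^ d) summable_on {1..}"
        by (simp only: Re_complex_of_real)
    qed
    have gs: "((\<lambda>m. s ^ m) has_sum s / (1 - s)) {1..}"
      using s by (intro has_sum_geometric_from_1) auto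
    show "(\<lambda>(m, d). s ^ m * (real d ^ k * s ^ d)) summable_on ({1..} \<times> {1..})"
    proof (rule summable_on_SigmaI)
      show "((\<lambda>d. case (m, d) of (m, d) \<Rightarrow> s ^ m * (real d ^ k * s ^ d)) has_sum
               s ^ m * infsum (\<lambda>d. real d ^ k * s ^ d) {1..}) {1..}" for m
        using has_sum_cmult_right[OF rs, of "s ^ m"] by simp
      show "(\<lambda>m. s ^ m * infsum (\<lambda>d. real d ^ k * s ^ d) {1..}) summable_on {1..}"
        using has_sum_cmult_left[OF gs] by (rule has_sum_imp_summable)
    qed (use s in auto)
    fix p :: "nat \<times> nat" assume "p \<in> {1..} \<times> {1..}"
    then obtain m d where p: "p = (m, d)" "m \<ge> 1" "d \<ge> 1" by auto
    have "norm q ^ (m * d) = s ^ (2 * (m * d))" by (simp add: power_mult s(3))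
    also have "\<dots> \<le> s ^ (m + d)"
    proof (rule power_decreasing)
      have "m \<le> m * d" "d \<le> m * d" using p by auto
      thus "m + d \<le> 2 * (m * d)" by linarith
    qed (use s in auto)
    finally have "real d ^ k * norm q ^ (m * d) \<le> real d ^ k * s ^ (m + d)"
      by (intro mult_left_mono) auto
    thus "norm (t p) \<le> (case p of (m, d) \<Rightarrow> s ^ m * (real d ^ k * s ^ d))"
      by (simp add: p t_def norm_mult norm_power power_add mult_ac)
  qed
  hence ts: "t summable_on ({1..} \<times> {1..})" by (rule Infinite_Sum.abs_summable_summable)
  define S where "S = infsum t ({1..} \<times> {1..})"
  have tS: "(t has_sum S) ({1..} \<times> {1..})" unfolding S_def using ts by (rule has_sum_infsum)
  have 1: "((\<lambda>m. eval_fps (pow_fps k) (q ^ m)) has_sum S) {1..}"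
  proof (rule has_sum_SigmaD[OF tS])
    fix m :: nat assume "m \<in> {1..}"
    hence "norm (q ^ m) < 1" using q by (auto simp: norm_power power_less_one_iff)
    from rows[OF this] show "((\<lambda>d. t (m, d)) has_sum eval_fps (pow_fps k) (q ^ m)) {1..}"
      by (simp add: t_def power_mult)
  qed
  have "((\<lambda>(n, d). of_nat d ^ k * q ^ n) has_sum S) (Sigma {1..} (\<lambda>n. {d. d dvd n}))"
    using tS
    by (subst has_sum_reindex_bij_witness[of _ "\<lambda>(m, d). (m * d, d)" "\<lambda>(n, d). (n div d, d)" "{1..} \<times> {1..}" t])
       (auto simp: t_def Suc_le_eq mult_ac intro!: Nat.gr0I elim!: dvdE)
  hence "((\<lambda>n. of_nat (divisor_sum k n) * q ^ n) has_sum S) {1..}"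
  proof (rule has_sum_SigmaD)
    fix n :: nat assume "n \<in> {1..}"
    thus "((\<lambda>d. case (n, d) of (n, d) \<Rightarrow> of_nat d ^ k * q ^ n) has_sum of_nat (divisor_sum k n) * q ^ n) {d. d dvd n}"
      by (intro has_sum_finiteI) (auto simp: divisor_sum_def sum_distrib_right)
  qed
  also have "?this \<longleftrightarrow> ((\<lambda>n. fps_nth (sigma_fps k) n * q ^ n) has_sum S) UNIV"
    by (rule has_sum_cong_neutral) (auto simp: sigma_fps_def not_less_eq_eq)
  finally have "(\<lambda>n. fps_nth (sigma_fps k) n * q ^ n) sums S" by (rule has_sum_imp_sums)
  moreover have "(\<lambda>n. fps_nth (sigma_fps k) n * q ^ n) sums eval_fps (sigma_fps k) q"
    by (intro sums_eval_fps in_unit_conv_radius q conv_radius_sigma_fps)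
  ultimately have "S = eval_fps (sigma_fps k) q" by (rule sums_unique2)
  with 1 show ?thesis by simp
qed

text \<open>The summand at \<open>(0, 0)\<close> is \<open>0\<close>, as \<open>1 / 0 = 0\<close>.\<close>
definition eisenstein_sum :: "nat \<Rightarrow> complex \<Rightarrow> complex" where
  "eisenstein_sum j \<tau> = infsum (\<lambda>(m :: int, n :: int). 1 / (of_int m * \<tau> + of_int n) ^ (2 * j)) UNIV"

lemma eisenstein_sum_minus_inverse:
  assumes "Im \<tau> > 0"
  shows "eisenstein_sum j (- 1 / \<tau>) = \<tau> ^ (2 * j) * eisenstein_sum j \<tau>"
proof -
  have nz: "\<tau> \<noteq> 0" using assms by auto
  have "1 / (of_int m * (- 1 / \<tau>) + of_int n) ^ (2 * j) =
          \<tau> ^ (2 * j) * (1 / (of_int n * \<tau> + of_int (- m)) ^ (2 * j))" for m n :: int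
  proof -
    have "of_int m * (- 1 / \<tau>) + of_int n = (of_int n * \<tau> + of_int (- m)) / \<tau>"
      using nz by (simp add: field_simps)
    thus ?thesis by (simp add: power_divide)
  qed
  hence "eisenstein_sum j (- 1 / \<tau>) =
          infsum (\<lambda>(m :: int, n :: int). \<tau> ^ (2 * j) * (1 / (of_int n * \<tau> + of_int (- m)) ^ (2 * j))) UNIV"
    unfolding eisenstein_sum_def by (intro infsum_cong) auto
  also have "\<dots> = infsum (\<lambda>(m :: int, n :: int). \<tau> ^ (2 * j) * (1 / (of_int m * \<tau> + of_int n) ^ (2 * j))) UNIV"
    by (rule infsum_reindex_bij_witness[where i = "\<lambda>(m, n). (- n, m)" and j = "\<lambda>(m, n). (n, - m)"]) auto
  also have "\<dots> = \<tau> ^ (2 * j) * eisenstein_sum j \<tau>"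
    unfolding eisenstein_sum_def by (subst infsum_cmult_right' [symmetric]) (auto intro!: infsum_cong)
  finally show ?thesis .
qed

text \<open>This is 2 zeta(2 j); the term n = 0 is 1/0 = 0.\<close>

definition eisenstein_const :: "nat \<Rightarrow> complex" where
  "eisenstein_const j = infsum (\<lambda>n :: int. 1 / of_int n ^ (2 * j)) UNIV"

lemma eisenstein_const_nonzero:
  assumes "j \<ge> 2"
  shows "eisenstein_const j \<noteq> 0"
proof -
  have "(\<lambda>(m :: int, n :: int). 1 / (of_int m * \<i> + of_int n) ^ (2 * j)) summable_on (Sigma UNIV (\<lambda>_. UNIV))"
    using summable_on_lattice[of \<i> j] assms by simp
  from summable_on_SigmaD1[OF this, of 0]
  have s: "(\<lambda>n :: int. complex_of_real (1 / of_int n ^ (2 * j))) summable_on UNIV" by simp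
  from summable_on_Re[OF s] have s': "(\<lambda>n :: int. 1 / real_of_int n ^ (2 * j)) summable_on UNIV"
    by (simp only: Re_complex_of_real)
  have eq: "eisenstein_const j = of_real (infsum (\<lambda>n :: int. 1 / of_int n ^ (2 * j)) UNIV)"
    using has_sum_of_real[OF has_sum_infsum[OF s'], where ?'a = complex]
    unfolding eisenstein_const_def by (intro infsumI) simp
  have "infsum (\<lambda>n :: int. 1 / real_of_int n ^ (2 * j)) {1} \<le> infsum (\<lambda>n :: int. 1 / of_int n ^ (2 * j)) UNIV"
    using s' by (intro infsum_mono_neutral) auto
  hence "infsum (\<lambda>n :: int. 1 / real_of_int n ^ (2 * j)) UNIV \<noteq> 0" by simp
  thus ?thesis unfolding eq by simp
qed

text \<open>Summation by rows: Lipschitz's formula at m \<tau> gives the row m > 0, the row -m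
  equals it because the exponent is even, and the row m = 0 is the constant.\<close>

lemma eisenstein_sum_q_series:
  assumes \<tau>: "Im \<tau> > 0" and j: "j \<ge> 2"
  shows "eisenstein_sum j \<tau> = eisenstein_const j +
           2 * lipschitz_const (2 * j) * eval_fps (sigma_fps (2 * j - 1)) (qq \<tau>)"
proof -
  define C where "C = lipschitz_const (2 * j)"
  define P where "P = eval_fps (pow_fps (2 * j - 1))"
  define S where "S = eval_fps (sigma_fps (2 * j - 1)) (qq \<tau>)"
  define r where "r = (\<lambda>m :: int. infsum (\<lambda>n :: int. 1 / (of_int m * \<tau> + of_int n) ^ (2 * j)) UNIV)"
  have "(\<lambda>(m :: int, n :: int). 1 / (of_int m * \<tau> + of_int n) ^ (2 * j)) summable_on (Sigma UNIV (\<lambda>_. UNIV))"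
    using summable_on_lattice[OF \<tau> j] by simp
  note sum1 = this
  have "((\<lambda>(m :: int, n :: int). 1 / (of_int m * \<tau> + of_int n) ^ (2 * j)) has_sum eisenstein_sum j \<tau>) (Sigma UNIV (\<lambda>_. UNIV))"
    using has_sum_infsum[OF sum1] unfolding eisenstein_sum_def by simp
  hence "(r has_sum eisenstein_sum j \<tau>) UNIV"
  proof (rule has_sum_SigmaD)
    fix m :: int
    show "((\<lambda>n. case (m, n) of (m, n) \<Rightarrow> 1 / (of_int m * \<tau> + of_int n) ^ (2 * j)) has_sum r m) UNIV"
      unfolding r_def prod.case by (rule has_sum_infsum, rule summable_on_SigmaD1[OF sum1]) simp
  qed
  moreover have "(r has_sum (eisenstein_const j + (C * S + C * S))) UNIV"
  proof -
    have r_pos: "r (int m) = C * P (qq \<tau> ^ m)" if "m \<ge> 1" for m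
    proof -
      have "Im (of_nat m * \<tau>) > 0" using that \<tau> by simp
      from lipschitz_formula[OF this j] show ?thesis
        unfolding r_def C_def P_def by (simp add: infsumI qq_of_nat_mult)
    qed
    have r_neg: "r (- m) = r m" for m
      unfolding r_def
    proof (rule infsum_reindex_bij_witness[where i = uminus and j = uminus])
      fix n :: int
      have "of_int m * \<tau> + of_int (- n) = - (of_int (- m) * \<tau> + of_int n)" by simp
      thus "1 / (of_int m * \<tau> + of_int (- n)) ^ (2 * j) = 1 / (of_int (- m) * \<tau> + of_int n) ^ (2 * j)"
        by (metis even_mult_iff even_numeral power_minus_even)
    qed auto
    have L: "((\<lambda>m. C * P (qq \<tau> ^ m)) has_sum C * S) {1..}"
      unfolding P_def S_def by (intro has_sum_cmult_right lambert_series norm_qq_less_1 \<tau>)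
    have L': "((\<lambda>m. r (int m)) has_sum C * S) {1..}"
      using L by (subst has_sum_cong[where g = "\<lambda>m. C * P (qq \<tau> ^ m)"]) (auto simp: r_pos)
    have pos: "(r has_sum C * S) (int ` {1..})"
      by (subst has_sum_reindex) (use L' in \<open>auto simp: o_def\<close>)
    have neg: "(r has_sum C * S) ((\<lambda>m. - int m) ` {1..})"
      by (subst has_sum_reindex) (use L' in \<open>auto simp: o_def r_neg inj_on_def\<close>)
    have zero: "(r has_sum eisenstein_const j) {0}"
      by (rule has_sum_finiteI) (auto simp: r_def eisenstein_const_def)
    have "(r has_sum (eisenstein_const j + (C * S + C * S))) ({0} \<union> (int ` {1..} \<union> (\<lambda>m. - int m) ` {1..}))"
      by (intro has_sum_Un_disjoint zero pos neg) auto
    also have "{0} \<union> (int ` {1..} \<union> (\<lambda>m. - int m) ` {1..}) = UNIV"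
    proof (rule UNIV_eq_I [symmetric])
      fix n :: int
      consider "n = 0" | "n > 0" | "n < 0" by linarith
      thus "n \<in> {0} \<union> (int ` {1..} \<union> (\<lambda>m. - int m) ` {1..})"
      proof cases
        case 2
        then show ?thesis by (auto simp: image_iff intro!: bexI[of _ "nat n"])
      next
        case 3
        then show ?thesis by (auto simp: image_iff intro!: bexI[of _ "nat (-n)"])
      qed auto
    qed
    finally show ?thesis .
  qed
  ultimately have "eisenstein_sum j \<tau> = eisenstein_const j + (C * S + C * S)"
    by (rule has_sum_unique)
  thus ?thesis by (simp add: C_def S_def)
qed

text \<open>Classically -4 j / B_(2 j), with the Bernoulli number B_(2 j).\<close>

definition eis_coeff :: "nat \<Rightarrow> complex" where
  "eis_coeff j = 2 * lipschitz_const (2 * j) / eisenstein_const j"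

lemma eisenstein_modular:
  assumes \<tau>: "Im \<tau> > 0" and j: "j \<ge> 2"
  shows "1 + eis_coeff j * eval_fps (sigma_fps (2 * j - 1)) (qq (- 1 / \<tau>)) =
           \<tau> ^ (2 * j) * (1 + eis_coeff j * eval_fps (sigma_fps (2 * j - 1)) (qq \<tau>))"
proof -
  have eq: "1 + eis_coeff j * eval_fps (sigma_fps (2 * j - 1)) (qq \<sigma>) = eisenstein_sum j \<sigma> / eisenstein_const j"
    if "Im \<sigma> > 0" for \<sigma>
    unfolding eisenstein_sum_q_series[OF that j] eis_coeff_def
    using eisenstein_const_nonzero[OF j] by (simp add: field_simps)
  show ?thesis
    unfolding eq[OF \<tau>] eq[OF minus_inverse_upper[OF \<tau>]] eisenstein_sum_minus_inverse[OF \<tau>] by simp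
qed

section \<open>Modular forms as functions of \<open>q\<close>\<close>

definition punctured_disc :: "complex set" where
  "punctured_disc = ball 0 1 - {0}"

lemma open_punctured_disc: "open punctured_disc"
  unfolding punctured_disc_def by (intro open_Diff) auto

lemma qq_in_punctured_disc: "Im \<tau> > 0 \<Longrightarrow> qq \<tau> \<in> punctured_disc"
  using norm_qq_less_1[of \<tau>] by (simp add: punctured_disc_def)

lemma punctured_disc_qq:
  assumes "q \<in> punctured_disc"
  obtains \<tau> where "Im \<tau> > 0" "qq \<tau> = q"
proof
  define \<tau> where "\<tau> = Ln q / (2 * of_real pi * \<i>)"
  have q: "q \<noteq> 0" "norm q < 1" using assms by (auto simp: punctured_disc_def)
  have "2 * of_real pi * \<i> * \<tau> = Ln q" by (simp add: \<tau>_def)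
  thus qq: "qq \<tau> = q" using q by (simp add: qq_def)
  show "Im \<tau> > 0" using q norm_qq[of \<tau>] qq by (simp add: zero_less_mult_iff)
qed

text \<open>Invariance under \<open>\<tau> \<mapsto> \<tau> + 1\<close> is automatic for a function of \<open>q\<close>.\<close>
definition modular_in_q :: "int \<Rightarrow> (complex \<Rightarrow> complex) \<Rightarrow> bool" where
  "modular_in_q k \<phi> \<longleftrightarrow> \<phi> holomorphic_on punctured_disc \<and>
     (\<forall>\<tau>. Im \<tau> > 0 \<longrightarrow> \<phi> (qq (- 1 / \<tau>)) = \<tau> powi k * \<phi> (qq \<tau>))"

text \<open>The function is hidden behind its expansion, so that most later identities become
  equations between formal Laurent series.\<close>

definition modular_series :: "int \<Rightarrow> complex fls \<Rightarrow> bool" where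
  "modular_series k F \<longleftrightarrow> (\<exists>\<phi>. modular_in_q k \<phi> \<and> \<phi> has_laurent_expansion F)"

lemma modular_seriesI: "modular_in_q k \<phi> \<Longrightarrow> \<phi> has_laurent_expansion F \<Longrightarrow> modular_series k F"
  by (auto simp: modular_series_def)

lemma modular_in_q_holomorphic: "modular_in_q k \<phi> \<Longrightarrow> \<phi> holomorphic_on punctured_disc"
  by (simp add: modular_in_q_def)

lemma modular_in_q_minus_inverse:
  "modular_in_q k \<phi> \<Longrightarrow> Im \<tau> > 0 \<Longrightarrow> \<phi> (qq (- 1 / \<tau>)) = \<tau> powi k * \<phi> (qq \<tau>)"
  by (simp add: modular_in_q_def)

lemma modular_series_mult:
  assumes "modular_series k F" "modular_series l G"
  shows "modular_series (k + l) (F * G)"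
proof -
  from assms obtain \<phi> \<psi> where *: "modular_in_q k \<phi>" "\<phi> has_laurent_expansion F"
    "modular_in_q l \<psi>" "\<psi> has_laurent_expansion G" by (auto simp: modular_series_def)
  show ?thesis
  proof (rule modular_seriesI)
    show "modular_in_q (k + l) (\<lambda>q. \<phi> q * \<psi> q)"
      unfolding modular_in_q_def
    proof (intro conjI allI impI)
      show "(\<lambda>q. \<phi> q * \<psi> q) holomorphic_on punctured_disc"
        by (intro holomorphic_intros *(1,3)[THEN modular_in_q_holomorphic])
      fix \<tau> :: complex assume \<tau>: "Im \<tau> > 0"
      hence "\<tau> \<noteq> 0" by auto
      thus "\<phi> (qq (- 1 / \<tau>)) * \<psi> (qq (- 1 / \<tau>)) = \<tau> powi (k + l) * (\<phi> (qq \<tau>) * \<psi> (qq \<tau>))"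
        using *(1,3)[THEN modular_in_q_minus_inverse, OF \<tau>] by (simp add: power_int_add)
    qed
  qed (intro laurent_expansion_intros *)
qed

lemma modular_series_add:
  assumes "modular_series k F" "modular_series k G"
  shows "modular_series k (F + G)"
proof -
  from assms obtain \<phi> \<psi> where *: "modular_in_q k \<phi>" "\<phi> has_laurent_expansion F"
    "modular_in_q k \<psi>" "\<psi> has_laurent_expansion G" by (auto simp: modular_series_def)
  show ?thesis
    by (rule modular_seriesI[of k "\<lambda>q. \<phi> q + \<psi> q"], use * in \<open>simp add: modular_in_q_def ring_distribs\<close>)
       (use * in \<open>auto simp: modular_in_q_def intro!: holomorphic_intros laurent_expansion_intros\<close>)
qed

lemma modular_series_const: "modular_series 0 (fls_const c)"
  by (rule modular_seriesI[of 0 "\<lambda>_. c"]) (auto simp: modular_in_q_def)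

lemma modular_series_1: "modular_series 0 1"
  using modular_series_const[of 1] by simp

lemma modular_series_cmult: "modular_series k F \<Longrightarrow> modular_series k (fls_const c * F)"
  using modular_series_mult[OF modular_series_const, of k F c] by simp

lemma modular_series_diff: "modular_series k F \<Longrightarrow> modular_series k G \<Longrightarrow> modular_series k (F - G)"
  using modular_series_add[of k F "fls_const (-1) * G"] modular_series_cmult[of k G "-1"]
  by (simp add: fls_eq_iff)

lemma modular_series_power: "modular_series k F \<Longrightarrow> modular_series (int n * k) (F ^ n)"
  by (induction n) (auto simp: modular_series_1 algebra_simps dest: modular_series_mult)

section \<open>Growth at the cusp and vanishing of expansions\<close>

lemma laurent_expansion_growth:
  assumes F: "\<phi> has_laurent_expansion F" and n: "\<And>i. i < int n \<Longrightarrow> fls_nth F i = 0"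
  obtains C r where "r > 0" "\<And>q. q \<noteq> 0 \<Longrightarrow> norm q < r \<Longrightarrow> norm (\<phi> q) \<le> C * norm q ^ n"
proof -
  let ?G = "fls_shift (int n) F"
  have "(\<lambda>q. \<phi> q * q powi (- int n)) has_laurent_expansion ?G"
    using F by (rule has_laurent_expansion_shift')
  moreover have "fls_subdegree ?G \<ge> 0"
  proof (cases "?G = 0")
    case False
    thus ?thesis by (rule fls_subdegree_geI) (simp add: n)
  qed simp
  ultimately have "((\<lambda>q. \<phi> q * q powi (- int n)) \<longlongrightarrow> fls_nth ?G 0) (at 0)"
    by (rule has_laurent_expansion_imp_tendsto_0)
  hence "\<forall>\<^sub>F q in at 0. dist (\<phi> q * q powi (- int n)) (fls_nth ?G 0) < 1"
    by (rule tendstoD) simp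
  then obtain r where r: "r > 0"
    "\<And>q. q \<noteq> 0 \<Longrightarrow> norm q < r \<Longrightarrow> dist (\<phi> q * q powi (- int n)) (fls_nth ?G 0) < 1"
    by (auto simp: eventually_at)
  show ?thesis
  proof (rule that[OF r(1)])
    fix q :: complex assume q: "q \<noteq> 0" "norm q < r"
    have "norm (\<phi> q * q powi (- int n)) \<le> norm (fls_nth ?G 0) + 1"
      using r(2)[OF q] norm_triangle_ineq2[of "\<phi> q * q powi (- int n)" "fls_nth ?G 0"]
      by (simp add: dist_norm)
    hence "norm (\<phi> q) / norm q ^ n \<le> norm (fls_nth ?G 0) + 1"
      by (simp add: norm_mult norm_power_int power_int_minus norm_inverse norm_power divide_inverse)
    thus "norm (\<phi> q) \<le> (norm (fls_nth ?G 0) + 1) * norm q ^ n"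
      using q by (simp add: field_simps)
  qed
qed

lemma growth_at_cusp:
  assumes F: "\<phi> has_laurent_expansion F" and n: "\<And>i. i < int n \<Longrightarrow> fls_nth F i = 0"
  obtains C Y where "\<And>\<tau>. Im \<tau> > Y \<Longrightarrow> norm (\<phi> (qq \<tau>)) \<le> C * exp (- (2 * pi * real n * Im \<tau>))"
proof -
  obtain C r where r: "r > 0" "\<And>q. q \<noteq> 0 \<Longrightarrow> norm q < r \<Longrightarrow> norm (\<phi> q) \<le> C * norm q ^ n"
    using laurent_expansion_growth[OF assms] by blast
  show ?thesis
  proof (rule that)
    fix \<tau> assume "Im \<tau> > - ln r / (2 * pi)"
    hence "- (2 * pi * Im \<tau>) < ln r" by (simp add: field_simps)
    hence "norm (qq \<tau>) < r" using r(1) by (metis exp_less_cancel_iff exp_ln norm_qq)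
    hence "norm (\<phi> (qq \<tau>)) \<le> C * norm (qq \<tau>) ^ n" by (intro r) auto
    also have "norm (qq \<tau>) ^ n = exp (- (2 * pi * real n * Im \<tau>))"
      by (simp add: norm_qq exp_of_nat_mult [symmetric] mult_ac)
    finally show "norm (\<phi> (qq \<tau>)) \<le> C * exp (- (2 * pi * real n * Im \<tau>))" .
  qed
qed

text \<open>The uniqueness statements of level one rest on this Sturm bound, with 21/2 instead of
  12. It decides weights up to 10 by n = 1, weight 18 by n = 2 and weight 28 by n = 3.\<close>

lemma modular_series_eq_0:
  assumes F: "modular_series k F" and n: "\<And>i. i < int n \<Longrightarrow> fls_nth F i = 0" "2 * k \<le> 21 * int n" "n > 0"
  shows "F = 0"
proof -
  from F obtain \<phi> where \<phi>: "modular_in_q k \<phi>" "\<phi> has_laurent_expansion F" by (auto simp: modular_series_def)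
  obtain C Y where CY: "\<And>\<tau>. Im \<tau> > Y \<Longrightarrow> norm (\<phi> (qq \<tau>)) \<le> C * exp (- (2 * pi * real n * Im \<tau>))"
    using growth_at_cusp[OF \<phi>(2) n(1)] by blast
  have "(\<phi> \<circ> qq) \<tau> = 0" if "Im \<tau> > 0" for \<tau>
  proof (rule modular_function_eq_0[where f = "\<phi> \<circ> qq" and n = n and k = k and Y = Y and C = C])
    show "\<phi> \<circ> qq holomorphic_on {\<tau>. Im \<tau> > 0}"
      by (rule holomorphic_on_compose_gen[OF holomorphic_qq modular_in_q_holomorphic[OF \<phi>(1)]])
         (auto intro: qq_in_punctured_disc)
  qed (use CY n that modular_in_q_minus_inverse[OF \<phi>(1)] in auto)
  hence "\<phi> q = 0" if "q \<in> punctured_disc" for q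
    using punctured_disc_qq[OF that] by (metis comp_apply)
  hence "eventually (\<lambda>q. \<phi> q = 0) (at 0)"
    unfolding eventually_at by (intro exI[of _ 1]) (auto simp: punctured_disc_def)
  hence "(\<lambda>_. 0) has_laurent_expansion F"
    using \<phi>(2) by (subst (asm) has_laurent_expansion_cong) auto
  thus "F = 0" by (rule zero_has_laurent_expansion_imp_eq_0)
qed

text \<open>The witness in \<open>modular_series\<close> has the same germ at 0 as the convergent
  series, and analytic continuation identifies the two on the punctured disc.\<close>

lemma modular_in_q_eval_fps:
  assumes "modular_series k (fps_to_fls f)" "fps_conv_radius f \<ge> 1"
  shows "modular_in_q k (eval_fps f)"
proof -
  from assms obtain \<phi> where \<phi>: "modular_in_q k \<phi>" "\<phi> has_laurent_expansion fps_to_fls f"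
    by (auto simp: modular_series_def)
  have holo: "eval_fps f holomorphic_on punctured_disc"
    by (intro holomorphic_intros) (use assms(2) in \<open>auto simp: punctured_disc_def intro: in_unit_conv_radius\<close>)
  have "eval_fps f has_fps_expansion f"
    by (rule eval_fps_has_fps_expansion) (use assms(2) in \<open>auto intro: less_le_trans[of _ 1]\<close>)
  hence "eval_fps f has_laurent_expansion fps_to_fls f" by (rule has_laurent_expansion_fps)
  from has_laurent_expansion_diff[OF this \<phi>(2)]
  have "(\<lambda>x. eval_fps f x - \<phi> x) has_laurent_expansion 0" by simp
  hence eq: "eval_fps f x = \<phi> x" if "x \<in> punctured_disc" for x
    using has_laurent_expansion_0_analytic_continuation[of "\<lambda>x. eval_fps f x - \<phi> x" "ball 0 1" x] that
      holo modular_in_q_holomorphic[OF \<phi>(1)]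
    by (auto simp: punctured_disc_def intro!: holomorphic_intros)
  show ?thesis
    unfolding modular_in_q_def
    using holo modular_in_q_minus_inverse[OF \<phi>(1)] eq qq_in_punctured_disc minus_inverse_upper by auto
qed

section \<open>The operator q d/dq and Rankin-Cohen brackets\<close>

definition dq :: "(complex \<Rightarrow> complex) \<Rightarrow> complex \<Rightarrow> complex" where
  "dq \<phi> q = q * deriv \<phi> q"

definition theta :: "complex fls \<Rightarrow> complex fls" where
  "theta F = fls_X * fls_deriv F"

lemma theta_nth [simp]: "fls_nth (theta F) n = of_int n * fls_nth F n"
  by (simp add: theta_def fls_X_times_conv_shift)

lemma has_laurent_expansion_dq: "\<phi> has_laurent_expansion F \<Longrightarrow> dq \<phi> has_laurent_expansion theta F"
  unfolding dq_def [abs_def] theta_def by (intro laurent_expansion_intros)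

lemma holomorphic_dq: "\<phi> holomorphic_on punctured_disc \<Longrightarrow> dq \<phi> holomorphic_on punctured_disc"
  unfolding dq_def [abs_def] by (intro holomorphic_intros open_punctured_disc)

lemma has_field_derivative_compose_qq:
  assumes "\<phi> holomorphic_on punctured_disc" "Im \<tau> > 0"
  shows "((\<lambda>\<tau>. \<phi> (qq \<tau>)) has_field_derivative 2 * of_real pi * \<i> * dq \<phi> (qq \<tau>)) (at \<tau>)"
proof -
  have "(\<phi> has_field_derivative deriv \<phi> (qq \<tau>)) (at (qq \<tau>))"
    using assms by (intro holomorphic_derivI[OF _ open_punctured_disc] qq_in_punctured_disc)
  from DERIV_chain2[OF this has_field_derivative_qq] show ?thesis
    by (simp add: dq_def mult_ac)
qed

text \<open>The transformation law \<open>R\<close> is left arbitrary because the lemma is also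
  applied to \<open>dq \<phi>\<close>, whose law has a correction term.\<close>

lemma dq_minus_inverse:
  assumes \<phi>: "\<phi> holomorphic_on punctured_disc" and \<tau>: "Im \<tau> > 0"
    and R: "\<And>\<tau>. Im \<tau> > 0 \<Longrightarrow> \<phi> (qq (- 1 / \<tau>)) = R \<tau>" and R': "(R has_field_derivative R') (at \<tau>)"
  shows "2 * of_real pi * \<i> * dq \<phi> (qq (- 1 / \<tau>)) = \<tau>\<^sup>2 * R'"
proof -
  have nz: "\<tau> \<noteq> 0" using \<tau> by auto
  have "((\<lambda>\<tau>. - 1 / \<tau>) has_field_derivative 1 / \<tau>\<^sup>2) (at \<tau>)"
    using nz by (auto intro!: derivative_eq_intros simp: power2_eq_square)
  from DERIV_chain2[OF has_field_derivative_compose_qq[OF \<phi> minus_inverse_upper[OF \<tau>]] this]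
  have "((\<lambda>\<tau>. \<phi> (qq (- 1 / \<tau>))) has_field_derivative
          2 * of_real pi * \<i> * dq \<phi> (qq (- 1 / \<tau>)) * (1 / \<tau>\<^sup>2)) (at \<tau>)" .
  moreover have "((\<lambda>\<tau>. \<phi> (qq (- 1 / \<tau>))) has_field_derivative R') (at \<tau>)"
    by (rule has_field_derivative_transform_within_open[OF R' open_halfspace_Im_gt[of 0]])
       (use \<tau> R in auto)
  ultimately have "2 * of_real pi * \<i> * dq \<phi> (qq (- 1 / \<tau>)) * (1 / \<tau>\<^sup>2) = R'"
    by (rule DERIV_unique)
  thus ?thesis using nz by (simp add: field_simps)
qed

lemma dq_modular:
  assumes \<phi>: "modular_in_q k \<phi>" and \<tau>: "Im \<tau> > 0"
  shows "dq \<phi> (qq (- 1 / \<tau>)) =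
     of_int k / (2 * of_real pi * \<i>) * \<tau> powi (k + 1) * \<phi> (qq \<tau>) + \<tau> powi (k + 2) * dq \<phi> (qq \<tau>)"
proof -
  have nz: "\<tau> \<noteq> 0" using \<tau> by auto
  have "2 * of_real pi * \<i> * dq \<phi> (qq (- 1 / \<tau>)) =
     \<tau>\<^sup>2 * (of_int k * \<tau> powi (k - 1) * \<phi> (qq \<tau>) + 2 * of_real pi * \<i> * dq \<phi> (qq \<tau>) * \<tau> powi k)"
    by (rule dq_minus_inverse[OF modular_in_q_holomorphic[OF \<phi>] \<tau> modular_in_q_minus_inverse[OF \<phi>]])
       (use nz in \<open>auto intro!: derivative_eq_intros
          has_field_derivative_compose_qq[OF modular_in_q_holomorphic[OF \<phi>] \<tau>]\<close>)
  also have "\<dots> = 2 * of_real pi * \<i> * (of_int k / (2 * of_real pi * \<i>) * \<tau> powi (k + 1) * \<phi> (qq \<tau>) + \<tau> powi (k + 2) * dq \<phi> (qq \<tau>))"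
  proof -
    have "\<tau>\<^sup>2 * \<tau> powi (k - 1) = \<tau> powi (k + 1)" "\<tau>\<^sup>2 * \<tau> powi k = \<tau> powi (k + 2)"
      using nz by (auto simp: power_int_add power_int_diff power2_eq_square)
    from this [symmetric] show ?thesis by (simp add: ring_distribs mult_ac)
  qed
  finally show ?thesis by (subst (asm) mult_left_cancel) auto
qed

lemma has_laurent_expansion_of_int: "(\<lambda>_. of_int k :: complex) has_laurent_expansion of_int k"
  by (simp add: fls_of_int has_laurent_expansion_const)

text \<open>The first Rankin-Cohen bracket: by \<open>dq_modular\<close> the correction terms of
  both products are k l times the same function and cancel.\<close>

lemma modular_series_rankin_cohen_1:
  assumes "modular_series k F" "modular_series l G"
  shows "modular_series (k + l + 2) (of_int k * F * theta G - of_int l * G * theta F)"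
proof -
  from assms obtain \<phi> \<psi> where *: "modular_in_q k \<phi>" "\<phi> has_laurent_expansion F"
    "modular_in_q l \<psi>" "\<psi> has_laurent_expansion G" by (auto simp: modular_series_def)
  show ?thesis
  proof (rule modular_seriesI)
    show "modular_in_q (k + l + 2) (\<lambda>q. of_int k * \<phi> q * dq \<psi> q - of_int l * \<psi> q * dq \<phi> q)"
      unfolding modular_in_q_def
    proof (intro conjI allI impI)
      show "(\<lambda>q. of_int k * \<phi> q * dq \<psi> q - of_int l * \<psi> q * dq \<phi> q) holomorphic_on punctured_disc"
        by (intro holomorphic_intros holomorphic_dq *(1,3)[THEN modular_in_q_holomorphic])
      fix \<tau> :: complex assume \<tau>: "Im \<tau> > 0"
      hence nz: "\<tau> \<noteq> 0" by auto
      show "of_int k * \<phi> (qq (- 1 / \<tau>)) * dq \<psi> (qq (- 1 / \<tau>)) - of_int l * \<psi> (qq (- 1 / \<tau>)) * dq \<phi> (qq (- 1 / \<tau>))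
        = \<tau> powi (k + l + 2) * (of_int k * \<phi> (qq \<tau>) * dq \<psi> (qq \<tau>) - of_int l * \<psi> (qq \<tau>) * dq \<phi> (qq \<tau>))"
        unfolding *(1,3)[THEN modular_in_q_minus_inverse, OF \<tau>] *(1,3)[THEN dq_modular, OF \<tau>]
        using nz by (simp add: power_int_add power2_eq_square) (simp add: algebra_simps)
    qed
    show "(\<lambda>q. of_int k * \<phi> q * dq \<psi> q - of_int l * \<psi> q * dq \<phi> q) has_laurent_expansion
            of_int k * F * theta G - of_int l * G * theta F"
      by (intro laurent_expansion_intros has_laurent_expansion_of_int has_laurent_expansion_dq *)
  qed
qed

text \<open>Up to a factor this is the second Rankin-Cohen bracket of a form of weight k = 12 with
  itself, (k + 1) (f')^2 - k f f'', of weight 2 k + 4.\<close>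

lemma modular_series_rankin_cohen_2:
  assumes "modular_series 12 F"
  shows "modular_series 28 (13 * (theta F)\<^sup>2 - 12 * (F * theta (theta F)))"
proof -
  define c where "c = 2 * of_real pi * \<i>"
  have c: "c \<noteq> 0" by (simp add: c_def)
  from assms obtain \<phi> where *: "modular_in_q 12 \<phi>" "\<phi> has_laurent_expansion F" by (auto simp: modular_series_def)
  note holo = modular_in_q_holomorphic[OF *(1)]
  show ?thesis
  proof (rule modular_seriesI)
    show "modular_in_q 28 (\<lambda>q. 13 * (dq \<phi> q)\<^sup>2 - 12 * (\<phi> q * dq (dq \<phi>) q))"
      unfolding modular_in_q_def
    proof (intro conjI allI impI)
      show "(\<lambda>q. 13 * (dq \<phi> q)\<^sup>2 - 12 * (\<phi> q * dq (dq \<phi>) q)) holomorphic_on punctured_disc"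
        by (intro holomorphic_intros holomorphic_dq holo)
      fix \<tau> :: complex assume \<tau>: "Im \<tau> > 0"
      define f0 f1 f2 where "f0 = \<phi> (qq \<tau>)" and "f1 = dq \<phi> (qq \<tau>)" and "f2 = dq (dq \<phi>) (qq \<tau>)"
      have 1: "dq \<phi> (qq (- 1 / \<sigma>)) = 12 / c * \<sigma> ^ 13 * \<phi> (qq \<sigma>) + \<sigma> ^ 14 * dq \<phi> (qq \<sigma>)"
        if "Im \<sigma> > 0" for \<sigma>
        using dq_modular[OF *(1) that] by (simp add: c_def)
      have "c * dq (dq \<phi>) (qq (- 1 / \<tau>)) =
              \<tau>\<^sup>2 * (12 / c * (13 * \<tau> ^ 12 * f0 + \<tau> ^ 13 * (c * f1)) + (14 * \<tau> ^ 13 * f1 + \<tau> ^ 14 * (c * f2)))"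
        unfolding c_def
      proof (rule dq_minus_inverse[OF holomorphic_dq[OF holo] \<tau> 1[unfolded c_def]])
        show "((\<lambda>\<sigma>. 12 / (2 * of_real pi * \<i>) * \<sigma> ^ 13 * \<phi> (qq \<sigma>) + \<sigma> ^ 14 * dq \<phi> (qq \<sigma>)) has_field_derivative
           12 / (2 * of_real pi * \<i>) * (13 * \<tau> ^ 12 * f0 + \<tau> ^ 13 * (2 * of_real pi * \<i> * f1)) +
           (14 * \<tau> ^ 13 * f1 + \<tau> ^ 14 * (2 * of_real pi * \<i> * f2))) (at \<tau>)"
          unfolding f0_def f1_def f2_def
          by (rule derivative_eq_intros refl has_field_derivative_compose_qq[OF holo \<tau>]
                has_field_derivative_compose_qq[OF holomorphic_dq[OF holo] \<tau>])+
             (simp add: algebra_simps)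
      qed auto
      hence 2: "dq (dq \<phi>) (qq (- 1 / \<tau>)) =
          (\<tau>\<^sup>2 * (12 / c * (13 * \<tau> ^ 12 * f0 + \<tau> ^ 13 * (c * f1)) + (14 * \<tau> ^ 13 * f1 + \<tau> ^ 14 * (c * f2)))) / c"
        using c by (simp add: field_simps)
      have 0: "\<phi> (qq (- 1 / \<tau>)) = \<tau> ^ 12 * f0"
        using modular_in_q_minus_inverse[OF *(1) \<tau>] by (simp add: f0_def)
      have "13 * (12 / c * \<tau> ^ 13 * f0 + \<tau> ^ 14 * f1)\<^sup>2 - 12 * (\<tau> ^ 12 * f0 * ((\<tau>\<^sup>2 * (12 / c * (13 * \<tau> ^ 12 * f0 + \<tau> ^ 13 * (c * f1)) + (14 * \<tau> ^ 13 * f1 + \<tau> ^ 14 * (c * f2)))) / c))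
         = \<tau> ^ 28 * (13 * f1\<^sup>2 - 12 * (f0 * f2))"
      proof -
        define t where "t = \<tau> ^ 12"
        have pw: "\<tau> ^ 12 = t" "\<tau> ^ 13 = t * \<tau>" "\<tau> ^ 14 = t * (\<tau> * \<tau>)" "\<tau>\<^sup>2 = \<tau> * \<tau>"
          "\<tau> ^ 28 = t * (t * (\<tau> * (\<tau> * (\<tau> * \<tau>))))"
          by (simp_all add: t_def eval_nat_numeral mult_ac)
        show ?thesis unfolding pw using c by (simp add: field_simps power2_eq_square)
      qed
      thus "13 * (dq \<phi> (qq (- 1 / \<tau>)))\<^sup>2 - 12 * (\<phi> (qq (- 1 / \<tau>)) * dq (dq \<phi>) (qq (- 1 / \<tau>))) =
         \<tau> powi 28 * (13 * (dq \<phi> (qq \<tau>))\<^sup>2 - 12 * (\<phi> (qq \<tau>) * dq (dq \<phi>) (qq \<tau>)))"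
        unfolding 0 1[OF \<tau>] 2 by (simp flip: f0_def f1_def f2_def)
    qed
  qed (intro laurent_expansion_intros has_laurent_expansion_dq *)
qed

section \<open>Bol's identity\<close>

lemma leibniz_times_ident:
  assumes "h holomorphic_on S" "open S" "w \<in> S"
  shows "(deriv ^^ Suc n) (\<lambda>z. z * h z) w = w * (deriv ^^ Suc n) h w + of_nat (Suc n) * (deriv ^^ n) h w"
  using assms(3)
proof (induction n arbitrary: w)
  case 0
  have "(h has_field_derivative deriv h w) (at w)"
    using assms 0 by (intro holomorphic_derivI)
  hence "((\<lambda>z. z * h z) has_field_derivative w * deriv h w + h w) (at w)"
    by (auto intro!: derivative_eq_intros)
  thus ?case by (simp add: DERIV_imp_deriv)
next
  case (Suc n)
  have hol: "(deriv ^^ m) h holomorphic_on S" for m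
    using assms by (intro holomorphic_higher_deriv)
  have d: "((deriv ^^ m) h has_field_derivative (deriv ^^ Suc m) h w) (at w)" for m
    using holomorphic_derivI[OF hol assms(2) Suc.prems, of m] by simp
  have "((\<lambda>w. w * (deriv ^^ Suc n) h w + of_nat (Suc n) * (deriv ^^ n) h w) has_field_derivative
     (deriv ^^ Suc n) h w + w * (deriv ^^ Suc (Suc n)) h w + of_nat (Suc n) * (deriv ^^ Suc n) h w) (at w)"
    by (rule derivative_eq_intros refl d)+ simp
  hence "((deriv ^^ Suc n) (\<lambda>z. z * h z) has_field_derivative
     (deriv ^^ Suc n) h w + w * (deriv ^^ Suc (Suc n)) h w + of_nat (Suc n) * (deriv ^^ Suc n) h w) (at w)"
    by (rule has_field_derivative_transform_within_open[OF _ assms(2) Suc.prems]) (simp only: Suc.IH)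
  hence "(deriv ^^ Suc (Suc n)) (\<lambda>z. z * h z) w =
     (deriv ^^ Suc n) h w + w * (deriv ^^ Suc (Suc n)) h w + of_nat (Suc n) * (deriv ^^ Suc n) h w"
    by (simp add: DERIV_imp_deriv)
  thus ?case by (simp add: algebra_simps)
qed

lemma holomorphic_dq_power: "\<phi> holomorphic_on punctured_disc \<Longrightarrow> (dq ^^ n) \<phi> holomorphic_on punctured_disc"
  by (induction n) (auto intro: holomorphic_dq)

text \<open>
  Bol's identity: \<open>(d/d\<tau>)\<^sup>n (\<tau>\<^bsup>n-1\<^esup> F(-1/\<tau>)) = \<tau>\<^bsup>-n-1\<^esup> F\<^bsup>(n)\<^esup>(-1/\<tau>)\<close>.  The induction
  step uses the Leibniz rule for the product of \<open>\<tau>\<close> and \<open>\<tau>\<^bsup>n-1\<^esup> F(-1/\<tau>)\<close>.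
\<close>
lemma bol_identity:
  assumes \<psi>: "\<psi> holomorphic_on punctured_disc" and \<tau>: "Im \<tau> > 0"
  shows "(deriv ^^ n) (\<lambda>\<tau>. \<tau> powi (int n - 1) * \<psi> (qq (- 1 / \<tau>))) \<tau> =
           (2 * of_real pi * \<i>) ^ n * \<tau> powi (- int n - 1) * (dq ^^ n) \<psi> (qq (- 1 / \<tau>))"
  using \<tau>
proof (induction n arbitrary: \<tau>)
  case 0
  thus ?case by simp
next
  case (Suc n)
  define c where "c = 2 * of_real pi * \<i>"
  let ?H = "{\<tau>. Im \<tau> > 0}"
  have opn: "open ?H" by (rule open_halfspace_Im_gt)
  have nz: "\<tau> \<noteq> 0" using Suc.prems by auto
  define h where "h = (\<lambda>\<tau>. \<tau> powi (int n - 1) * \<psi> (qq (- 1 / \<tau>)))"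
  have inv: "((\<lambda>\<tau>. - 1 / \<tau>) has_field_derivative 1 / \<sigma>\<^sup>2) (at \<sigma>)" if "Im \<sigma> > 0" for \<sigma>
    using that by (auto intro!: derivative_eq_intros simp: power2_eq_square)
  have comp: "((\<lambda>\<tau>. (dq ^^ m) \<psi> (qq (- 1 / \<tau>))) has_field_derivative
        c * (dq ^^ Suc m) \<psi> (qq (- 1 / \<sigma>)) * (1 / \<sigma>\<^sup>2)) (at \<sigma>)" if "Im \<sigma> > 0" for \<sigma> m
    using DERIV_chain2[OF has_field_derivative_compose_qq[OF holomorphic_dq_power[OF \<psi>]
            minus_inverse_upper[OF that]] inv[OF that], of m] by (simp add: c_def)
  have holo: "h holomorphic_on ?H"
    unfolding h_def
  proof (intro holomorphic_intros)
    show "(\<lambda>\<tau>. \<psi> (qq (- 1 / \<tau>))) holomorphic_on ?H"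
      using comp[of _ 0] unfolding holomorphic_on_open[OF opn] by auto
  qed auto
  have "(deriv ^^ Suc n) (\<lambda>\<tau>. \<tau> powi (int (Suc n) - 1) * \<psi> (qq (- 1 / \<tau>))) \<tau> = (deriv ^^ Suc n) (\<lambda>\<tau>. \<tau> * h \<tau>) \<tau>"
  proof (rule higher_deriv_cong_ev)
    have "eventually (\<lambda>\<tau>. \<tau> \<in> ?H) (nhds \<tau>)"
      using Suc.prems opn by (intro eventually_nhds_in_open) auto
    thus "eventually (\<lambda>\<tau>. \<tau> powi (int (Suc n) - 1) * \<psi> (qq (- 1 / \<tau>)) = \<tau> * h \<tau>) (nhds \<tau>)"
    proof eventually_elim
      case (elim \<sigma>)
      hence "\<sigma> \<noteq> 0" by auto
      thus ?case by (simp add: h_def power_int_diff)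
    qed
  qed simp
  also have "\<dots> = \<tau> * (deriv ^^ Suc n) h \<tau> + of_nat (Suc n) * (deriv ^^ n) h \<tau>"
    using holo opn Suc.prems by (intro leibniz_times_ident) auto
  also have "(deriv ^^ n) h \<tau> = c ^ n * \<tau> powi (- int n - 1) * (dq ^^ n) \<psi> (qq (- 1 / \<tau>))"
    using Suc.IH[OF Suc.prems] by (simp add: h_def c_def)
  also have "(deriv ^^ Suc n) h \<tau> =
     c ^ n * (of_int (- int n - 1) * \<tau> powi (- int n - 2) * (dq ^^ n) \<psi> (qq (- 1 / \<tau>)) +
       \<tau> powi (- int n - 1) * (c * (dq ^^ Suc n) \<psi> (qq (- 1 / \<tau>)) * (1 / \<tau>\<^sup>2)))"
  proof -
    have "((\<lambda>\<tau>. c ^ n * (\<tau> powi (- int n - 1) * (dq ^^ n) \<psi> (qq (- 1 / \<tau>)))) has_field_derivative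
       c ^ n * (of_int (- int n - 1) * \<tau> powi (- int n - 2) * (dq ^^ n) \<psi> (qq (- 1 / \<tau>)) +
       \<tau> powi (- int n - 1) * (c * (dq ^^ Suc n) \<psi> (qq (- 1 / \<tau>)) * (1 / \<tau>\<^sup>2)))) (at \<tau>)"
    proof -
      have "((\<lambda>\<tau>. \<tau> powi (- int n - 1)) has_field_derivative
               of_int (- int n - 1) * \<tau> powi (- int n - 2)) (at \<tau>)"
      proof -
        have "- int n - 1 - 1 = - int n - 2" by simp
        with DERIV_power_int[OF DERIV_ident disjI2[OF nz], of "- int n - 1"] show ?thesis
          by (simp only: mult_1_right)
      qed
      from DERIV_cmult[OF DERIV_mult'[OF this comp[OF Suc.prems, of n]], of "c ^ n"]
      show ?thesis by (simp only: add.commute)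
    qed
    hence "((deriv ^^ n) h has_field_derivative
       c ^ n * (of_int (- int n - 1) * \<tau> powi (- int n - 2) * (dq ^^ n) \<psi> (qq (- 1 / \<tau>)) +
       \<tau> powi (- int n - 1) * (c * (dq ^^ Suc n) \<psi> (qq (- 1 / \<tau>)) * (1 / \<tau>\<^sup>2)))) (at \<tau>)"
      by (rule has_field_derivative_transform_within_open[OF _ opn])
         (use Suc.prems Suc.IH in \<open>auto simp: h_def c_def\<close>)
    thus ?thesis by (simp add: DERIV_imp_deriv)
  qed
  also have "\<tau> * (c ^ n * (of_int (- int n - 1) * \<tau> powi (- int n - 2) * (dq ^^ n) \<psi> (qq (- 1 / \<tau>)) +
       \<tau> powi (- int n - 1) * (c * (dq ^^ Suc n) \<psi> (qq (- 1 / \<tau>)) * (1 / \<tau>\<^sup>2)))) +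
      of_nat (Suc n) * (c ^ n * \<tau> powi (- int n - 1) * (dq ^^ n) \<psi> (qq (- 1 / \<tau>))) =
      c ^ Suc n * \<tau> powi (- int (Suc n) - 1) * (dq ^^ Suc n) \<psi> (qq (- 1 / \<tau>))"
  proof -
    have 1: "\<tau> powi (- int n - 1) = \<tau> * \<tau> powi (- int n - 2)"
      using nz by (simp add: power_int_diff power2_eq_square)
    have 2: "\<tau> powi (- int (Suc n) - 1) = \<tau> powi (- int n - 2)"
      by (simp add: algebra_simps)
    show ?thesis unfolding 1 2 using nz by (simp add: power2_eq_square algebra_simps)
  qed
  finally show ?case unfolding c_def .
qed

lemma higher_deriv_compose_qq:
  assumes \<psi>: "\<psi> holomorphic_on punctured_disc" and \<tau>: "Im \<tau> > 0"
  shows "(deriv ^^ n) (\<lambda>\<tau>. \<psi> (qq \<tau>)) \<tau> = (2 * of_real pi * \<i>) ^ n * (dq ^^ n) \<psi> (qq \<tau>)"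
  using \<tau>
proof (induction n arbitrary: \<tau>)
  case (Suc n)
  have "((\<lambda>\<tau>. (2 * of_real pi * \<i>) ^ n * (dq ^^ n) \<psi> (qq \<tau>)) has_field_derivative
      (2 * of_real pi * \<i>) ^ n * (2 * of_real pi * \<i> * dq ((dq ^^ n) \<psi>) (qq \<tau>))) (at \<tau>)"
    by (intro DERIV_cmult has_field_derivative_compose_qq holomorphic_dq_power \<psi> Suc.prems)
  hence "((deriv ^^ n) (\<lambda>\<tau>. \<psi> (qq \<tau>)) has_field_derivative
      (2 * of_real pi * \<i>) ^ n * (2 * of_real pi * \<i> * dq ((dq ^^ n) \<psi>) (qq \<tau>))) (at \<tau>)"
    by (rule has_field_derivative_transform_within_open[OF _ open_halfspace_Im_gt[of 0]])
       (use Suc in auto)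
  thus ?case by (simp add: DERIV_imp_deriv)
qed auto

text \<open>In weight 1 - n the function \<tau>^(n-1) F(-1/\<tau>) of Bol's identity is F itself, so
  the n-th derivative transforms with weight n + 1 and without correction terms.\<close>

lemma modular_series_bol:
  assumes "modular_series (1 - int n) F"
  shows "modular_series (int n + 1) ((theta ^^ n) F)"
proof -
  from assms obtain \<phi> where \<phi>: "modular_in_q (1 - int n) \<phi>" "\<phi> has_laurent_expansion F" by (auto simp: modular_series_def)
  note holo = modular_in_q_holomorphic[OF \<phi>(1)]
  show ?thesis
  proof (rule modular_seriesI)
    show "(dq ^^ n) \<phi> has_laurent_expansion (theta ^^ n) F"
      using \<phi>(2) by (induction n) (auto intro: has_laurent_expansion_dq)
    show "modular_in_q (int n + 1) ((dq ^^ n) \<phi>)"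
      unfolding modular_in_q_def
    proof (intro conjI allI impI holomorphic_dq_power holo)
      fix \<tau> :: complex assume \<tau>: "Im \<tau> > 0"
      have nz: "\<tau> \<noteq> 0" using \<tau> by auto
      have "(deriv ^^ n) (\<lambda>\<tau>. \<tau> powi (int n - 1) * \<phi> (qq (- 1 / \<tau>))) \<tau> = (deriv ^^ n) (\<lambda>\<tau>. \<phi> (qq \<tau>)) \<tau>"
      proof (rule higher_deriv_cong_ev)
        have "eventually (\<lambda>\<tau>. \<tau> \<in> {\<tau>. Im \<tau> > 0}) (nhds \<tau>)"
          using \<tau> open_halfspace_Im_gt by (intro eventually_nhds_in_open) auto
        thus "eventually (\<lambda>\<tau>. \<tau> powi (int n - 1) * \<phi> (qq (- 1 / \<tau>)) = \<phi> (qq \<tau>)) (nhds \<tau>)"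
        proof eventually_elim
          case (elim \<sigma>)
          hence "\<sigma> \<noteq> 0" by auto
          hence "\<sigma> powi (int n - 1) * \<sigma> powi (1 - int n) = 1"
            by (simp flip: power_int_add)
          thus ?case using modular_in_q_minus_inverse[OF \<phi>(1), of \<sigma>] elim
            by (simp flip: mult.assoc)
        qed
      qed simp
      hence "\<tau> powi (- int n - 1) * (dq ^^ n) \<phi> (qq (- 1 / \<tau>)) = (dq ^^ n) \<phi> (qq \<tau>)"
        unfolding bol_identity[OF holo \<tau>] higher_deriv_compose_qq[OF holo \<tau>]
        by simp
      hence "\<tau> powi (int n + 1) * (\<tau> powi (- int n - 1) * (dq ^^ n) \<phi> (qq (- 1 / \<tau>))) =
              \<tau> powi (int n + 1) * (dq ^^ n) \<phi> (qq \<tau>)" by simp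
      moreover have "\<tau> powi (int n + 1) * \<tau> powi (- int n - 1) = 1"
        using nz by (simp flip: power_int_add)
      ultimately show "(dq ^^ n) \<phi> (qq (- 1 / \<tau>)) = \<tau> powi (int n + 1) * (dq ^^ n) \<phi> (qq \<tau>)"
        by (simp flip: mult.assoc)
    qed
  qed
qed

section \<open>The forms \<open>E\<^sub>4\<close>, \<open>E\<^sub>6\<close> and \<open>\<Delta>\<close>\<close>

lemma conv_radius_ge_1_intros:
  fixes f g :: "complex fps"
  assumes "fps_conv_radius f \<ge> 1" "fps_conv_radius g \<ge> 1"
  shows "fps_conv_radius (f + g) \<ge> 1" "fps_conv_radius (f - g) \<ge> 1" "fps_conv_radius (f * g) \<ge> 1"
  using assms fps_conv_radius_add[of f g] fps_conv_radius_diff[of f g] fps_conv_radius_mult[of f g]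
  by (auto intro: order_trans[of 1 "min (fps_conv_radius f) (fps_conv_radius g)"])

lemma conv_radius_power_ge_1:
  fixes f :: "complex fps"
  shows "fps_conv_radius f \<ge> 1 \<Longrightarrow> fps_conv_radius (f ^ n) \<ge> 1"
  using fps_conv_radius_power[of f n] by (rule order_trans[rotated])

lemma holomorphic_eval_fps_disc:
  assumes "fps_conv_radius f \<ge> 1" "A \<subseteq> ball 0 1"
  shows "eval_fps f holomorphic_on A"
proof (intro holomorphic_intros subsetI)
  fix z assume "z \<in> A"
  hence "norm z < 1" using assms(2) by auto
  from in_unit_conv_radius[OF this assms(1)] show "z \<in> eball 0 (fps_conv_radius f)" by simp
qed

definition eis_fps :: "nat \<Rightarrow> complex fps" where
  "eis_fps j = 1 + fps_const (eis_coeff j) * sigma_fps (2 * j - 1)"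

lemma conv_radius_eis_fps: "fps_conv_radius (eis_fps j) \<ge> 1"
  unfolding eis_fps_def by (intro conv_radius_ge_1_intros conv_radius_sigma_fps) auto

lemma modular_series_eis_fps:
  assumes j: "j \<ge> 2"
  shows "modular_series (2 * int j) (fps_to_fls (eis_fps j))"
proof (rule modular_seriesI)
  have ev: "eval_fps (eis_fps j) q = 1 + eis_coeff j * eval_fps (sigma_fps (2 * j - 1)) q" if "norm q < 1" for q
  proof -
    have s: "ereal (norm q) < fps_conv_radius (sigma_fps (2 * j - 1))"
      by (intro in_unit_conv_radius that conv_radius_sigma_fps)
    moreover have "ereal (norm q) < fps_conv_radius (fps_const (eis_coeff j) * sigma_fps (2 * j - 1))"
      by (intro in_unit_conv_radius that conv_radius_ge_1_intros conv_radius_sigma_fps) auto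
    ultimately show ?thesis
      unfolding eis_fps_def by (subst eval_fps_add) (auto simp: eval_fps_mult)
  qed
  have holo: "eval_fps (eis_fps j) holomorphic_on punctured_disc"
    by (intro holomorphic_eval_fps_disc conv_radius_eis_fps) (auto simp: punctured_disc_def)
  show "modular_in_q (2 * int j) (eval_fps (eis_fps j))"
    unfolding modular_in_q_def
  proof (intro conjI allI impI holo)
    fix \<tau> :: complex assume \<tau>: "Im \<tau> > 0"
    have "\<tau> powi (2 * int j) = \<tau> ^ (2 * j)"
      by (simp flip: power_int_of_nat)
    thus "eval_fps (eis_fps j) (qq (- 1 / \<tau>)) = \<tau> powi (2 * int j) * eval_fps (eis_fps j) (qq \<tau>)"
      using eisenstein_modular[OF \<tau> j] ev norm_qq_less_1 \<tau> minus_inverse_upper by simp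
  qed
  show "eval_fps (eis_fps j) has_laurent_expansion fps_to_fls (eis_fps j)"
    by (intro has_laurent_expansion_fps eval_fps_has_fps_expansion less_le_trans[OF _ conv_radius_eis_fps]) simp
qed

lemma divisor_sum_eval:
  assumes "n > 0"
  shows "divisor_sum k n = 1 + (\<Sum>d\<leftarrow>[2..<n + 1]. if d dvd n then d ^ k else 0)"
proof -
  have "{d. d dvd n} = insert 1 {d \<in> {2..<n + 1}. d dvd n}"
  proof (intro set_eqI iffI)
    fix d assume "d \<in> {d. d dvd n}"
    with assms show "d \<in> insert 1 {d \<in> {2..<n + 1}. d dvd n}"
      by (cases "d = 0"; cases "d = 1") (auto dest: dvd_imp_le)
  qed auto
  hence "divisor_sum k n = (\<Sum>d\<in>insert 1 {d \<in> {2..<n + 1}. d dvd n}. d ^ k)"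
    unfolding divisor_sum_def by (rule arg_cong)
  also have "\<dots> = 1 + (\<Sum>d\<in>{d \<in> {2..<n + 1}. d dvd n}. d ^ k)"
    by (subst sum.insert) auto
  also have "(\<Sum>d\<in>{d \<in> {2..<n + 1}. d dvd n}. d ^ k) = (\<Sum>d\<in>{2..<n + 1}. if d dvd n then d ^ k else 0)"
    by (rule sum.inter_filter) simp
  also have "\<dots> = (\<Sum>d\<leftarrow>[2..<n + 1]. if d dvd n then d ^ k else 0)"
    by (simp only: interv_sum_list_conv_sum_set_nat set_upt)
  finally show ?thesis .
qed

lemma fps_to_fls_modular_series_eq:
  assumes "modular_series k (fps_to_fls f)" "modular_series k (fps_to_fls g)" "\<And>i. i < n \<Longrightarrow> fps_nth f i = fps_nth g i"
    "2 * k \<le> 21 * int n" "n > 0"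
  shows "f = g"
proof -
  have "fps_to_fls f - fps_to_fls g = 0"
    by (rule modular_series_eq_0[OF modular_series_diff[OF assms(1,2)] _ assms(4,5)]) (auto simp: assms(3) nat_less_iff)
  thus ?thesis by simp
qed

lemma eis_fps_nth_0 [simp]: "fps_nth (eis_fps j) 0 = 1"
  by (simp add: eis_fps_def sigma_fps_def)

lemma eis_fps_nth_1: "fps_nth (eis_fps j) (Suc 0) = eis_coeff j"
  by (simp add: eis_fps_def sigma_fps_def divisor_sum_eval)

lemma eis_fps_nth_2: "j > 0 \<Longrightarrow> fps_nth (eis_fps j) 2 = eis_coeff j * (1 + 2 ^ (2 * j - 1))"
  by (simp add: eis_fps_def sigma_fps_def divisor_sum_eval)

lemma fps_mult_nth_2: "fps_nth (f * g) 2 = fps_nth f 0 * fps_nth g 2 + fps_nth f 1 * fps_nth g 1 + fps_nth f 2 * fps_nth g 0"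
  by (simp add: fps_mult_nth numeral_2_eq_2)

text \<open>
  The spaces of modular forms of weight \<open>8\<close> and \<open>10\<close> are one-dimensional, so \<open>E\<^sub>4\<^sup>2 = E\<^sub>8\<close> and
  \<open>E\<^sub>4 E\<^sub>6 = E\<^sub>1\<^sub>0\<close>.  Comparing two coefficients determines the normalising constants without
  computing \<open>\<zeta>(4)\<close> and \<open>\<zeta>(6)\<close>.
\<close>
lemma eis_coeff_2: "eis_coeff 2 = 240"
proof -
  have "eis_fps 2 * eis_fps 2 = eis_fps 4"
    by (rule fps_to_fls_modular_series_eq[where k = 8 and n = 1])
       (use modular_series_mult[OF modular_series_eis_fps[of 2] modular_series_eis_fps[of 2]] modular_series_eis_fps[of 4] in \<open>auto simp: fls_times_fps_to_fls\<close>)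
  hence "fps_nth (eis_fps 2 * eis_fps 2) 1 = fps_nth (eis_fps 4) 1"
    "fps_nth (eis_fps 2 * eis_fps 2) 2 = fps_nth (eis_fps 4) 2" by simp_all
  \<comment> \<open>9 = 1 + 2^3 and 129 = 1 + 2^7 are divisor sums at 2. With c =
    \<open>eis_coeff 2\<close> the equations combine to 18 c + c^2 = 258 c.\<close>
  hence 1: "eis_coeff 4 = 2 * eis_coeff 2" and 2: "2 * (9 * eis_coeff 2) + eis_coeff 2 ^ 2 = 129 * eis_coeff 4"
    by (simp_all add: fps_mult_nth_1 fps_mult_nth_2 eis_fps_nth_1 eis_fps_nth_2 power2_eq_square)
  have "eis_coeff 2 * (eis_coeff 2 - 240) = 0"
    using 2 unfolding 1 by (simp add: algebra_simps power2_eq_square)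
  moreover have "eis_coeff 2 \<noteq> 0"
    using eisenstein_const_nonzero[of 2] by (simp add: eis_coeff_def lipschitz_const_def)
  ultimately show ?thesis by simp
qed

lemma eis_coeff_3: "eis_coeff 3 = - 504"
proof -
  have "eis_fps 2 * eis_fps 3 = eis_fps 5"
    by (rule fps_to_fls_modular_series_eq[where k = 10 and n = 1])
       (use modular_series_mult[OF modular_series_eis_fps[of 2] modular_series_eis_fps[of 3]] modular_series_eis_fps[of 5] in \<open>auto simp: fls_times_fps_to_fls\<close>)
  hence "fps_nth (eis_fps 2 * eis_fps 3) 1 = fps_nth (eis_fps 5) 1"
    "fps_nth (eis_fps 2 * eis_fps 3) 2 = fps_nth (eis_fps 5) 2" by simp_all
  \<comment> \<open>33 = 1 + 2^5 and 513 = 1 + 2^9.\<close>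
  hence 1: "eis_coeff 5 = 240 + eis_coeff 3" and 2: "33 * eis_coeff 3 + 240 * eis_coeff 3 + 9 * 240 = 513 * eis_coeff 5"
    by (simp_all add: fps_mult_nth_1 fps_mult_nth_2 eis_fps_nth_1 eis_fps_nth_2 eis_coeff_2 algebra_simps)
  have "240 * (eis_coeff 3 + 504) = 0" using 2 unfolding 1 by (simp add: algebra_simps)
  thus ?thesis by (simp add: add_eq_0_iff2)
qed

definition E4 :: "complex fps" where "E4 = 1 + 240 * sigma_fps 3"
definition E6 :: "complex fps" where "E6 = 1 - 504 * sigma_fps 5"

lemma E4_altdef: "E4 = eis_fps 2" and E6_altdef: "E6 = eis_fps 3"
  by (simp_all add: E4_def E6_def eis_fps_def eis_coeff_2 eis_coeff_3 numeral_fps_const flip: fps_const_neg)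

lemma conv_radius_E4: "fps_conv_radius E4 \<ge> 1" and conv_radius_E6: "fps_conv_radius E6 \<ge> 1"
  by (simp_all add: E4_altdef E6_altdef conv_radius_eis_fps)

lemma modular_series_E4: "modular_series 4 (fps_to_fls E4)" and modular_series_E6: "modular_series 6 (fps_to_fls E6)"
  using modular_series_eis_fps[of 2] modular_series_eis_fps[of 3] by (simp_all add: E4_altdef E6_altdef)

lemma E4_nth_0 [simp]: "fps_nth E4 0 = 1" and E6_nth_0 [simp]: "fps_nth E6 0 = 1"
  by (simp_all add: E4_altdef E6_altdef)

definition Delta :: "complex fps" where
  "Delta = fps_const (1 / 1728) * (E4 ^ 3 - E6 ^ 2)"

lemma Delta_mult_1728: "1728 * Delta = E4 ^ 3 - E6 ^ 2"
  by (simp add: Delta_def numeral_fps_const flip: mult.assoc)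

lemma conv_radius_Delta: "fps_conv_radius Delta \<ge> 1"
  unfolding Delta_def by (intro conv_radius_ge_1_intros conv_radius_power_ge_1 conv_radius_E4 conv_radius_E6) auto

lemma modular_series_Delta: "modular_series 12 (fps_to_fls Delta)"
proof -
  have "modular_series 12 (fls_const (1 / 1728) * (fps_to_fls E4 ^ 3 - fps_to_fls E6 ^ 2))"
    using modular_series_power[OF modular_series_E4, of 3] modular_series_power[OF modular_series_E6, of 2] by (intro modular_series_cmult modular_series_diff) auto
  thus ?thesis
    by (simp add: Delta_def fls_times_fps_to_fls fps_to_fls_power)
qed

lemma Delta_nth_0 [simp]: "fps_nth Delta 0 = 0"
  by (simp add: Delta_def fps_power_zeroth)

lemma Delta_nth_1 [simp]: "fps_nth Delta (Suc 0) = 1"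
proof -
  have "fps_nth E4 (Suc 0) = 240" "fps_nth E6 (Suc 0) = -504"
    by (simp_all add: E4_altdef E6_altdef eis_fps_nth_1 eis_coeff_2 eis_coeff_3)
  thus ?thesis by (simp add: Delta_def power_numeral_reduce fps_mult_nth_1)
qed

lemma Delta_nonzero [simp]: "Delta \<noteq> 0"
  using Delta_nth_1 by force

lemma theta_fps_to_fls: "theta (fps_to_fls f) = fps_to_fls (fps_X * fps_deriv f)"
  by (simp add: theta_def fls_deriv_fps_to_fls fls_times_fps_to_fls)

text \<open>The bracket of Delta with itself begins with (13 - 12) q^2, and three coefficients
  decide in weight 28. The identity is the differential equation that forbids zeros of
  Delta.\<close>

lemma modular_series_28_identity:
  "13 * (theta (fps_to_fls Delta))\<^sup>2 - 12 * (fps_to_fls Delta * theta (theta (fps_to_fls Delta))) =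
     fps_to_fls E4 * (fps_to_fls Delta)\<^sup>2"
proof -
  define P where "P = 13 * (fps_X * fps_deriv Delta)\<^sup>2 - 12 * (Delta * (fps_X * fps_deriv (fps_X * fps_deriv Delta)))"
  have P: "13 * (theta (fps_to_fls Delta))\<^sup>2 - 12 * (fps_to_fls Delta * theta (theta (fps_to_fls Delta))) = fps_to_fls P"
    unfolding P_def theta_fps_to_fls by (simp add: fls_times_fps_to_fls fps_to_fls_power)
  have "P = E4 * Delta\<^sup>2"
  proof (rule fps_to_fls_modular_series_eq[where k = 28 and n = 3])
    show "modular_series 28 (fps_to_fls P)" using modular_series_rankin_cohen_2[OF modular_series_Delta] by (simp add: P)
    show "modular_series 28 (fps_to_fls (E4 * Delta\<^sup>2))"
      using modular_series_mult[OF modular_series_E4 modular_series_power[OF modular_series_Delta, of 2]] by (simp add: fls_times_fps_to_fls fps_to_fls_power)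
    fix i :: nat assume "i < 3"
    hence "i = 0 \<or> i = 1 \<or> i = 2" by auto
    thus "fps_nth P i = fps_nth (E4 * Delta\<^sup>2) i"
      by (auto simp: P_def power2_eq_square fps_mult_nth_1 fps_mult_nth_2 numeral_fps_const fps_nth_Abs_fps)
  qed auto
  thus ?thesis by (simp add: P fls_times_fps_to_fls fps_to_fls_power)
qed

text \<open>Away from the cusp the factor q of q d/dq expands at the point z as z + X.\<close>

lemma has_fps_expansion_dq:
  assumes "(\<lambda>x. f (z + x)) has_fps_expansion P"
  shows "(\<lambda>x. dq f (z + x)) has_fps_expansion (fps_const z + fps_X) * fps_deriv P"
proof -
  have "deriv (\<lambda>x. f (z + x)) = (\<lambda>x. deriv f (z + x))"
    unfolding deriv_def using DERIV_shift[of f _ _ z] by (simp add: add.commute)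
  with has_fps_expansion_deriv[OF assms] have "(\<lambda>x. deriv f (z + x)) has_fps_expansion fps_deriv P"
    by simp
  thus ?thesis unfolding dq_def by (intro fps_expansion_intros)
qed

lemma X_deriv_X_power_mult:
  "fps_X * fps_deriv (fps_X ^ r * G) = fps_X ^ r * (of_nat r * G + fps_X * fps_deriv (G :: complex fps))"
proof -
  have "fps_X * fps_deriv (fps_X ^ r) = of_nat r * (fps_X ^ r :: complex fps)"
    by (induction r) (simp_all del: fps_deriv_power add: algebra_simps)
  thus ?thesis by (simp add: algebra_simps del: fps_deriv_power)
qed

text \<open>
  At a zero of \<open>\<Delta>\<close> of order \<open>r\<close> the form \<open>13 (\<theta>\<Delta>)\<^sup>2 - 12 \<Delta> \<theta>\<^sup>2\<Delta> = E\<^sub>4 \<Delta>\<^sup>2\<close> would have order exactly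
  \<open>2 r - 2\<close>, because its leading coefficient is a nonzero multiple of \<open>13 r\<^sup>2 - 12 r (r - 1)\<close>.
\<close>
lemma Delta_nonvanishing:
  assumes q: "q \<in> punctured_disc"
  shows "eval_fps Delta q \<noteq> 0"
proof
  assume zero: "eval_fps Delta q = 0"
  define f where "f = eval_fps Delta"
  have q': "q \<noteq> 0" "norm q < 1" using q by (auto simp: punctured_disc_def)
  have holo: "f holomorphic_on ball 0 1" "eval_fps E4 holomorphic_on ball 0 1"
    unfolding f_def by (auto intro: holomorphic_eval_fps_disc conv_radius_Delta conv_radius_E4)
  have holo': "f holomorphic_on punctured_disc" "eval_fps E4 holomorphic_on punctured_disc"
    using holo by (auto elim!: holomorphic_on_subset simp: punctured_disc_def)
  have fps_ball: "eval_fps g has_laurent_expansion fps_to_fls g" if "fps_conv_radius g \<ge> 1" for g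
    using that by (intro has_laurent_expansion_fps eval_fps_has_fps_expansion less_le_trans[OF _ that]) simp
  define I where "I = (\<lambda>w. 13 * (dq f w)\<^sup>2 - 12 * (f w * dq (dq f) w) - eval_fps E4 w * (f w)\<^sup>2)"
  \<comment> \<open>The identity of expansions at 0 continues to the whole punctured disc, so it may
    be expanded at the supposed zero.\<close>
  have I0: "I w = 0" if "w \<in> punctured_disc" for w
  proof (rule has_laurent_expansion_0_analytic_continuation[where A = "ball 0 1" and f = I and x = w])
    have "I has_laurent_expansion 13 * (theta (fps_to_fls Delta))\<^sup>2 - 12 * (fps_to_fls Delta * theta (theta (fps_to_fls Delta))) -
            fps_to_fls E4 * (fps_to_fls Delta)\<^sup>2"
      unfolding I_def f_def
      by (intro laurent_expansion_intros has_laurent_expansion_dq fps_ball conv_radius_Delta conv_radius_E4)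
    thus "I has_laurent_expansion 0" by (simp add: modular_series_28_identity)
    show "I holomorphic_on ball 0 1 - {0}"
      unfolding I_def punctured_disc_def[symmetric]
      by (intro holomorphic_intros holomorphic_dq holo')
  qed (use that in \<open>auto simp: punctured_disc_def\<close>)
  have an: "g analytic_on {q}" if "g holomorphic_on ball 0 1" for g
    using that q' by (auto simp: analytic_at intro!: exI[of _ "ball 0 1"])
  define P E where "P = fps_expansion f q" and "E = fps_expansion (eval_fps E4) q"
  have fP: "(\<lambda>x. f (q + x)) has_fps_expansion P" and fE: "(\<lambda>x. eval_fps E4 (q + x)) has_fps_expansion E"
    unfolding P_def E_def by (intro analytic_at_imp_has_fps_expansion an holo)+
  define u :: "complex fps" where "u = fps_const q + fps_X"
  have f1: "(\<lambda>x. dq f (q + x)) has_fps_expansion u * fps_deriv P"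
    unfolding u_def by (rule has_fps_expansion_dq[OF fP])
  have f2: "(\<lambda>x. dq (dq f) (q + x)) has_fps_expansion u * fps_deriv (u * fps_deriv P)"
    unfolding u_def by (rule has_fps_expansion_dq[OF f1[unfolded u_def]])
  have "eventually (\<lambda>w. w \<in> punctured_disc) (nhds q)"
    using q by (intro eventually_nhds_in_open open_punctured_disc)
  hence ev: "eventually (\<lambda>x. q + x \<in> punctured_disc) (nhds 0)"
    by (subst (asm) nhds_to_0) (simp add: eventually_filtermap add.commute)
  have "(\<lambda>x. I (q + x)) has_fps_expansion
     13 * (u * fps_deriv P)\<^sup>2 - 12 * (P * (u * fps_deriv (u * fps_deriv P))) - E * P\<^sup>2"
    unfolding I_def by (intro fps_expansion_intros f1 f2 fP fE)
  moreover have "(\<lambda>x. I (q + x)) has_fps_expansion 0"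
    unfolding has_fps_expansion_0_iff using ev by eventually_elim (simp add: I0)
  ultimately have eq: "13 * (u * fps_deriv P)\<^sup>2 - 12 * (P * (u * fps_deriv (u * fps_deriv P))) - E * P\<^sup>2 = 0"
    by (rule fps_expansion_unique_complex)
  have "P \<noteq> 0"
  proof
    assume "P = 0"
    hence "eventually (\<lambda>x. f (q + x) = 0) (nhds 0)" using fP by (simp add: has_fps_expansion_0_iff)
    hence "eventually (\<lambda>w. f w = 0) (nhds q)"
      by (subst nhds_to_0) (simp add: eventually_filtermap add.commute)
    then obtain S where S: "open S" "q \<in> S" "\<And>w. w \<in> S \<Longrightarrow> f w = 0"
      by (auto simp: eventually_nhds)
    have "f w = 0" if "w \<in> ball 0 1" for w
      by (rule analytic_continuation_open[of "S \<inter> ball 0 1" "ball 0 1" f "\<lambda>_. 0"])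
         (use S q' that holo in \<open>auto\<close>)
    hence "eventually (\<lambda>w. f w = 0) (nhds 0)"
      using eventually_nhds_in_open[of "ball 0 1" "0::complex"] by (auto elim!: eventually_mono)
    hence "f has_fps_expansion 0" by (simp add: has_fps_expansion_0_iff)
    moreover have "f has_fps_expansion Delta" unfolding f_def
      by (intro eval_fps_has_fps_expansion less_le_trans[OF _ conv_radius_Delta]) simp
    ultimately have "Delta = 0" by (intro fps_expansion_unique_complex)
    thus False by simp
  qed
  define r G where "r = subdegree P" and "G = fps_shift r P"
  have PG: "P = fps_X ^ r * G" by (simp add: r_def G_def fps_shift_times_fps_X_power mult.commute)
  have G0: "fps_nth G 0 \<noteq> 0" using \<open>P \<noteq> 0\<close> by (simp add: G_def r_def)
  have "fps_nth P 0 = 0" using has_fps_expansion_imp_0_eq_fps_nth_0[OF fP] zero by (simp add: f_def)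
  hence r0: "r > 0" using \<open>P \<noteq> 0\<close> by (intro Nat.gr0I) (simp add: r_def subdegree_eq_0_iff)
  define G1 where "G1 = of_nat r * G + fps_X * fps_deriv G"
  define H where "H = u * G1"
  define A where "A = u * fps_deriv P"
  have XA: "fps_X * A = fps_X ^ r * H"
    using X_deriv_X_power_mult[of r G] by (simp add: A_def H_def G1_def PG mult_ac)
  have XB: "fps_X\<^sup>2 * (u * fps_deriv A) = fps_X ^ r * (u * (of_nat r * H + fps_X * fps_deriv H - H))"
  proof -
    have "fps_X\<^sup>2 * fps_deriv A = fps_X * fps_deriv (fps_X * A) - fps_X * A"
      by (simp add: power2_eq_square algebra_simps)
    also have "\<dots> = fps_X ^ r * (of_nat r * H + fps_X * fps_deriv H) - fps_X ^ r * H"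
      unfolding XA by (simp only: X_deriv_X_power_mult)
    finally have "u * (fps_X\<^sup>2 * fps_deriv A) = u * (fps_X ^ r * (of_nat r * H + fps_X * fps_deriv H) - fps_X ^ r * H)"
      by simp
    thus ?thesis by (simp add: algebra_simps)
  qed
  \<comment> \<open>The factor X^2 turns the powers X^(r-1) and X^(r-2) of the derivatives into X^r,
    so that r = 1 needs no separate treatment.\<close>
  have "0 = fps_X\<^sup>2 * (13 * A\<^sup>2 - 12 * (P * (u * fps_deriv A)) - E * P\<^sup>2)"
    using eq by (simp add: A_def)
  also have "\<dots> = 13 * (fps_X * A)\<^sup>2 - 12 * (P * (fps_X\<^sup>2 * (u * fps_deriv A))) - fps_X\<^sup>2 * E * P\<^sup>2"
    by (simp add: algebra_simps power2_eq_square)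
  also have "\<dots> = (fps_X ^ r)\<^sup>2 * (13 * H\<^sup>2 - 12 * (G * (u * (of_nat r * H + fps_X * fps_deriv H - H))) - fps_X\<^sup>2 * E * G\<^sup>2)"
    unfolding XA XB PG by (simp add: algebra_simps power2_eq_square)
  finally have "13 * H\<^sup>2 - 12 * (G * (u * (of_nat r * H + fps_X * fps_deriv H - H))) - fps_X\<^sup>2 * E * G\<^sup>2 = 0"
    by simp
  hence "fps_nth (13 * H\<^sup>2 - 12 * (G * (u * (of_nat r * H + fps_X * fps_deriv H - H))) - fps_X\<^sup>2 * E * G\<^sup>2) 0 = 0"
    by simp
  hence "(q * fps_nth G 0)\<^sup>2 * (13 * of_nat r ^ 2 - 12 * of_nat r * (of_nat r - 1)) = 0"
    by (simp add: H_def G1_def u_def fps_power_zeroth power2_eq_square numeral_fps_const fps_of_nat [symmetric] algebra_simps)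
  hence "13 * of_nat r ^ 2 - 12 * of_nat r * (of_nat r - 1) = (0 :: complex)" using q' G0 by simp
  \<comment> \<open>13 r^2 - 12 r (r - 1) = r^2 + 12 r, which is positive for r > 0.\<close>
  hence "of_nat (r ^ 2 + 12 * r) = (0 :: complex)" by (simp add: algebra_simps power2_eq_square)
  thus False using r0 by (subst (asm) of_nat_eq_0_iff) simp
qed

lemma modular_series_inverse_Delta: "modular_series (-12) (inverse (fps_to_fls Delta))"
proof (rule modular_seriesI)
  have D: "modular_in_q 12 (eval_fps Delta)"
    by (rule modular_in_q_eval_fps[OF modular_series_Delta conv_radius_Delta])
  show "modular_in_q (-12) (\<lambda>q. inverse (eval_fps Delta q))"
    unfolding modular_in_q_def
  proof (intro conjI allI impI)
    show "(\<lambda>q. inverse (eval_fps Delta q)) holomorphic_on punctured_disc"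
      by (intro holomorphic_on_inverse modular_in_q_holomorphic[OF D] Delta_nonvanishing)
    fix \<tau> :: complex assume "Im \<tau> > 0"
    from modular_in_q_minus_inverse[OF D this]
    show "inverse (eval_fps Delta (qq (- 1 / \<tau>))) = \<tau> powi - 12 * inverse (eval_fps Delta (qq \<tau>))"
      by (simp add: power_int_minus field_simps)
  qed
  show "(\<lambda>q. inverse (eval_fps Delta q)) has_laurent_expansion inverse (fps_to_fls Delta)"
    by (intro laurent_expansion_intros has_laurent_expansion_fps eval_fps_has_fps_expansion
          less_le_trans[OF _ conv_radius_Delta]) simp
qed

section \<open>Weight 2 and uniqueness in weights 4 to 14\<close>

lemma fls_as_fps_nonneg:
  assumes "\<And>i. i < 0 \<Longrightarrow> fls_nth F i = 0"
  obtains f where "F = fps_to_fls f"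
proof
  show "F = fps_to_fls (fls_regpart F)"
    by (rule fls_eqI) (use assms in \<open>auto simp: not_le\<close>)
qed

text \<open>If c is the constant term of f, comparison of constant terms in weights 6 and 8 gives f
  E_4 = c E_6 and f E_6 = c E_4^2. Eliminating f leaves c (E_4^3 - E_6^2) = 0, hence c = 0 and f =
  0.\<close>

lemma modular_series_2_eq_0:
  assumes F: "modular_series 2 F" and nonneg: "\<And>i. i < 0 \<Longrightarrow> fls_nth F i = 0"
  shows "F = 0"
proof -
  obtain f where f: "F = fps_to_fls f" using fls_as_fps_nonneg[OF nonneg] by blast
  define c where "c = fps_nth f 0"
  have 1: "f * E4 = fps_const c * E6"
  proof (rule fps_to_fls_modular_series_eq[where k = 6 and n = 1])
    show "modular_series 6 (fps_to_fls (f * E4))" using modular_series_mult[OF F modular_series_E4] by (simp add: f fls_times_fps_to_fls)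
    show "modular_series 6 (fps_to_fls (fps_const c * E6))" using modular_series_cmult[OF modular_series_E6] by (simp add: fls_times_fps_to_fls)
  qed (auto simp: c_def)
  have 2: "f * E6 = fps_const c * E4 ^ 2"
  proof (rule fps_to_fls_modular_series_eq[where k = 8 and n = 1])
    show "modular_series 8 (fps_to_fls (f * E6))" using modular_series_mult[OF F modular_series_E6] by (simp add: f fls_times_fps_to_fls)
    show "modular_series 8 (fps_to_fls (fps_const c * E4 ^ 2))" using modular_series_cmult[OF modular_series_power[OF modular_series_E4, of 2]]
      by (simp add: fls_times_fps_to_fls fps_to_fls_power)
  qed (auto simp: c_def fps_power_zeroth)
  have "fps_const c * (E4 ^ 3 - E6 ^ 2) = (fps_const c * E4 ^ 2) * E4 - (fps_const c * E6) * E6"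
    by (simp add: algebra_simps power2_eq_square power3_eq_cube)
  also have "\<dots> = 0" unfolding 1[symmetric] 2[symmetric] by simp
  finally have "fps_const c * (1728 * Delta) = 0" by (simp add: Delta_mult_1728)
  hence "c = 0" by auto
  with 1 have "f * E4 = 0" by simp
  moreover have "E4 \<noteq> 0" using E4_nth_0 by force
  ultimately show ?thesis by (simp add: f)
qed

lemma inverse_Delta:
  obtains g where "inverse (fps_to_fls Delta) = fls_X_inv * fps_to_fls g" "fps_nth g 0 = 1"
proof
  define h where "h = fps_shift 1 Delta"
  have D: "Delta = fps_X * h"
    by (rule fps_ext) (auto simp: h_def)
  have h0: "fps_nth h 0 = 1" by (simp add: h_def)
  hence "inverse h * h = 1" by (intro inverse_mult_eq_1) simp
  hence "fps_to_fls (inverse h) * fps_to_fls h = 1" by (simp flip: fls_times_fps_to_fls)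
  hence "fps_to_fls (inverse h) = inverse (fps_to_fls h)"
    by (simp add: inverse_unique[of "fps_to_fls h" "fps_to_fls (inverse h)"] mult.commute)
  thus "inverse (fps_to_fls Delta) = fls_X_inv * fps_to_fls (inverse h)"
    unfolding D by (simp add: fls_times_fps_to_fls fls_inverse_X mult.commute)
  show "fps_nth (inverse h) 0 = 1" using h0 by simp
qed

text \<open>Up to weight 10 the vanishing criterion with n = 1 applies. In weight 14, division by
  Delta uses up the zero at the cusp and leads to a form of weight 2 without pole.\<close>

lemma modular_series_cusp_eq_0:
  assumes F: "modular_series k F" and k: "k \<in> {4, 6, 8, 10, 14}" and cusp: "\<And>i. i \<le> 0 \<Longrightarrow> fls_nth F i = 0"
  shows "F = 0"
proof (cases "k = 14")
  case False
  show ?thesis by (rule modular_series_eq_0[OF F, of 1]) (use cusp k False in auto)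
next
  case True
  obtain g where g: "inverse (fps_to_fls Delta) = fls_X_inv * fps_to_fls g" using inverse_Delta by metis
  obtain f where f: "F = fps_to_fls f" using fls_as_fps_nonneg[of F] cusp by force
  have f0: "fps_nth f 0 = 0" using cusp[of 0] by (simp add: f)
  hence f': "f = fps_X * fps_shift 1 f" by (intro fps_ext) auto
  have "F * inverse (fps_to_fls Delta) = fps_to_fls (fps_shift 1 f * g)"
  proof -
    have "F * inverse (fps_to_fls Delta) = (fls_X * fls_X_inv) * fps_to_fls (fps_shift 1 f * g)"
      unfolding f g by (subst f') (simp add: fls_times_fps_to_fls)
    thus ?thesis by (simp add: fls_X_times_conv_shift)
  qed
  hence "F * inverse (fps_to_fls Delta) = 0"
    using modular_series_mult[OF F modular_series_inverse_Delta] by (intro modular_series_2_eq_0) (auto simp: True)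
  thus ?thesis by simp
qed

text \<open>Euclidean descent on |c|: with t = a div c the matrix is T^t S times a matrix with lower
  left entry a mod c. For c = 0 the evenness of k absorbs the sign of -I.\<close>

lemma modular_in_q_SL2:
  fixes a b c d :: int
  assumes \<phi>: "modular_in_q k \<phi>" and "even k" and "a * d - b * c = 1" and \<tau>: "Im \<tau> > 0"
  shows "\<phi> (qq ((of_int a * \<tau> + of_int b) / (of_int c * \<tau> + of_int d))) =
           (of_int c * \<tau> + of_int d) powi k * \<phi> (qq \<tau>)"
  using assms(3)
proof (induction "nat \<bar>c\<bar>" arbitrary: a b c d rule: less_induct)
  case less
  have qq_int: "qq (\<sigma> + of_int n) = qq \<sigma>" for \<sigma> n by (rule invariant_shift_int) simp
  show ?case
  proof (cases "c = 0")
    case True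
    hence "a * d = 1" using less.prems by simp
    hence "a = 1 \<and> d = 1 \<or> a = -1 \<and> d = -1" by (simp add: zmult_eq_1_iff)
    thus ?thesis
    proof
      assume "a = 1 \<and> d = 1"
      thus ?thesis using True by (simp add: qq_int)
    next
      assume *: "a = -1 \<and> d = -1"
      have "(- \<tau> + of_int b) / (-1) = \<tau> + of_int (- b)" by (simp add: field_simps)
      thus ?thesis using True * \<open>even k\<close> qq_int[of \<tau> "-b"] by simp
    qed
  next
    case False
    define t r b' where "t = a div c" and "r = a mod c" and "b' = b - t * d"
    have r: "nat \<bar>r\<bar> < nat \<bar>c\<bar>" using False by (simp add: r_def abs_mod_less)
    have a: "a = t * c + r" by (simp add: t_def r_def)
    have det: "(- c) * b' - (- d) * r = 1"
      using less.prems by (simp add: a b'_def algebra_simps)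
    define y where "y = (of_int (- c) * \<tau> + of_int (- d)) / (of_int r * \<tau> + of_int b')"
    have nz: "of_int m * \<tau> + of_int n \<noteq> 0" if "m \<noteq> 0 \<or> n \<noteq> 0" for m n :: int
    proof
      assume "of_int m * \<tau> + of_int n = 0"
      hence "Im (of_int m * \<tau> + of_int n) = 0" "Re (of_int m * \<tau> + of_int n) = 0" by simp_all
      thus False using \<tau> that by auto
    qed
    have nz1: "of_int c * \<tau> + of_int d \<noteq> 0" using False by (intro nz) auto
    have nz2: "of_int r * \<tau> + of_int b' \<noteq> 0" using det by (intro nz) auto
    have "Im y > 0"
    proof -
      have "Im y = of_int ((- c) * b' - (- d) * r) * Im \<tau> / (norm (of_int r * \<tau> + of_int b'))\<^sup>2"
        unfolding y_def by (simp add: Im_divide cmod_power2 algebra_simps)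
      also have "\<dots> > 0" unfolding det using \<tau> nz2 by simp
      finally show ?thesis .
    qed
    have "(of_int a * \<tau> + of_int b) / (of_int c * \<tau> + of_int d) = - 1 / y + of_int t"
    proof -
      have "of_int a * \<tau> + of_int b = (of_int r * \<tau> + of_int b') + of_int t * (of_int c * \<tau> + of_int d)"
        by (simp add: a b'_def algebra_simps)
      moreover have "- 1 / y = (of_int r * \<tau> + of_int b') / (of_int c * \<tau> + of_int d)"
      proof -
        have "of_int (- c) * \<tau> + of_int (- d) = - (of_int c * \<tau> + of_int d)" by simp
        hence "y = - ((of_int c * \<tau> + of_int d) / (of_int r * \<tau> + of_int b'))"
          unfolding y_def by (simp only: minus_divide_left)
        thus ?thesis by (metis divide_divide_eq_right minus_divide_left minus_divide_right mult_1 verit_minus_simplify(4))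
      qed
      ultimately show ?thesis using nz1 by (simp only: add_divide_distrib) simp
    qed
    hence "\<phi> (qq ((of_int a * \<tau> + of_int b) / (of_int c * \<tau> + of_int d))) = \<phi> (qq (- 1 / y))"
      by (simp only: qq_int)
    also have "\<dots> = y powi k * \<phi> (qq y)" by (rule modular_in_q_minus_inverse[OF \<phi> \<open>Im y > 0\<close>])
    also have "\<phi> (qq y) = (of_int r * \<tau> + of_int b') powi k * \<phi> (qq \<tau>)"
      unfolding y_def by (rule less.hyps[OF r det])
    also have "y powi k * ((of_int r * \<tau> + of_int b') powi k * \<phi> (qq \<tau>)) = (of_int (- c) * \<tau> + of_int (- d)) powi k * \<phi> (qq \<tau>)"
      unfolding y_def using nz2 by (simp add: power_int_divide_distrib)
    also have "of_int (- c) * \<tau> + of_int (- d) = - (of_int c * \<tau> + of_int d)" by simp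
    also have "\<dots> powi k = (of_int c * \<tau> + of_int d) powi k"
      using \<open>even k\<close> by (simp only: power_int_minus_left if_True)
    finally show ?thesis .
  qed
qed

section \<open>Modular equations of level 2 and 3\<close>

lemma holomorphic_mult_eq_0:
  assumes "f holomorphic_on S" "g holomorphic_on S" "open S" "connected S"
    and "\<And>z. z \<in> S \<Longrightarrow> f z * g z = 0"
  shows "(\<forall>z\<in>S. f z = 0) \<or> (\<forall>z\<in>S. g z = 0)"
proof (rule disjCI)
  assume "\<not> (\<forall>z\<in>S. g z = 0)"
  then obtain z0 where z0: "z0 \<in> S" "g z0 \<noteq> 0" by auto
  have "open (S \<inter> g -` (- {0}))"
    by (rule continuous_open_preimage[OF holomorphic_on_imp_continuous_on[OF assms(2)] assms(3)]) auto
  hence opn: "open {z \<in> S. g z \<noteq> 0}"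
    by (simp add: vimage_def Int_def)
  show "\<forall>z\<in>S. f z = 0"
  proof
    fix z assume "z \<in> S"
    show "f z = 0"
      by (rule analytic_continuation_open[of "{z \<in> S. g z \<noteq> 0}" S f "\<lambda>_. 0"])
         (use opn z0 assms \<open>z \<in> S\<close> in auto)
  qed
qed

lemma modular_E4: "modular_in_q 4 (eval_fps E4)"
  by (rule modular_in_q_eval_fps[OF modular_series_E4 conv_radius_E4])

lemma modular_Delta: "modular_in_q 12 (eval_fps Delta)"
  by (rule modular_in_q_eval_fps[OF modular_series_Delta conv_radius_Delta])

lemma bounded_eval_fps:
  assumes "fps_conv_radius f \<ge> 1" "y > 0"
  obtains R where "\<And>\<tau>. Im \<tau> \<ge> y \<Longrightarrow> norm (eval_fps f (qq \<tau>)) \<le> R"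
proof -
  define r where "r = exp (- (2 * pi * y))"
  have r: "r < 1" using assms(2) by (simp add: r_def)
  have "continuous_on (cball 0 r) (eval_fps f)"
    using r by (intro holomorphic_on_imp_continuous_on holomorphic_eval_fps_disc assms) auto
  hence "compact (eval_fps f ` cball 0 r)" by (rule compact_continuous_image) simp
  hence "bounded (eval_fps f ` cball 0 r)" by (rule compact_imp_bounded)
  then obtain R where "\<forall>x\<in>eval_fps f ` cball 0 r. norm x \<le> R"
    unfolding bounded_iff by blast
  hence R: "norm (eval_fps f q) \<le> R" if "norm q \<le> r" for q
    using that by simp
  show ?thesis
    by (rule that[of R], rule R) (simp add: norm_qq r_def)
qed

text \<open>
  A Sturm bound for \<open>\<Gamma>\<^sub>0(p)\<close>: the product of \<open>P(E\<^sub>4(\<tau>), E\<^sub>4(p\<tau>), \<Delta>(\<tau>))\<close> with its conjugates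
  \<open>P(E\<^sub>4(\<tau>), p\<^sup>-\<^sup>4 E\<^sub>4((\<tau>+j)/p), \<Delta>(\<tau>))\<close> has level one, and it vanishes identically if the order
  of the first factor at the cusp is too large.
\<close>
lemma level_p_identity:
  fixes P :: "complex \<Rightarrow> complex \<Rightarrow> complex \<Rightarrow> complex" and w p n :: nat
  assumes p: "p = 2 \<or> p = 3"
    and hom: "\<And>s a b t. P (s ^ 4 * a) (s ^ 4 * b) (s ^ 12 * t) = s ^ w * P a b t"
    and holo: "\<And>f g h S. f holomorphic_on S \<Longrightarrow> g holomorphic_on S \<Longrightarrow> h holomorphic_on S \<Longrightarrow>
                 (\<lambda>z. P (f z) (g z) (h z)) holomorphic_on S"
    and cont: "continuous_on UNIV (\<lambda>(a, b, t). P a b t)"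
    and F: "(\<lambda>q. P (eval_fps E4 q) (eval_fps E4 (q ^ p)) (eval_fps Delta q)) has_fps_expansion F"
    and F0: "\<And>i. i < n \<Longrightarrow> fps_nth F i = 0"
    and n: "2 * (p + 1) * w \<le> 21 * n" "n > 0"
    and \<tau>: "Im \<tau> > 0"
  shows "P (eval_fps E4 (qq \<tau>)) (eval_fps E4 (qq (of_nat p * \<tau>))) (eval_fps Delta (qq \<tau>)) = 0"
    and "P (eval_fps E4 (qq \<tau>)) (eval_fps E4 (qq (\<tau> / of_nat p)) / of_nat p ^ 4) (eval_fps Delta (qq \<tau>)) = 0"
proof -
  define e d where "e = eval_fps E4" and "d = eval_fps Delta"
  let ?H = "{\<tau>. Im \<tau> > 0}"
  define x where "x = (\<lambda>j \<tau>. (\<tau> + of_nat j) / of_nat p :: complex)"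
  define G0 where "G0 = (\<lambda>\<tau>. P (e (qq \<tau>)) (e (qq (of_nat p * \<tau>))) (d (qq \<tau>)))"
  define G where "G = (\<lambda>j \<tau>. P (e (qq \<tau>)) (e (qq (x j \<tau>)) / of_nat p ^ 4) (d (qq \<tau>)))"
  have p0: "p > 0" using p by auto
  have Im_x: "Im (x j \<tau>) = Im \<tau> / p" for j \<tau> by (simp add: x_def)
  have eS: "e (qq (- 1 / \<tau>)) = \<tau> ^ 4 * e (qq \<tau>)" and dS: "d (qq (- 1 / \<tau>)) = \<tau> ^ 12 * d (qq \<tau>)"
    if "Im \<tau> > 0" for \<tau>
    using modular_in_q_minus_inverse[OF modular_E4 that] modular_in_q_minus_inverse[OF modular_Delta that]
    by (simp_all add: e_def d_def)
  \<comment> \<open>Here p \<tau> becomes -1/(\<tau>/p), and the law of weight 4 at \<tau>/p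
    produces the factor p^(-4) built into \<open>G\<close>.\<close>
  have S0: "G0 (- 1 / \<tau>) = \<tau> ^ w * G 0 \<tau>" if "Im \<tau> > 0" for \<tau>
  proof -
    have "of_nat p * (- 1 / \<tau>) = - 1 / x 0 \<tau>" using p0 that by (auto simp: x_def)
    hence "e (qq (of_nat p * (- 1 / \<tau>))) = \<tau> ^ 4 * (e (qq (x 0 \<tau>)) / of_nat p ^ 4)"
      using eS[of "x 0 \<tau>"] that p0 by (simp add: x_def power_divide)
    thus ?thesis unfolding G0_def G_def by (simp only: eS[OF that] dS[OF that] hom)
  qed
  have S1: "G 0 (- 1 / \<tau>) = \<tau> ^ w * G0 \<tau>" if "Im \<tau> > 0" for \<tau>
  proof -
    have "x 0 (- 1 / \<tau>) = - 1 / (of_nat p * \<tau>)" using p0 that by (auto simp: x_def field_simps)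
    hence "e (qq (x 0 (- 1 / \<tau>))) / of_nat p ^ 4 = \<tau> ^ 4 * e (qq (of_nat p * \<tau>))"
      using eS[of "of_nat p * \<tau>"] that p0 by (simp add: power_mult_distrib)
    thus ?thesis unfolding G0_def G_def by (simp only: eS[OF that] dS[OF that] hom)
  qed
  \<comment> \<open>For p = 2 and p = 3 one has j (p - j) = p - 1, so the matrix with rows (j, -1)
    and (p, j - p) has determinant 1. It carries \<open>x (p - j) \<tau>\<close> to
    \<open>x j (- 1 / \<tau>)\<close>.\<close>
  have S2: "G j (- 1 / \<tau>) = \<tau> ^ w * G (p - j) \<tau>" if "Im \<tau> > 0" "0 < j" "j < p" for \<tau> j
  proof -
    have det: "int j * (- int (p - j)) - (- 1) * int p = 1"
      using p that by (auto simp: less_Suc_eq numeral_2_eq_2 numeral_3_eq_3)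
    have nz: "\<tau> \<noteq> 0" using that by auto
    have den: "of_int (int p) * x (p - j) \<tau> + of_int (- int (p - j)) = \<tau>"
      using p0 by (simp add: x_def)
    have "of_nat j * of_nat (p - j) = (of_nat p - 1 :: complex)"
      using p that by (auto simp: less_Suc_eq numeral_2_eq_2 numeral_3_eq_3)
    hence "of_int (int j) * x (p - j) \<tau> + of_int (- 1) = (of_nat j * \<tau> - 1) / of_nat p"
      using p0 by (simp add: x_def field_simps)
    hence "(of_int (int j) * x (p - j) \<tau> + of_int (- 1)) / \<tau> = x j (- 1 / \<tau>)"
      using nz p0 by (simp add: x_def field_simps)
    hence "e (qq (x j (- 1 / \<tau>))) = \<tau> powi 4 * e (qq (x (p - j) \<tau>))"
      using modular_in_q_SL2[OF modular_E4 _ det, of "x (p - j) \<tau>"] that p0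
      unfolding e_def den by (simp add: Im_x)
    hence "e (qq (x j (- 1 / \<tau>))) / of_nat p ^ 4 = \<tau> ^ 4 * (e (qq (x (p - j) \<tau>)) / of_nat p ^ 4)"
      by simp
    thus ?thesis unfolding G_def by (simp only: eS[OF that(1)] dS[OF that(1)] hom)
  qed
  have T0: "G0 (\<tau> + 1) = G0 \<tau>" for \<tau>
  proof -
    have "qq (of_nat p * (\<tau> + 1)) = qq (of_nat p * \<tau>)" by (simp add: qq_of_nat_mult)
    thus ?thesis by (simp add: G0_def)
  qed
  have T1: "G j (\<tau> + 1) = G (Suc j) \<tau>" for j \<tau>
    using qq_plus_1[of \<tau>] by (simp add: G_def x_def add_ac)
  have T2: "G p \<tau> = G 0 \<tau>" for \<tau>
    using p0 by (simp add: G_def x_def add_divide_distrib)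
  define N where "N = (\<lambda>\<tau>. G0 \<tau> * (\<Prod>j<p. G j \<tau>))"
  have prod: "(\<Prod>j<p. G j \<tau>) = (if p = 2 then G 0 \<tau> * G 1 \<tau> else G 0 \<tau> * G 1 \<tau> * G 2 \<tau>)" for \<tau>
    using p by (auto simp: numeral_2_eq_2 numeral_3_eq_3)
  have NT: "N (\<tau> + 1) = N \<tau>" for \<tau>
    using p T2[of \<tau>] by (auto simp: N_def prod T0 T1 numeral_2_eq_2 numeral_3_eq_3)
  have NS: "N (- 1 / \<tau>) = \<tau> powi int ((p + 1) * w) * N \<tau>" if "Im \<tau> > 0" for \<tau>
  proof -
    have "N (- 1 / \<tau>) = \<tau> ^ ((p + 1) * w) * N \<tau>"
      using p
    proof
      assume p: "p = 2"
      have "N \<sigma> = G0 \<sigma> * (G 0 \<sigma> * G 1 \<sigma>)" for \<sigma>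
        unfolding N_def prod using p by simp
      moreover have "G 1 (- 1 / \<tau>) = \<tau> ^ w * G 1 \<tau>"
        using S2[OF that, of 1] p by simp
      moreover have "\<tau> ^ ((p + 1) * w) = \<tau> ^ w * (\<tau> ^ w * \<tau> ^ w)"
      proof -
        have "(p + 1) * w = w + (w + w)" using p by simp
        thus ?thesis by (simp only: power_add)
      qed
      ultimately show ?thesis by (simp only: S0[OF that] S1[OF that] mult_ac)
    next
      assume p: "p = 3"
      have "N \<sigma> = G0 \<sigma> * (G 0 \<sigma> * G 1 \<sigma> * G 2 \<sigma>)" for \<sigma>
        unfolding N_def prod using p by simp
      moreover have "G 1 (- 1 / \<tau>) = \<tau> ^ w * G 2 \<tau>"
        using S2[OF that, of 1] p by (simp add: numeral_2_eq_2)
      moreover have "G 2 (- 1 / \<tau>) = \<tau> ^ w * G 1 \<tau>"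
        using S2[OF that, of 2] p by simp
      moreover have "\<tau> ^ ((p + 1) * w) = \<tau> ^ w * (\<tau> ^ w * (\<tau> ^ w * \<tau> ^ w))"
      proof -
        have "(p + 1) * w = w + (w + (w + w))" using p by simp
        thus ?thesis by (simp only: power_add)
      qed
      ultimately show ?thesis by (simp only: S0[OF that] S1[OF that] mult_ac)
    qed
    thus ?thesis by (simp only: power_int_of_nat)
  qed
  have he: "(\<lambda>\<tau>. eval_fps f (qq (c * \<tau> + b))) holomorphic_on ?H"
    if f: "fps_conv_radius f \<ge> 1" and c: "c \<in> \<real>" "Re c > 0" and b: "Im b = 0" for f c b
  proof -
    have "Im c = 0" using c by (simp add: complex_is_Real_iff)
    have "qq holomorphic_on UNIV" by (rule holomorphic_qq)
    hence "qq \<circ> (\<lambda>\<tau>. c * \<tau> + b) holomorphic_on ?H"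
      by (intro holomorphic_on_compose_gen[where t = UNIV] holomorphic_intros) auto
    hence "eval_fps f \<circ> (qq \<circ> (\<lambda>\<tau>. c * \<tau> + b)) holomorphic_on ?H"
      by (rule holomorphic_on_compose_gen[OF _ holomorphic_eval_fps_disc[OF f order_refl]])
         (use c b \<open>Im c = 0\<close> in \<open>auto intro!: norm_qq_less_1\<close>)
    thus ?thesis by (simp add: o_def)
  qed
  have h1: "(\<lambda>\<tau>. e (qq \<tau>)) holomorphic_on ?H" "(\<lambda>\<tau>. d (qq \<tau>)) holomorphic_on ?H"
    using he[OF conv_radius_E4, of 1 0] he[OF conv_radius_Delta, of 1 0] by (simp_all add: e_def d_def)
  have hG0: "G0 holomorphic_on ?H" unfolding G0_def
    using he[OF conv_radius_E4, of "of_nat p" 0] p0 by (intro holo h1) (simp add: e_def)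
  have hG: "G j holomorphic_on ?H" for j unfolding G_def
  proof (intro holo h1 holomorphic_intros)
    show "(\<lambda>\<tau>. e (qq (x j \<tau>))) holomorphic_on ?H"
      using he[OF conv_radius_E4, of "1 / of_nat p" "of_nat j / of_nat p"] p0
      by (simp add: e_def x_def add_divide_distrib)
  qed (use p0 in auto)
  have hN: "N holomorphic_on ?H"
    unfolding N_def by (intro holomorphic_intros hG0 hG)
  obtain R1 where R1: "\<And>\<tau>. Im \<tau> \<ge> 1 / p \<Longrightarrow> norm (e (qq \<tau>)) \<le> R1"
    unfolding e_def using bounded_eval_fps[OF conv_radius_E4, of "1 / p"] p0 by auto
  obtain R2 where R2: "\<And>\<tau>. Im \<tau> \<ge> 1 / p \<Longrightarrow> norm (d (qq \<tau>)) \<le> R2"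
    unfolding d_def using bounded_eval_fps[OF conv_radius_Delta, of "1 / p"] p0 by auto
  have bdd: "\<exists>C. \<forall>a b t. norm a \<le> R \<longrightarrow> norm b \<le> R \<longrightarrow> norm t \<le> R \<longrightarrow> norm (P a b t) \<le> C" for R
  proof -
    let ?K = "cball 0 R \<times> cball 0 R \<times> cball (0::complex) R"
    have "bounded ((\<lambda>(a, b, t). P a b t) ` ?K)"
      by (intro compact_imp_bounded compact_continuous_image compact_Times compact_cball
            continuous_on_subset[OF cont]) auto
    then obtain C where "\<forall>x\<in>(\<lambda>(a, b, t). P a b t) ` ?K. norm x \<le> C"
      unfolding bounded_iff by blast
    thus ?thesis by (intro exI[of _ C]) auto
  qed
  obtain C where C: "\<And>a b t. norm a \<le> max R1 R2 \<Longrightarrow> norm b \<le> max R1 R2 \<Longrightarrow> norm t \<le> max R1 R2 \<Longrightarrow> norm (P a b t) \<le> C"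
    using bdd[of "max R1 R2"] by blast
  \<comment> \<open>The conjugates only have to stay bounded near the cusp; the decay of
    \<open>N\<close> comes from \<open>G0\<close>.\<close>
  have GC: "norm (G j \<tau>) \<le> C" if "Im \<tau> \<ge> 1" for j \<tau>
    unfolding G_def
  proof (rule C)
    have p1: "1 / real p \<le> Im \<tau>" using that p0 by (auto intro!: order_trans[OF _ that])
    show "norm (e (qq \<tau>)) \<le> max R1 R2" using R1[OF p1] by simp
    show "norm (d (qq \<tau>)) \<le> max R1 R2" using R2[OF p1] by simp
    have "norm (e (qq (x j \<tau>)) / of_nat p ^ 4) \<le> norm (e (qq (x j \<tau>)))"
      using p0 by (simp add: norm_divide norm_power divide_le_eq mult_le_cancel_left1 one_le_power)
    also have "\<dots> \<le> R1" using that p0 by (intro R1) (simp add: Im_x divide_right_mono)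
    finally show "norm (e (qq (x j \<tau>)) / of_nat p ^ 4) \<le> max R1 R2" by simp
  qed
  have "\<And>i. i < int n \<Longrightarrow> fls_nth (fps_to_fls F) i = 0" using F0 by (auto simp: nat_less_iff)
  from growth_at_cusp[OF has_laurent_expansion_fps[OF F] this] obtain C' Y where
    C': "\<And>\<tau>. Im \<tau> > Y \<Longrightarrow> norm (G0 \<tau>) \<le> C' * exp (- (2 * pi * real n * Im \<tau>))"
    unfolding G0_def e_def d_def qq_of_nat_mult by blast
  have bound: "norm (N \<tau>) \<le> (C' * C ^ p) * exp (- (2 * pi * real n * Im \<tau>))" if "Im \<tau> > max 1 Y" for \<tau>
  proof -
    have "norm (N \<tau>) = norm (G0 \<tau>) * (\<Prod>j<p. norm (G j \<tau>))"
      by (simp add: N_def norm_mult prod_norm)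
    also have "\<dots> \<le> (C' * exp (- (2 * pi * real n * Im \<tau>))) * (\<Prod>j<p. C)"
      using that by (intro mult_mono prod_mono conjI C' GC prod_nonneg order_trans[OF norm_ge_zero C']) auto
    finally show ?thesis by (simp add: mult_ac)
  qed
  have N0: "N \<tau> = 0" if "Im \<tau> > 0" for \<tau>
  proof (rule modular_function_eq_0[where k = "int ((p + 1) * w)" and n = n and Y = "max 1 Y", OF hN NT NS bound _ n(2) that])
    have "int (2 * (p + 1) * w) \<le> int (21 * n)" using n(1) by (simp only: of_nat_le_iff)
    thus "2 * int ((p + 1) * w) \<le> 21 * int n" by (simp add: algebra_simps)
  qed auto
  have opn: "open ?H" "connected ?H"
    by (auto intro: open_halfspace_Im_gt convex_connected convex_halfspace_Im_gt)
  \<comment> \<open>A vanishing product has an identically vanishing factor. Translations connect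
    the \<open>G j\<close> with \<open>G 0\<close>, and S connects \<open>G 0\<close> with
    \<open>G0\<close>, so both of these vanish.\<close>
  have "(\<forall>\<tau>\<in>?H. G0 \<tau> = 0) \<or> (\<exists>j<m. \<forall>\<tau>\<in>?H. G j \<tau> = 0)"
    if "\<And>\<tau>. \<tau> \<in> ?H \<Longrightarrow> G0 \<tau> * (\<Prod>j<m. G j \<tau>) = 0" for m
    using that
  proof (induction m)
    case (Suc m)
    have "(\<forall>\<tau>\<in>?H. G0 \<tau> * (\<Prod>j<m. G j \<tau>) = 0) \<or> (\<forall>\<tau>\<in>?H. G m \<tau> = 0)"
      by (rule holomorphic_mult_eq_0) (use opn Suc.prems in \<open>auto intro!: holomorphic_intros hG0 hG simp: mult_ac\<close>)
    thus ?case using Suc.IH less_SucI by blast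
  qed auto
  from this[of p] have "(\<forall>\<tau>\<in>?H. G0 \<tau> = 0) \<or> (\<exists>j<p. \<forall>\<tau>\<in>?H. G j \<tau> = 0)"
    using N0 by (simp add: N_def)
  moreover have "\<forall>\<tau>\<in>?H. G 0 \<tau> = 0" if "\<forall>\<tau>\<in>?H. G j \<tau> = 0" for j
  proof
    fix \<tau> assume "\<tau> \<in> ?H"
    have shift: "G 0 (\<sigma> + of_nat i) = G i \<sigma>" for i \<sigma>
    proof (induction i arbitrary: \<sigma>)
      case (Suc i)
      have "G 0 (\<sigma> + of_nat (Suc i)) = G 0 ((\<sigma> + 1) + of_nat i)" by (simp add: add_ac)
      also have "\<dots> = G (Suc i) \<sigma>" by (simp only: Suc T1)
      finally show ?case .
    qed simp
    from shift[of "\<tau> - of_nat j" j] that \<open>\<tau> \<in> ?H\<close> show "G 0 \<tau> = 0" by simp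
  qed
  moreover have "\<forall>\<tau>\<in>?H. G0 \<tau> = 0" if *: "\<forall>\<tau>\<in>?H. G 0 \<tau> = 0"
  proof
    fix \<tau> assume "\<tau> \<in> ?H"
    hence "Im \<tau> > 0" by simp
    from S1[OF this] * minus_inverse_upper[OF this] have "\<tau> ^ w * G0 \<tau> = 0" by simp
    thus "G0 \<tau> = 0" using \<open>\<tau> \<in> ?H\<close> by auto
  qed
  moreover have "\<forall>\<tau>\<in>?H. G 0 \<tau> = 0" if *: "\<forall>\<tau>\<in>?H. G0 \<tau> = 0"
  proof
    fix \<tau> assume "\<tau> \<in> ?H"
    hence "Im \<tau> > 0" by simp
    from S0[OF this] * minus_inverse_upper[OF this] have "\<tau> ^ w * G 0 \<tau> = 0" by simp
    thus "G 0 \<tau> = 0" using \<open>\<tau> \<in> ?H\<close> by auto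
  qed
  ultimately have "\<forall>\<tau>\<in>?H. G0 \<tau> = 0" "\<forall>\<tau>\<in>?H. G 0 \<tau> = 0" by blast+
  with \<tau> show "P (eval_fps E4 (qq \<tau>)) (eval_fps E4 (qq (of_nat p * \<tau>))) (eval_fps Delta (qq \<tau>)) = 0"
    "P (eval_fps E4 (qq \<tau>)) (eval_fps E4 (qq (\<tau> / of_nat p)) / of_nat p ^ 4) (eval_fps Delta (qq \<tau>)) = 0"
    by (auto simp: G0_def G_def x_def e_def d_def)
qed

section \<open>Evaluation of initial coefficients with integer lists\<close>

definition fps_starts :: "complex fps \<Rightarrow> int list \<Rightarrow> bool" where
  "fps_starts f xs \<longleftrightarrow> (\<forall>i<length xs. fps_nth f i = of_int (xs ! i))"

definition list_conv :: "int list \<Rightarrow> int list \<Rightarrow> int list" where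
  "list_conv xs ys = map (\<lambda>i. \<Sum>j\<leftarrow>[0..<Suc i]. xs ! j * ys ! (i - j)) [0..<min (length xs) (length ys)]"

lemma fps_starts_mult:
  assumes "fps_starts f xs" "fps_starts g ys"
  shows "fps_starts (f * g) (list_conv xs ys)"
  unfolding fps_starts_def
proof (intro allI impI)
  fix i assume "i < length (list_conv xs ys)"
  hence i: "i < length xs" "i < length ys" by (simp_all add: list_conv_def)
  have "fps_nth (f * g) i = (\<Sum>j=0..i. of_int (xs ! j) * of_int (ys ! (i - j)))"
    unfolding fps_mult_nth using assms i by (intro sum.cong) (auto simp: fps_starts_def)
  also have "\<dots> = of_int (\<Sum>j\<in>{0..<Suc i}. xs ! j * ys ! (i - j))"
    by (simp add: atLeastLessThanSuc_atLeastAtMost)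
  also have "(\<Sum>j\<in>{0..<Suc i}. xs ! j * ys ! (i - j)) = list_conv xs ys ! i"
    using i unfolding list_conv_def
    by (subst nth_map) (simp_all only: length_upt nth_upt interv_sum_list_conv_sum_set_nat set_upt, simp_all)
  finally show "fps_nth (f * g) i = of_int (list_conv xs ys ! i)" .
qed

lemma fps_starts_add:
  "fps_starts f xs \<Longrightarrow> fps_starts g ys \<Longrightarrow> fps_starts (f + g) (map2 (+) xs ys)"
  by (simp add: fps_starts_def)

lemma fps_starts_diff:
  "fps_starts f xs \<Longrightarrow> fps_starts g ys \<Longrightarrow> fps_starts (f - g) (map2 (-) xs ys)"
  by (simp add: fps_starts_def)

lemma fps_starts_numeral_mult_iff:
  "fps_starts (numeral c * f) (map ((*) (numeral c)) xs) \<longleftrightarrow> fps_starts f xs"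
  by (simp add: fps_starts_def numeral_fps_const)

lemmas fps_starts_numeral_mult = fps_starts_numeral_mult_iff [THEN iffD2]

lemma fps_starts_compose:
  assumes "fps_starts f xs" "p > 0"
  shows "fps_starts (f oo fps_X ^ p) (map (\<lambda>i. if p dvd i then xs ! (i div p) else 0) [0..<length xs])"
  using assms by (auto simp: fps_starts_def fps_nth_compose_X_power intro: le_less_trans[OF div_le_dividend])

lemma fps_starts_cong: "fps_starts f xs \<Longrightarrow> xs = ys \<Longrightarrow> fps_starts f ys"
  by simp

text \<open>Seven terms are what the Sturm bound demands for the level 3 relation of weight 16, as 2
  (3 + 1) 16 = 128 lies between 126 and 147, the sixfold and sevenfold of 21.\<close>

lemma divisor_sums:
  "map (divisor_sum 3) [0..<7] = [0, 1, 9, 28, 73, 126, 252]"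
  "map (divisor_sum 5) [0..<7] = [0, 1, 33, 244, 1057, 3126, 8052]"
proof -
  have eq: "map (divisor_sum k) [0..<7] =
    map (\<lambda>n. if n = 0 then 0 else 1 + (\<Sum>d\<leftarrow>[2..<n + 1]. if d dvd n then d ^ k else 0)) [0..<7]" for k
    by (rule map_cong) (auto simp: divisor_sum_eval)
  show "map (divisor_sum 3) [0..<7] = [0, 1, 9, 28, 73, 126, 252]"
    "map (divisor_sum 5) [0..<7] = [0, 1, 33, 244, 1057, 3126, 8052]"
    unfolding eq by code_simp+
qed

lemma fps_starts_sigma_fps: "fps_starts (sigma_fps k) (map int (map (divisor_sum k) [0..<n]))"
  by (simp add: fps_starts_def sigma_fps_def)

lemma fps_starts_1: "fps_starts 1 [1, 0, 0, 0, 0, 0, 0]"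
  by (auto simp: fps_starts_def nth_Cons split: nat.splits)

lemma fps_starts_E4: "fps_starts E4 [1, 240, 2160, 6720, 17520, 30240, 60480]"
proof -
  have "fps_starts (sigma_fps 3) [0, 1, 9, 28, 73, 126, 252]"
    using fps_starts_sigma_fps[of 3 7] unfolding divisor_sums by simp
  thus ?thesis unfolding E4_def
    by (rule fps_starts_cong[OF fps_starts_add[OF fps_starts_1 fps_starts_numeral_mult]]) simp
qed

lemma fps_starts_E6: "fps_starts E6 [1, -504, -16632, -122976, -532728, -1575504, -4058208]"
proof -
  have "fps_starts (sigma_fps 5) [0, 1, 33, 244, 1057, 3126, 8052]"
    using fps_starts_sigma_fps[of 5 7] unfolding divisor_sums by simp
  thus ?thesis unfolding E6_def
    by (rule fps_starts_cong[OF fps_starts_diff[OF fps_starts_1 fps_starts_numeral_mult]]) simp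
qed

lemma fps_starts_Delta: "fps_starts Delta [0, 1, -24, 252, -1472, 4830, -6048]"
proof -
  have eq: "1728 * Delta = E4 * (E4 * E4) - E6 * E6"
    by (simp add: Delta_mult_1728 power2_eq_square power3_eq_cube mult.assoc)
  have "fps_starts (1728 * Delta) (map ((*) 1728) [0, 1, -24, 252, -1472, 4830, -6048])"
    unfolding eq
    by (rule fps_starts_cong[OF fps_starts_diff[OF fps_starts_mult[OF fps_starts_E4
            fps_starts_mult[OF fps_starts_E4 fps_starts_E4]] fps_starts_mult[OF fps_starts_E6 fps_starts_E6]]])
       code_simp
  thus ?thesis by (simp only: fps_starts_numeral_mult_iff)
qed

lemma eval_fps_expansions:
  "eval_fps E4 has_fps_expansion E4" "eval_fps Delta has_fps_expansion Delta"
  "p > 0 \<Longrightarrow> (\<lambda>q. eval_fps E4 (q ^ p)) has_fps_expansion (E4 oo fps_X ^ p)"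
  "p > 0 \<Longrightarrow> (\<lambda>q. eval_fps Delta (q ^ p)) has_fps_expansion (Delta oo fps_X ^ p)"
proof -
  show *: "eval_fps E4 has_fps_expansion E4" "eval_fps Delta has_fps_expansion Delta"
    by (intro eval_fps_has_fps_expansion less_le_trans[OF _ conv_radius_E4] less_le_trans[OF _ conv_radius_Delta]; simp)+
  assume "p > 0"
  hence X: "(\<lambda>q::complex. q ^ p) has_fps_expansion fps_X ^ p" "fps_nth (fps_X ^ p :: complex fps) 0 = 0"
    by (auto intro: fps_expansion_intros)
  show "(\<lambda>q. eval_fps E4 (q ^ p)) has_fps_expansion (E4 oo fps_X ^ p)"
    "(\<lambda>q. eval_fps Delta (q ^ p)) has_fps_expansion (Delta oo fps_X ^ p)"
    using has_fps_expansion_compose[OF *(1) X] has_fps_expansion_compose[OF *(2) X] by (simp_all add: o_def)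
qed

lemma fps_eq_0_if_zero_on_disc:
  assumes "\<phi> has_fps_expansion F" "\<And>\<tau>. Im \<tau> > 0 \<Longrightarrow> \<phi> (qq \<tau>) = 0"
  shows "F = 0"
proof -
  have "eventually (\<lambda>q. q \<in> ball 0 1 - {0}) (at (0 :: complex))"
    by (intro eventually_at_in_open) auto
  hence "eventually (\<lambda>q. \<phi> q = 0) (at 0)"
  proof eventually_elim
    case (elim q)
    hence "q \<in> punctured_disc" by (simp add: punctured_disc_def)
    then obtain \<tau> where "Im \<tau> > 0" "qq \<tau> = q" by (rule punctured_disc_qq)
    thus ?case using assms(2) by auto
  qed
  hence "(\<lambda>_. 0) has_laurent_expansion fps_to_fls F"
    using has_laurent_expansion_fps[OF assms(1)] by (subst (asm) has_laurent_expansion_cong) auto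
  hence "fps_to_fls F = 0" by (rule zero_has_laurent_expansion_imp_eq_0)
  thus ?thesis by simp
qed

text \<open>With u = (E4 - E)/240 and w = (16 E - E4)/15 the relations read Delta = u w^2 and
  Delta(q^2) = u^2 w, where 54000 is 240 times 15^2 and 864000 is 15 times 240^2. Classically u and
  w are the eta quotients eta(2 \<tau>)^16/eta(\<tau>)^8 and eta(\<tau>)^16/eta(2 \<tau>)^8.\<close>

lemma level_2_Delta:
  defines "E \<equiv> E4 oo fps_X ^ 2"
  shows "(16 * E - E4)\<^sup>2 * (E4 - E) = 54000 * Delta"
    and "(E4 - E)\<^sup>2 * (16 * E - E4) = 864000 * (Delta oo fps_X ^ 2)"
proof -
  define P where "P = (\<lambda>a b t :: complex. (16 * b - a)\<^sup>2 * (a - b) - 54000 * t)"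
  define F where "F = (16 * E - E4)\<^sup>2 * (E4 - E) - 54000 * Delta"
  have ex: "(\<lambda>q. P (eval_fps E4 q) (eval_fps E4 (q ^ 2)) (eval_fps Delta q)) has_fps_expansion F"
    unfolding P_def F_def E_def by (intro fps_expansion_intros eval_fps_expansions) simp_all
  have hom: "P (s ^ 4 * a) (s ^ 4 * b) (s ^ 12 * t) = s ^ 12 * P a b t" for s a b t
  proof -
    have "s ^ 12 = s ^ 4 * (s ^ 4 * s ^ 4)" by (simp flip: power_add)
    thus ?thesis by (simp add: P_def algebra_simps power2_eq_square)
  qed
  have holo: "(\<lambda>z. P (f z) (g z) (h z)) holomorphic_on S"
    if "f holomorphic_on S" "g holomorphic_on S" "h holomorphic_on S" for f g h S
    unfolding P_def by (intro holomorphic_intros that)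
  have cont: "continuous_on UNIV (\<lambda>(a, b, t). P a b t)"
    unfolding P_def case_prod_beta by (intro continuous_intros)
  have "fps_starts E [1, 0, 240, 0, 2160, 0, 6720]"
    unfolding E_def by (rule fps_starts_cong[OF fps_starts_compose[OF fps_starts_E4]]) (simp, code_simp)
  note st = fps_starts_diff[OF fps_starts_numeral_mult[OF this, of "num.Bit0 (num.Bit0 (num.Bit0 (num.Bit0 num.One)))"] fps_starts_E4]
    fps_starts_diff[OF fps_starts_E4 this]
  have "fps_starts F [0, 0, 0, 0, 0, 0, 0]"
    unfolding F_def power2_eq_square
    by (rule fps_starts_cong[OF fps_starts_diff[OF fps_starts_mult[OF fps_starts_mult[OF st(1) st(1)] st(2)]
           fps_starts_numeral_mult[OF fps_starts_Delta]]]) code_simp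
  hence F0: "fps_nth F i = 0" if "i < 4" for i
    using that by (auto simp: fps_starts_def nth_Cons split: nat.splits)
  have id: "P (eval_fps E4 (qq \<tau>)) (eval_fps E4 (qq (of_nat 2 * \<tau>))) (eval_fps Delta (qq \<tau>)) = 0"
    "P (eval_fps E4 (qq \<tau>)) (eval_fps E4 (qq (\<tau> / of_nat 2)) / of_nat 2 ^ 4) (eval_fps Delta (qq \<tau>)) = 0"
    if "Im \<tau> > 0" for \<tau>
    by (rule level_p_identity[where w = 12 and n = 4, OF _ hom holo cont ex F0 _ _ that]; simp)+
  have "F = 0"
    by (rule fps_eq_0_if_zero_on_disc[OF ex]) (use id(1) qq_of_nat_mult[of 2] in auto)
  thus "(16 * E - E4)\<^sup>2 * (E4 - E) = 54000 * Delta" by (simp add: F_def)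
  \<comment> \<open>The second conclusion of \<open>level_p_identity\<close>, taken at 2 \<tau>: it
    concerns \<open>P\<close> at (E_4(2 \<tau>), E_4(\<tau>)/16, Delta(2 \<tau>)).\<close>
  define F' where "F' = (16 * (fps_const (1 / 16) * E4) - E)\<^sup>2 * (E - fps_const (1 / 16) * E4) - 54000 * (Delta oo fps_X ^ 2)"
  have ex': "(\<lambda>q. P (eval_fps E4 (q ^ 2)) (1 / 16 * eval_fps E4 q) (eval_fps Delta (q ^ 2))) has_fps_expansion F'"
    unfolding P_def F'_def E_def by (intro fps_expansion_intros eval_fps_expansions) simp_all
  have "F' = 0"
  proof (rule fps_eq_0_if_zero_on_disc[OF ex'])
    fix \<tau> :: complex assume "Im \<tau> > 0"
    thus "P (eval_fps E4 (qq \<tau> ^ 2)) (1 / 16 * eval_fps E4 (qq \<tau>)) (eval_fps Delta (qq \<tau> ^ 2)) = 0"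
      using id(2)[of "2 * \<tau>"] qq_of_nat_mult[of 2 \<tau>] by simp
  qed
  hence "(E4 - E)\<^sup>2 * (E - fps_const (1 / 16) * E4) = 54000 * (Delta oo fps_X ^ 2)"
    by (simp add: F'_def numeral_fps_const flip: mult.assoc)
  hence "16 * ((E4 - E)\<^sup>2 * (E - fps_const (1 / 16) * E4)) = 16 * (54000 * (Delta oo fps_X ^ 2))" by simp
  moreover have "16 * (fps_const (1 / 16) * E4) = E4" by (simp add: numeral_fps_const flip: mult.assoc)
  ultimately show "(E4 - E)\<^sup>2 * (16 * E - E4) = 864000 * (Delta oo fps_X ^ 2)"
    by (simp add: algebra_simps)
qed

text \<open>
  In terms of \<open>u\<close> and \<open>w\<close> the function \<open>w/u\<close> is a Hauptmodul of \<open>\<Gamma>\<^sub>0(2)\<close>; the formula for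
  \<open>\<Delta>(2\<tau>)\<close> arises from the one for \<open>\<Delta>(\<tau>)\<close> by the Fricke involution.
\<close>
lemma level_2_parametrization:
  fixes A u w :: "complex fps"
  defines "A \<equiv> sigma_fps 3 oo fps_X ^ 2"
  defines "u \<equiv> sigma_fps 3 - A" and "w \<equiv> 1 - 16 * sigma_fps 3 + 256 * A"
  shows "E4 = w + 256 * u" "E4 oo fps_X ^ 2 = w + 16 * u" "Delta = u * w\<^sup>2" "Delta oo fps_X ^ 2 = u\<^sup>2 * w"
proof -
  show 1: "E4 = w + 256 * u" by (simp add: u_def w_def E4_def algebra_simps)
  have "E4 oo fps_X ^ 2 = 1 + 240 * A"
    by (simp add: E4_def A_def fps_compose_add_distrib fps_compose_mult_distrib numeral_fps_const)
  thus 2: "E4 oo fps_X ^ 2 = w + 16 * u" by (simp add: u_def w_def algebra_simps)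
  have "54000 * Delta = 54000 * (u * w\<^sup>2)"
    unfolding level_2_Delta(1)[symmetric] 2 unfolding 1 by (simp add: algebra_simps power2_eq_square)
  thus "Delta = u * w\<^sup>2" by simp
  have "864000 * (Delta oo fps_X ^ 2) = 864000 * (u\<^sup>2 * w)"
    unfolding level_2_Delta(2)[symmetric] 2 unfolding 1 by (simp add: algebra_simps power2_eq_square)
  thus "Delta oo fps_X ^ 2 = u\<^sup>2 * w" by simp
qed

text \<open>With u = (E4 - E)/240 and w = (81 E - E4)/80 one has E4 + 9 E = 10 (w + 27 u), and the
  relations read Delta (w + 27 u) = u w^3 and Delta(q^3) (w + 27 u) = u^3 w. The weight is 16
  because Delta is not a polynomial in u and w here, only a quotient with denominator w + 27
  u.\<close>

lemma level_3_Delta: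
  defines "E \<equiv> E4 oo fps_X ^ 3"
  shows "122880000 * (Delta * (E4 + 9 * E)) = 10 * (E4 - E) * (81 * E - E4) ^ 3"
    and "9953280000 * ((Delta oo fps_X ^ 3) * (E4 + 9 * E)) = 90 * (81 * E - E4) * (E4 - E) ^ 3"
proof -
  define P where "P = (\<lambda>a b t :: complex. 122880000 * (t * (a + 9 * b)) - 10 * ((a - b) * ((81 * b - a) * ((81 * b - a) * (81 * b - a)))))"
  define F where "F = 122880000 * (Delta * (E4 + 9 * E)) - 10 * ((E4 - E) * ((81 * E - E4) * ((81 * E - E4) * (81 * E - E4))))"
  have ex: "(\<lambda>q. P (eval_fps E4 q) (eval_fps E4 (q ^ 3)) (eval_fps Delta q)) has_fps_expansion F"
    unfolding P_def F_def E_def by (intro fps_expansion_intros eval_fps_expansions) simp_all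
  have hom: "P (s ^ 4 * a) (s ^ 4 * b) (s ^ 12 * t) = s ^ 16 * P a b t" for s a b t
  proof -
    have "s ^ 12 = s ^ 4 * (s ^ 4 * s ^ 4)" "s ^ 16 = s ^ 4 * (s ^ 4 * (s ^ 4 * s ^ 4))"
      by (simp_all flip: power_add)
    thus ?thesis by (simp add: P_def algebra_simps)
  qed
  have holo: "(\<lambda>z. P (f z) (g z) (h z)) holomorphic_on S"
    if "f holomorphic_on S" "g holomorphic_on S" "h holomorphic_on S" for f g h S
    unfolding P_def by (intro holomorphic_intros that)
  have cont: "continuous_on UNIV (\<lambda>(a, b, t). P a b t)"
    unfolding P_def case_prod_beta by (intro continuous_intros)
  have E: "fps_starts E [1, 0, 0, 240, 0, 0, 2160]"
    unfolding E_def by (rule fps_starts_cong[OF fps_starts_compose[OF fps_starts_E4]]) (simp, code_simp)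
  have 1: "fps_starts (E4 + 9 * E) [10, 240, 2160, 8880, 17520, 30240, 79920]"
    by (rule fps_starts_cong[OF fps_starts_add[OF fps_starts_E4 fps_starts_numeral_mult[OF E]]]) code_simp
  have 2: "fps_starts (E4 - E) [0, 240, 2160, 6480, 17520, 30240, 58320]"
    by (rule fps_starts_cong[OF fps_starts_diff[OF fps_starts_E4 E]]) code_simp
  have 3: "fps_starts (81 * E - E4) [80, - 240, - 2160, 12720, - 17520, - 30240, 114480]"
    by (rule fps_starts_cong[OF fps_starts_diff[OF fps_starts_numeral_mult[OF E] fps_starts_E4]]) code_simp
  have "fps_starts F [0, 0, 0, 0, 0, 0, 0]"
    unfolding F_def
    by (rule fps_starts_cong[OF fps_starts_diff[OF
          fps_starts_numeral_mult[OF fps_starts_mult[OF fps_starts_Delta 1]]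
          fps_starts_numeral_mult[OF fps_starts_mult[OF 2 fps_starts_mult[OF 3 fps_starts_mult[OF 3 3]]]]]]) code_simp
  hence F0: "fps_nth F i = 0" if "i < 7" for i
    using that by (auto simp: fps_starts_def nth_Cons split: nat.splits)
  have id: "P (eval_fps E4 (qq \<tau>)) (eval_fps E4 (qq (of_nat 3 * \<tau>))) (eval_fps Delta (qq \<tau>)) = 0"
    "P (eval_fps E4 (qq \<tau>)) (eval_fps E4 (qq (\<tau> / of_nat 3)) / of_nat 3 ^ 4) (eval_fps Delta (qq \<tau>)) = 0"
    if "Im \<tau> > 0" for \<tau>
    by (rule level_p_identity[where w = 16 and n = 7, OF _ hom holo cont ex F0 _ _ that]; simp)+
  have "F = 0"
    by (rule fps_eq_0_if_zero_on_disc[OF ex]) (use id(1) qq_of_nat_mult[of 3] in auto)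
  thus "122880000 * (Delta * (E4 + 9 * E)) = 10 * (E4 - E) * (81 * E - E4) ^ 3"
    by (simp add: F_def power3_eq_cube mult.assoc)
  define e where "e = fps_const (1 / 81) * E4"
  have e: "E4 = 81 * e" by (simp add: e_def numeral_fps_const flip: mult.assoc)
  define F' where "F' = 122880000 * ((Delta oo fps_X ^ 3) * (E + 9 * e)) -
     10 * ((E - e) * ((81 * e - E) * ((81 * e - E) * (81 * e - E))))"
  have ex': "(\<lambda>q. P (eval_fps E4 (q ^ 3)) (1 / 81 * eval_fps E4 q) (eval_fps Delta (q ^ 3))) has_fps_expansion F'"
    unfolding P_def F'_def E_def e_def by (intro fps_expansion_intros eval_fps_expansions) simp_all
  have "F' = 0"
  proof (rule fps_eq_0_if_zero_on_disc[OF ex'])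
    fix \<tau> :: complex assume "Im \<tau> > 0"
    thus "P (eval_fps E4 (qq \<tau> ^ 3)) (1 / 81 * eval_fps E4 (qq \<tau>)) (eval_fps Delta (qq \<tau> ^ 3)) = 0"
      using id(2)[of "3 * \<tau>"] qq_of_nat_mult[of 3 \<tau>] by simp
  qed
  hence eq: "122880000 * ((Delta oo fps_X ^ 3) * (E + 9 * e)) = 10 * ((E - e) * (81 * e - E) ^ 3)"
    by (simp add: F'_def power3_eq_cube)
  have "9953280000 * ((Delta oo fps_X ^ 3) * (E4 + 9 * E)) = 729 * (122880000 * ((Delta oo fps_X ^ 3) * (E + 9 * e)))"
    unfolding e by (simp add: algebra_simps)
  also have "\<dots> = 729 * (10 * ((E - e) * (81 * e - E) ^ 3))" unfolding eq ..
  also have "\<dots> = 90 * (81 * E - E4) * (E4 - E) ^ 3"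
    unfolding e by (simp add: algebra_simps power3_eq_cube)
  finally show "9953280000 * ((Delta oo fps_X ^ 3) * (E4 + 9 * E)) = 90 * (81 * E - E4) * (E4 - E) ^ 3" .
qed

text \<open>Dividing the last two relations gives Delta(\<tau>)/Delta(3 \<tau>) = (w/u)^2, so w/u is
  the Hauptmodul (eta(\<tau>)/eta(3 \<tau>))^12 of level 3.\<close>

lemma level_3_parametrization:
  fixes A u w :: "complex fps"
  defines "A \<equiv> sigma_fps 3 oo fps_X ^ 3"
  defines "u \<equiv> sigma_fps 3 - A" and "w \<equiv> 1 - 3 * sigma_fps 3 + 243 * A"
  shows "E4 = w + 243 * u" "E4 oo fps_X ^ 3 = w + 3 * u"
    "Delta * (w + 27 * u) = u * w ^ 3" "(Delta oo fps_X ^ 3) * (w + 27 * u) = u ^ 3 * w"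
proof -
  show 1: "E4 = w + 243 * u" by (simp add: u_def w_def E4_def algebra_simps)
  have "E4 oo fps_X ^ 3 = 1 + 240 * A"
    by (simp add: E4_def A_def fps_compose_add_distrib fps_compose_mult_distrib numeral_fps_const)
  thus 2: "E4 oo fps_X ^ 3 = w + 3 * u" by (simp add: u_def w_def algebra_simps)
  have "1228800000 * (Delta * (w + 27 * u)) = 122880000 * (Delta * (E4 + 9 * (E4 oo fps_X ^ 3)))"
    unfolding 2 unfolding 1 by (simp add: algebra_simps)
  also have "\<dots> = 1228800000 * (u * w ^ 3)"
    unfolding level_3_Delta(1) unfolding 2 unfolding 1 by (simp add: algebra_simps power3_eq_cube)
  finally show "Delta * (w + 27 * u) = u * w ^ 3" by simp
  have "99532800000 * ((Delta oo fps_X ^ 3) * (w + 27 * u)) = 9953280000 * ((Delta oo fps_X ^ 3) * (E4 + 9 * (E4 oo fps_X ^ 3)))"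
    unfolding 2 unfolding 1 by (simp add: algebra_simps)
  also have "\<dots> = 99532800000 * (u ^ 3 * w)"
    unfolding level_3_Delta(2) unfolding 2 unfolding 1 by (simp add: algebra_simps power3_eq_cube)
  finally show "(Delta oo fps_X ^ 3) * (w + 27 * u) = u ^ 3 * w" by simp
qed

section \<open>Integral series and the ring \<open>\<int>[j]\<close>\<close>

definition int_coeffs :: "complex fls \<Rightarrow> bool" where
  "int_coeffs F \<longleftrightarrow> (\<forall>n. fls_nth F n \<in> \<int>)"

lemma int_coeffs_nth: "int_coeffs F \<Longrightarrow> fls_nth F n \<in> \<int>"
  by (simp add: int_coeffs_def)

lemma int_coeffs_of_int [simp, intro]: "int_coeffs (of_int c)"
  by (auto simp: int_coeffs_def fls_of_int)

lemma nth_of_int_mult: "fls_nth (of_int c * F) i = of_int c * fls_nth (F :: complex fls) i"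
  by (simp add: fls_of_int)

lemma int_coeffs_0 [simp, intro]: "int_coeffs 0" and int_coeffs_1 [simp, intro]: "int_coeffs 1"
  and int_coeffs_numeral [simp, intro]: "int_coeffs (numeral k)"
  using int_coeffs_of_int[of 0] int_coeffs_of_int[of 1] int_coeffs_of_int[of "numeral k"] by simp_all

lemma int_coeffs_add [intro]: "int_coeffs F \<Longrightarrow> int_coeffs G \<Longrightarrow> int_coeffs (F + G)"
  and int_coeffs_diff [intro]: "int_coeffs F \<Longrightarrow> int_coeffs G \<Longrightarrow> int_coeffs (F - G)"
  and int_coeffs_uminus [intro]: "int_coeffs F \<Longrightarrow> int_coeffs (- F)"
  by (auto simp: int_coeffs_def)

lemma int_coeffs_mult [intro]: "int_coeffs F \<Longrightarrow> int_coeffs G \<Longrightarrow> int_coeffs (F * G)"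
  unfolding int_coeffs_def by (subst fls_times_nth(1)) (auto intro!: Ints_sum Ints_mult)

lemma int_coeffs_power [intro]: "int_coeffs F \<Longrightarrow> int_coeffs (F ^ n)"
  by (induction n) auto

lemma int_coeffs_fps_to_fls: "int_coeffs (fps_to_fls f) \<longleftrightarrow> (\<forall>n. fps_nth f n \<in> \<int>)"
proof
  assume "int_coeffs (fps_to_fls f)"
  thus "\<forall>n. fps_nth f n \<in> \<int>" using int_coeffs_nth[of "fps_to_fls f" "int n" for n] by auto
qed (auto simp: int_coeffs_def)

lemma int_coeffs_X_inv [simp, intro]: "int_coeffs fls_X_inv"
  by (auto simp: int_coeffs_def)

lemma int_coeffs_compose_power [intro]: "int_coeffs F \<Longrightarrow> int_coeffs (fls_compose_power F p)"
  by (cases "p = 0") (auto simp: int_coeffs_def fls_nth_compose_power)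

lemma int_coeffs_inverse_fps:
  assumes "int_coeffs (fps_to_fls f)" "fps_nth f 0 = 1"
  shows "int_coeffs (fps_to_fls (inverse f))"
proof -
  have f: "fps_nth f i \<in> \<int>" for i using assms(1) by (simp add: int_coeffs_fps_to_fls)
  have 1: "f * inverse f = 1" using assms(2) by (intro inverse_mult_eq_1') simp
  have "fps_nth (inverse f) n \<in> \<int>" for n
  proof (induction n rule: less_induct)
    case (less n)
    have "(\<Sum>i=0..n. fps_nth f i * fps_nth (inverse f) (n - i)) = fps_nth 1 n"
      by (simp only: 1 flip: fps_mult_nth)
    hence "fps_nth (inverse f) n + (\<Sum>i=1..n. fps_nth f i * fps_nth (inverse f) (n - i)) = fps_nth 1 n"
      using assms(2) by (simp add: sum.atLeast_Suc_atMost)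
    hence "fps_nth (inverse f) n = fps_nth 1 n - (\<Sum>i=1..n. fps_nth f i * fps_nth (inverse f) (n - i))"
      by (simp add: algebra_simps)
    also have "\<dots> \<in> \<int>"
      using less f by (intro Ints_diff Ints_sum Ints_mult) auto
    finally show ?case .
  qed
  thus ?thesis by (simp add: int_coeffs_fps_to_fls)
qed

lemma inverse_fps_to_fls:
  assumes "fps_nth f 0 = (1 :: complex)"
  shows "inverse (fps_to_fls f) = fps_to_fls (inverse f)"
proof -
  have "f * inverse f = 1" using assms by (intro inverse_mult_eq_1') simp
  hence "fps_to_fls f * fps_to_fls (inverse f) = 1" by (simp flip: fls_times_fps_to_fls)
  thus ?thesis by (rule inverse_unique)
qed

section \<open>Congruences between Laurent series\<close>

definition cong_fls :: "int \<Rightarrow> complex fls \<Rightarrow> complex fls \<Rightarrow> bool" where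
  "cong_fls N F G \<longleftrightarrow> (\<exists>H. int_coeffs H \<and> F - G = of_int N * H)"

lemma cong_flsI: "int_coeffs H \<Longrightarrow> F - G = of_int N * H \<Longrightarrow> cong_fls N F G"
  by (auto simp: cong_fls_def)

lemma cong_fls_refl [simp, intro]: "cong_fls N F F"
  by (rule cong_flsI[of 0]) auto

lemma cong_fls_sym: "cong_fls N F G \<Longrightarrow> cong_fls N G F"
  unfolding cong_fls_def by (metis int_coeffs_uminus minus_diff_eq mult_minus_right)

lemma cong_fls_add:
  assumes "cong_fls N F F'" "cong_fls N G G'"
  shows "cong_fls N (F + G) (F' + G')"
proof -
  from assms obtain H H' where "int_coeffs H" "F - F' = of_int N * H" "int_coeffs H'" "G - G' = of_int N * H'"
    by (auto simp: cong_fls_def)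
  thus ?thesis by (intro cong_flsI[of "H + H'"]) (auto simp: algebra_simps)
qed

lemma cong_fls_trans [trans]:
  assumes "cong_fls N F G" "cong_fls N G H"
  shows "cong_fls N F H"
proof -
  from assms obtain K K' where "int_coeffs K" "F - G = of_int N * K" "int_coeffs K'" "G - H = of_int N * K'"
    by (auto simp: cong_fls_def)
  thus ?thesis by (intro cong_flsI[of "K + K'"]) (auto simp: algebra_simps)
qed

lemma cong_fls_mult_left:
  assumes "int_coeffs K" "cong_fls N F G"
  shows "cong_fls N (K * F) (K * G)"
proof -
  from assms obtain H where "int_coeffs H" "F - G = of_int N * H" by (auto simp: cong_fls_def)
  with assms show ?thesis
    by (intro cong_flsI[of "K * H"]) (auto simp: mult.left_commute simp flip: right_diff_distrib)
qed

lemma cong_fls_mult: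
  assumes "cong_fls N F F'" "cong_fls N G G'" "int_coeffs F'" "int_coeffs G"
  shows "cong_fls N (F * G) (F' * G')"
  using cong_fls_mult_left[OF assms(4,1)] cong_fls_mult_left[OF assms(3,2)]
  by (auto simp: mult.commute intro: cong_fls_trans)

lemma cong_fls_int_coeffs:
  assumes "cong_fls N F G" "int_coeffs G"
  shows "int_coeffs F"
proof -
  from assms obtain H where "int_coeffs H" "F - G = of_int N * H" by (auto simp: cong_fls_def)
  hence "F = of_int N * H + G" "int_coeffs (of_int N * H + G)" using assms by (auto simp: algebra_simps)
  thus ?thesis by simp
qed

lemma cong_fls_power:
  assumes "cong_fls N F G" "int_coeffs G"
  shows "cong_fls N (F ^ n) (G ^ n)"
  by (induction n) (use assms cong_fls_int_coeffs[OF assms] in \<open>auto intro!: cong_fls_mult\<close>)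

lemma cong_fls_cancel:
  assumes "cong_fls N (K * F) (K * G)" "int_coeffs (inverse K)" "K \<noteq> 0"
  shows "cong_fls N F G"
  using cong_fls_mult_left[OF assms(2,1)] assms(3) by (simp flip: mult.assoc)

lemma cong_fls_of_int_mult:
  assumes "N dvd c" "int_coeffs F"
  shows "cong_fls N (of_int c * F) 0"
proof -
  from assms obtain k where "c = N * k" by auto
  thus ?thesis using assms by (intro cong_flsI[of "of_int k * F"]) (auto simp: mult.assoc)
qed

lemma cong_fls_add_multiple: "N dvd c \<Longrightarrow> int_coeffs F \<Longrightarrow> cong_fls N (G + of_int c * F) G"
  using cong_fls_add[OF cong_fls_refl cong_fls_of_int_mult, of N c F G] by simp

lemma cong_fls_dvd: "cong_fls N F G \<Longrightarrow> M dvd N \<Longrightarrow> cong_fls M F G"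
  unfolding cong_fls_def by (elim dvdE exE conjE) (metis int_coeffs_mult int_coeffs_of_int mult.assoc of_int_mult)

lemma cong_fls_compose_power:
  assumes "cong_fls N F G" "p > 0"
  shows "cong_fls N (fls_compose_power F p) (fls_compose_power G p)"
proof -
  from assms obtain H where H: "int_coeffs H" "F - G = of_int N * H" by (auto simp: cong_fls_def)
  have "fls_compose_power F p - fls_compose_power G p = fls_compose_power (of_int N) p * fls_compose_power H p"
    using H(2) by (simp flip: fls_compose_power_diff fls_compose_power_mult)
  moreover have "fls_compose_power (of_int N) p = (of_int N :: complex fls)"
    using assms(2) by (simp add: fls_of_int)
  ultimately show ?thesis using H by (intro cong_flsI[of "fls_compose_power H p"]) auto
qed

lemma cong_fls_nth:
  assumes "cong_fls N F G" "fls_nth F n = of_int a" "fls_nth G n = of_int b"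
  shows "N dvd a - b"
proof -
  from assms obtain H where H: "int_coeffs H" "F - G = of_int N * H" by (auto simp: cong_fls_def)
  obtain h where h: "fls_nth H n = of_int h" using int_coeffs_nth[OF H(1)] by (auto elim: Ints_cases)
  have "fls_nth (F - G) n = of_int (N * h)"
    unfolding H(2) by (simp add: h fls_of_int)
  hence "(of_int (a - b) :: complex) = of_int (N * h)" using assms by simp
  hence "a - b = N * h" by (simp only: of_int_eq_iff)
  thus ?thesis by simp
qed

section \<open>Integrality of the Eisenstein series, Delta and j\<close>

lemma int_coeffs_E4: "int_coeffs (fps_to_fls E4)" and int_coeffs_E6: "int_coeffs (fps_to_fls E6)"
  by (auto simp: int_coeffs_fps_to_fls E4_def E6_def sigma_fps_def numeral_fps_const)

lemma dvd_12_aux: "12 dvd 5 * d ^ 3 + 7 * d ^ (5::nat)" for d :: nat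
proof -
  have "(5 * d ^ 3 + 7 * d ^ 5) mod 12 = (5 * (d mod 12) ^ 3 + 7 * (d mod 12) ^ 5) mod 12"
    by (intro mod_add_cong mod_mult_cong) (simp_all add: power_mod)
  moreover have "(5 * (d mod 12) ^ 3 + 7 * (d mod 12) ^ 5) mod 12 = 0"
  proof -
    have "[0..<12] = [0, 1, 2, 3, 4, 5, 6, 7, 8, 9, 10, 11]" by code_simp
    moreover have "d mod 12 \<in> set [0..<12]" by simp
    ultimately have "d mod 12 \<in> {0, 1, 2, 3, 4, 5, 6, 7, 8, 9, 10, 11}" by (simp only: list.set)
    thus ?thesis by (elim insertE) simp_all
  qed
  ultimately show ?thesis by (simp add: mod_eq_0_iff_dvd)
qed

text \<open>
  \<open>\<Delta> = (5 A + 7 B)/12 + 100 A\<^sup>2 - 147 B\<^sup>2 + 8000 A\<^sup>3\<close> for \<open>A = \<Sum> \<sigma>\<^sub>3(n) q\<^sup>n\<close>, \<open>B = \<Sum> \<sigma>\<^sub>5(n) q\<^sup>n\<close>, and \<open>12\<close>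
  divides \<open>5 d\<^sup>3 + 7 d\<^sup>5\<close>.
\<close>
lemma int_coeffs_Delta: "int_coeffs (fps_to_fls Delta)"
proof -
  define A B where "A = sigma_fps 3" and "B = sigma_fps 5"
  define C :: "complex fps" where "C = Abs_fps (\<lambda>n. of_nat ((5 * divisor_sum 3 n + 7 * divisor_sum 5 n) div 12))"
  have C: "12 * C = 5 * A + 7 * B"
  proof (rule fps_ext)
    fix n
    have "5 * divisor_sum 3 n + 7 * divisor_sum 5 n = (\<Sum>d | d dvd n. 5 * d ^ 3 + 7 * d ^ 5)"
      by (simp add: divisor_sum_def sum.distrib sum_distrib_left)
    also have "12 dvd \<dots>" by (intro dvd_sum dvd_12_aux)
    finally have "12 * ((5 * divisor_sum 3 n + 7 * divisor_sum 5 n) div 12) = 5 * divisor_sum 3 n + 7 * divisor_sum 5 n"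
      by simp
    hence "of_nat (12 * ((5 * divisor_sum 3 n + 7 * divisor_sum 5 n) div 12)) =
            (of_nat (5 * divisor_sum 3 n + 7 * divisor_sum 5 n) :: complex)" by (simp only:)
    thus "fps_nth (12 * C) n = fps_nth (5 * A + 7 * B) n"
      by (simp add: C_def A_def B_def sigma_fps_def numeral_fps_const)
  qed
  have "1728 * C = 144 * (12 * C)" by simp
  hence "1728 * C = 144 * (5 * A + 7 * B)" unfolding C .
  hence "1728 * (C + 100 * A\<^sup>2 - 147 * B\<^sup>2 + 8000 * A ^ 3) = 144 * (5 * A + 7 * B) + 172800 * A\<^sup>2 - 254016 * B\<^sup>2 + 13824000 * A ^ 3"
    by (simp add: algebra_simps)
  also have "\<dots> = 1728 * Delta"
    unfolding Delta_mult_1728 E4_def E6_def A_def B_def by (simp add: algebra_simps power2_eq_square power3_eq_cube)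
  finally have "C + 100 * A\<^sup>2 - 147 * B\<^sup>2 + 8000 * A ^ 3 = Delta"
    by (subst (asm) mult_left_cancel) simp_all
  note Delta = this [symmetric]
  have "int_coeffs (fps_to_fls A)" "int_coeffs (fps_to_fls B)" "int_coeffs (fps_to_fls C)"
    by (auto simp: int_coeffs_fps_to_fls A_def B_def C_def sigma_fps_def)
  thus ?thesis unfolding Delta fps_to_fls_plus fps_to_fls_minus fls_times_fps_to_fls fps_to_fls_power fps_to_fls_numeral
    by (intro int_coeffs_add int_coeffs_diff int_coeffs_mult int_coeffs_power int_coeffs_numeral)
qed

abbreviation "e4 \<equiv> fps_to_fls E4"
abbreviation "e6 \<equiv> fps_to_fls E6"
abbreviation "De \<equiv> fps_to_fls Delta"

definition jfls :: "complex fls" where "jfls = e4 ^ 3 / De"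

text \<open>Leading coefficient 1 and integral coefficients are what triangular elimination over the
  integers requires. Products inherit the property, with pole orders added.\<close>

definition leading :: "nat \<Rightarrow> complex fls \<Rightarrow> bool" where
  "leading e U \<longleftrightarrow> (\<exists>h. U = fls_X_inv ^ e * fps_to_fls h \<and> fps_nth h 0 = 1 \<and> int_coeffs (fps_to_fls h))"

lemma leading_int_coeffs: "leading e U \<Longrightarrow> int_coeffs U"
  by (auto simp: leading_def)

lemma leading_mult: "leading a U \<Longrightarrow> leading b W \<Longrightarrow> leading (a + b) (U * W)"
  unfolding leading_def
  by (elim exE conjE, rule_tac x = "h * ha" in exI) (auto simp: power_add fls_times_fps_to_fls)

lemma leading_1: "leading 0 1"
  unfolding leading_def by (rule exI[of _ 1]) auto

lemma leading_power: "leading a U \<Longrightarrow> leading (n * a) (U ^ n)"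
  by (induction n) (auto simp: leading_1 dest: leading_mult)

lemma leading_e4: "leading 0 e4" and leading_e6: "leading 0 e6"
  unfolding leading_def using int_coeffs_E4 int_coeffs_E6
  by (auto intro: exI[of _ E4] exI[of _ E6])

lemma leading_inverse:
  assumes f: "fps_nth f 0 = 0" "fps_nth f (Suc 0) = 1" "int_coeffs (fps_to_fls f)"
  shows "leading 1 (inverse (fps_to_fls f))"
proof -
  define h where "h = fps_shift 1 f"
  have D: "f = fps_X * h" by (rule fps_ext) (auto simp: h_def f)
  have h: "fps_nth h 0 = 1" "int_coeffs (fps_to_fls h)"
    using f by (simp_all add: h_def int_coeffs_fps_to_fls)
  have "inverse (fps_to_fls f) = fls_X_inv ^ 1 * fps_to_fls (inverse h)"
    unfolding D by (simp add: fls_times_fps_to_fls fls_inverse_X inverse_fps_to_fls[OF h(1)] mult.commute)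
  thus ?thesis unfolding leading_def using h int_coeffs_inverse_fps[OF h(2,1)]
    by (intro exI[of _ "inverse h"]) auto
qed

lemma leading_inverse_Delta: "leading 1 (inverse De)"
  by (intro leading_inverse int_coeffs_Delta) simp_all

lemma leading_jfls: "leading 1 jfls"
  using leading_mult[OF leading_power[OF leading_e4, of 3] leading_inverse_Delta]
  by (simp add: jfls_def divide_inverse)

lemma int_coeffs_inverse_e4: "int_coeffs (inverse e4)"
  using int_coeffs_inverse_fps[OF int_coeffs_E4 E4_nth_0] by (simp add: inverse_fps_to_fls)

lemma e4_nonzero [simp]: "E4 \<noteq> 0" and e6_nonzero [simp]: "E6 \<noteq> 0"
  using E4_nth_0 E6_nth_0 by force+

lemma int_coeffs_inverse_jfls: "int_coeffs (inverse jfls)"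
proof -
  have "inverse jfls = inverse e4 ^ 3 * De"
    by (simp add: jfls_def divide_inverse power_inverse mult.commute)
  thus ?thesis using int_coeffs_inverse_e4 int_coeffs_Delta by auto
qed

lemma jfls_nonzero [simp]: "jfls \<noteq> 0"
  by (simp add: jfls_def)

lemma modular_series_jfls: "modular_series 0 jfls"
  using modular_series_mult[OF modular_series_power[OF modular_series_E4, of 3] modular_series_inverse_Delta] by (simp add: jfls_def divide_inverse)

text \<open>The ring \<open>\<int>[j]\<close>, by Horner's scheme.\<close>
inductive zj :: "complex fls \<Rightarrow> bool" where
  zj_of_int: "zj (of_int c)"
| zj_step: "zj F \<Longrightarrow> zj (of_int c + jfls * F)"

lemma zj_0: "zj 0" and zj_1: "zj 1"
  using zj_of_int[of 0] zj_of_int[of 1] by simp_all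

lemma zj_decompose:
  assumes "zj F"
  obtains c G where "zj G" "F = of_int c + jfls * G"
  using assms
proof cases
  case (zj_of_int c)
  thus ?thesis using that[of 0 c] zj_0 by simp
qed (use that in auto)

lemma zj_add_of_int: "zj F \<Longrightarrow> zj (of_int c + F)"
proof (induction rule: zj.induct)
  case (zj_of_int d)
  thus ?case using zj.zj_of_int[of "c + d"] by simp
next
  case (zj_step F d)
  thus ?case using zj.zj_step[of F "c + d"] by (simp add: add.assoc)
qed

lemma zj_add: "zj F \<Longrightarrow> zj G \<Longrightarrow> zj (F + G)"
proof (induction arbitrary: G rule: zj.induct)
  case (zj_of_int c)
  thus ?case by (rule zj_add_of_int)
next
  case (zj_step F c)
  obtain d H where H: "zj H" "G = of_int d + jfls * H" using zj_step.prems by (rule zj_decompose)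
  have "of_int c + jfls * F + G = of_int (c + d) + jfls * (F + H)"
    by (simp add: H(2) algebra_simps)
  thus ?case using zj.zj_step[OF zj_step.IH[OF H(1)], of "c + d"] by (simp only:)
qed

lemma zj_j_mult: "zj F \<Longrightarrow> zj (jfls * F)"
  using zj_step[of F 0] by simp

lemma zj_of_int_mult: "zj F \<Longrightarrow> zj (of_int c * F)"
proof (induction rule: zj.induct)
  case (zj_of_int d)
  thus ?case using zj.zj_of_int[of "c * d"] by simp
next
  case (zj_step F d)
  thus ?case using zj.zj_step[of "of_int c * F" "c * d"] by (simp add: algebra_simps)
qed

lemma zj_mult: "zj F \<Longrightarrow> zj G \<Longrightarrow> zj (F * G)"
proof (induction rule: zj.induct)
  case (zj_step F c)
  thus ?case by (auto simp: ring_distribs mult.assoc intro!: zj_add zj_of_int_mult zj_j_mult)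
qed (rule zj_of_int_mult)

lemma zj_diff: "zj F \<Longrightarrow> zj G \<Longrightarrow> zj (F - G)"
  using zj_add[of F "of_int (-1) * G"] zj_of_int_mult[of G "-1"] by simp

lemma zj_j_power: "zj (jfls ^ n)"
  by (induction n) (auto intro: zj_1 zj_j_mult)

lemma zj_sum: "(\<And>x. x \<in> A \<Longrightarrow> zj (f x)) \<Longrightarrow> zj (\<Sum>x\<in>A. f x)"
  by (induction A rule: infinite_finite_induct) (auto intro: zj_0 zj_add)

lemma zj_int_coeffs: "zj F \<Longrightarrow> int_coeffs F"
  by (induction rule: zj.induct) (auto intro: leading_int_coeffs[OF leading_jfls])

lemma zj_modular_series: "zj F \<Longrightarrow> modular_series 0 F"
proof (induction rule: zj.induct)
  case (zj_of_int c)
  thus ?case using modular_series_const[of "of_int c"] by (simp add: fls_of_int)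
next
  case (zj_step F c)
  thus ?case using modular_series_const[of "of_int c"] modular_series_mult[OF modular_series_jfls zj_step.IH]
    by (auto simp: fls_of_int intro: modular_series_add)
qed

lemma leading_nth:
  assumes "leading e U"
  shows "fls_nth U (- int e) = 1" "\<And>i. i < - int e \<Longrightarrow> fls_nth U i = 0"
  using assms by (auto simp: leading_def fls_X_inv_power_times_conv_shift)

text \<open>Triangular elimination: U j^(m - e) begins with q^(-m), and the elements found for e
  \<le> l < m remove its terms q^(-l). With e = 1 the constant term stays free, which is the
  situation of weight 2 - k.\<close>

lemma zj_basis:
  assumes U: "leading e U" and "m \<ge> e"
  shows "\<exists>F. zj F \<and> (\<forall>i\<le>- int e. fls_nth (U * F) i = (if i = - int m then 1 else 0))"
  using assms(2)
proof (induction m rule: less_induct)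
  case (less m)
  have "\<forall>l\<in>{e..<m}. \<exists>F. zj F \<and> (\<forall>i\<le>- int e. fls_nth (U * F) i = (if i = - int l then 1 else 0))"
    using less.IH by auto
  then obtain B where B: "\<And>l. l \<in> {e..<m} \<Longrightarrow> zj (B l)"
    "\<And>l i. l \<in> {e..<m} \<Longrightarrow> i \<le> - int e \<Longrightarrow> fls_nth (U * B l) i = (if i = - int l then 1 else 0)"
    by metis
  define K where "K = jfls ^ (m - e)"
  have UK: "leading m (U * K)"
    using leading_mult[OF U leading_power[OF leading_jfls, of "m - e"]] less.prems by (simp add: K_def)
  have "\<exists>c. fls_nth (U * K) (- int l) = of_int c" for l
    using int_coeffs_nth[OF leading_int_coeffs[OF UK]] by (auto elim: Ints_cases)
  then obtain c where c: "\<And>l. fls_nth (U * K) (- int l) = of_int (c l)" by metis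
  define F where "F = K - (\<Sum>l\<in>{e..<m}. of_int (c l) * B l)"
  have "zj F" unfolding F_def K_def
    by (intro zj_diff zj_sum zj_of_int_mult zj_j_power B)
  moreover have "fls_nth (U * F) i = (if i = - int m then 1 else 0)" if i: "i \<le> - int e" for i
  proof -
    have "U * F = U * K - (\<Sum>l\<in>{e..<m}. of_int (c l) * (U * B l))"
      by (simp add: F_def algebra_simps sum_distrib_left)
    hence "fls_nth (U * F) i = fls_nth (U * K) i - (\<Sum>l\<in>{e..<m}. of_int (c l) * fls_nth (U * B l) i)"
      by (simp add: fls_nth_sum fls_of_int)
    also have "(\<Sum>l\<in>{e..<m}. of_int (c l) * fls_nth (U * B l) i) = (\<Sum>l\<in>{e..<m}. if l = nat (- i) then of_int (c l) else 0)"
      using i by (intro sum.cong) (auto simp: B(2))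
    also have "\<dots> = (if nat (- i) \<in> {e..<m} then of_int (c (nat (- i))) else 0)"
      by simp
    finally have *: "fls_nth (U * F) i = fls_nth (U * K) i - (if nat (- i) \<in> {e..<m} then of_int (c (nat (- i))) else 0)" .
    consider "i < - int m" | "i = - int m" | "- int m < i" by linarith
    thus ?thesis
    proof cases
      case 3
      hence "nat (- i) \<in> {e..<m}" using i by auto
      thus ?thesis using 3 i c[of "nat (- i)"] unfolding * by simp
    qed (use * leading_nth[OF UK] in auto)
  qed
  ultimately show ?case by blast
qed

text \<open>As U begins with 1, the lowest coefficient of F is that of U F, hence divisible by N.
  Subtracting this multiple of a power of j lowers the pole order, until a constant remains.\<close>

lemma zj_divisible:
  assumes U: "leading 0 U" and F: "zj F" and div: "\<And>i. i \<le> 0 \<Longrightarrow> \<exists>k. fls_nth (U * F) i = of_int (N * k)"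
  shows "cong_fls N F 0"
proof -
  have lead: "fls_nth (U * F) i = fls_nth F i" if low: "\<And>i'. i' < i \<Longrightarrow> fls_nth F i' = 0" for F i
  proof -
    obtain h where h: "U = fps_to_fls h" "fps_nth h 0 = 1" using U by (auto simp: leading_def)
    define G where "G = fls_shift i F"
    obtain g where g: "G = fps_to_fls g"
      by (rule fls_as_fps_nonneg[of G]) (simp add: G_def low)
    have "fls_nth (U * F) i = fls_nth (fls_shift i (U * F)) 0" by simp
    also have "fls_shift i (U * F) = U * G" by (simp add: G_def fls_shifted_times_simps)
    also have "fls_nth (U * G) 0 = fls_nth G 0"
      using h by (simp add: g flip: fls_times_fps_to_fls)
    also have "\<dots> = fls_nth F i" by (simp add: G_def)
    finally show ?thesis .
  qed
  have "cong_fls N F 0" if "zj F" "\<And>i. i < - int m \<Longrightarrow> fls_nth F i = 0"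
    "\<And>i. i \<le> 0 \<Longrightarrow> \<exists>k. fls_nth (U * F) i = of_int (N * k)" for m F
    using that
  proof (induction m arbitrary: F)
    case 0
    obtain k where k: "fls_nth F 0 = of_int (N * k)" using 0(3)[of 0] lead[of 0 F] 0(2) by auto
    \<comment> \<open>An element of Z[j] without pole is constant, by the vanishing criterion in
      weight 0.\<close>
    have "F - of_int (N * k) = 0"
    proof (rule modular_series_eq_0[where n = 1 and k = 0])
      show "modular_series 0 (F - of_int (N * k))" by (intro zj_modular_series zj_diff zj_of_int 0)
      fix i assume "i < int 1"
      hence "i < 0 \<or> i = 0" by auto
      thus "fls_nth (F - of_int (N * k)) i = 0"
        using 0(2)[of i] k unfolding fls_of_int by auto
    qed auto
    hence "F = of_int (N * k) * 1" by simp
    thus ?case using cong_fls_of_int_mult[of N "N * k" 1] by simp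
  next
    case (Suc m)
    define i where "i = - int (Suc m)"
    have i: "i < 0" by (simp add: i_def)
    obtain k where k: "fls_nth F i = of_int (N * k)"
      using Suc.prems(3)[of i] lead[of i F] Suc.prems(2) by (auto simp: i_def)
    define F' where "F' = F - of_int (N * k) * jfls ^ Suc m"
    have L: "leading (Suc m) (jfls ^ Suc m)" using leading_power[OF leading_jfls, of "Suc m"] by simp
    have "cong_fls N F' 0"
    proof (rule Suc.IH)
      show "zj F'" unfolding F'_def by (intro zj_diff zj_of_int_mult zj_j_power Suc.prems)
      show "fls_nth F' i' = 0" if "i' < - int m" for i'
      proof (cases "i' = i")
        case True
        thus ?thesis using leading_nth(1)[OF L] k by (simp add: F'_def i_def fls_of_int del: power_Suc)
      next
        case False
        hence "i' < i" using that by (simp add: i_def)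
        thus ?thesis using leading_nth(2)[OF L, of i'] Suc.prems(2)[of i']
          by (simp add: F'_def i_def fls_of_int del: power_Suc)
      qed
      show "\<exists>l. fls_nth (U * F') i' = of_int (N * l)" if i': "i' \<le> 0" for i'
      proof -
        obtain l where l: "fls_nth (U * F) i' = of_int (N * l)" using Suc.prems(3)[OF i'] by auto
        have "int_coeffs (U * jfls ^ Suc m)"
          using leading_int_coeffs[OF leading_mult[OF U L]] .
        then obtain b where b: "fls_nth (U * jfls ^ Suc m) i' = of_int b"
          using int_coeffs_nth by (metis Ints_cases)
        have "U * F' = U * F - of_int (N * k) * (U * jfls ^ Suc m)"
          by (simp add: F'_def algebra_simps)
        hence "fls_nth (U * F') i' = of_int (N * (l - k * b))"
          using l b by (simp only: fls_minus_nth nth_of_int_mult) (simp add: algebra_simps)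
        thus ?thesis by blast
      qed
    qed
    hence "cong_fls N (F' + of_int (N * k) * jfls ^ Suc m) (0 + 0)"
      by (intro cong_fls_add cong_fls_of_int_mult leading_int_coeffs[OF L]) auto
    thus ?case by (simp add: F'_def)
  qed
  note * = this
  show ?thesis
  proof (rule *[OF F _ div, of "nat (- fls_subdegree F)"])
    fix i assume "i < - int (nat (- fls_subdegree F))"
    hence "i < fls_subdegree F" by linarith
    thus "fls_nth F i = 0" by simp
  qed
qed

section \<open>The substitution of q^p for q on Z[j]\<close>

abbreviation frob :: "nat \<Rightarrow> complex fls \<Rightarrow> complex fls" where
  "frob p F \<equiv> fls_compose_power F p"

lemma frob_of_int [simp]: "p > 0 \<Longrightarrow> frob p (of_int c) = of_int c"
  by (simp add: fls_of_int)

lemma frob_zj: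
  assumes p: "p > 0" and J: "zj J'" "cong_fls N (frob p jfls) J'" and F: "zj F"
  shows "\<exists>F'. zj F' \<and> cong_fls N (frob p F) F'"
  using F
proof (induction rule: zj.induct)
  case (zj_of_int c)
  show ?case using p by (intro exI[of _ "of_int c"]) (auto intro: zj.zj_of_int)
next
  case (zj_step F c)
  from zj_step.IH obtain F' where F': "zj F'" "cong_fls N (frob p F) F'" by blast
  have "cong_fls N (frob p (of_int c + jfls * F)) (of_int c + J' * F')"
    using p J F' zj_step.hyps
    by (auto intro!: cong_fls_add cong_fls_mult zj_int_coeffs int_coeffs_compose_power)
  moreover have "zj (of_int c + J' * F')" by (intro zj_add zj_mult zj.zj_of_int J F')
  ultimately show ?case by blast
qed

text \<open>
  Modulo \<open>N\<close> one has \<open>j(q\<^sup>p) = j K\<close> with \<open>K = \<kappa> + j K\<^sub>2\<close> and \<open>U(q\<^sup>p) = U (1 + \<alpha>/j + \<beta>/j\<^sup>2)\<close>; the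
  remaining hypotheses make the denominators cancel.
\<close>
lemma frob_form:
  assumes p: "p > 0" and U: "leading 0 U" and K2: "zj K2"
    and j: "cong_fls N (frob p jfls) (jfls * (of_int \<kappa> + jfls * K2))"
    and V: "cong_fls N (jfls\<^sup>2 * frob p U) (U * (jfls\<^sup>2 + of_int \<alpha> * jfls + of_int \<beta>))"
    and dvd: "N dvd \<alpha> * d" "N dvd \<beta> * d" "N dvd \<beta> * \<kappa>"
    and F: "zj G" "d dvd c" "F = of_int c + jfls * G"
  shows "\<exists>Q. zj Q \<and> cong_fls N (frob p (U * F)) (U * Q)"
proof -
  define K where "K = of_int \<kappa> + jfls * K2"
  have K: "zj K" unfolding K_def by (intro zj_step K2)
  have jK: "zj (jfls * K)" by (intro zj_j_mult K)
  obtain G' where G': "zj G'" "cong_fls N (frob p G) G'"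
    using frob_zj[OF p jK _ F(1)] j unfolding K_def by blast
  have iU: "int_coeffs U" by (rule leading_int_coeffs[OF U])
  have iJ: "int_coeffs jfls" by (rule leading_int_coeffs[OF leading_jfls])
  define X where "X = of_int c + jfls * K * G'"
  have zX: "zj X" unfolding X_def by (intro zj_add zj.zj_of_int zj_mult jK G')
  have "cong_fls N (frob p F) X"
    unfolding F(3) X_def using p G' j F(1) jK unfolding K_def
    by (auto intro!: cong_fls_add cong_fls_mult zj_int_coeffs int_coeffs_compose_power)
  hence 1: "cong_fls N ((jfls\<^sup>2 * frob p U) * frob p F) ((U * (jfls\<^sup>2 + of_int \<alpha> * jfls + of_int \<beta>)) * X)"
  proof (rule cong_fls_mult[OF V])
    show "int_coeffs (U * (jfls\<^sup>2 + of_int \<alpha> * jfls + of_int \<beta>))"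
      by (intro int_coeffs_mult int_coeffs_add int_coeffs_power int_coeffs_of_int iU iJ)
    show "int_coeffs (frob p F)"
      unfolding F(3) by (intro int_coeffs_compose_power zj_int_coeffs zj.zj_step F(1))
  qed
  \<comment> \<open>\<open>Q\<close> gathers what stays polynomial after division by j^2. The
    leftovers alpha c j, beta c and beta kappa j G' vanish modulo \<open>N\<close> by the three
    divisibility hypotheses.\<close>
  define Q where "Q = X + of_int \<alpha> * (K * G') + of_int \<beta> * (K2 * G')"
  have zQ: "zj Q" unfolding Q_def by (intro zj_add zj_of_int_mult zj_mult zX K K2 G')
  have eq: "(U * (jfls\<^sup>2 + of_int \<alpha> * jfls + of_int \<beta>)) * X =
     jfls\<^sup>2 * (U * Q) + of_int (\<alpha> * c) * (U * jfls) + of_int (\<beta> * c) * U + of_int (\<beta> * \<kappa>) * (U * (jfls * G'))"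
    unfolding Q_def X_def K_def by (simp add: algebra_simps power2_eq_square)
  have "cong_fls N (jfls\<^sup>2 * (U * Q) + of_int (\<alpha> * c) * (U * jfls) + of_int (\<beta> * c) * U + of_int (\<beta> * \<kappa>) * (U * (jfls * G')))
          (jfls\<^sup>2 * (U * Q))"
  proof -
    have "N dvd \<alpha> * c" "N dvd \<beta> * c"
      using dvd F(2) by (meson dvd_trans mult_dvd_mono dvd_refl)+
    moreover have "int_coeffs (U * jfls)" "int_coeffs (U * (jfls * G'))"
      by (intro int_coeffs_mult zj_int_coeffs[OF G'(1)] iU iJ)+
    ultimately show ?thesis using dvd(3) iU
      by (intro cong_fls_trans[OF cong_fls_add_multiple] cong_fls_add_multiple)
  qed
  with 1 have "cong_fls N ((jfls\<^sup>2 * frob p U) * frob p F) (jfls\<^sup>2 * (U * Q))"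
    unfolding eq by (rule cong_fls_trans)
  hence "cong_fls N (jfls\<^sup>2 * frob p (U * F)) (jfls\<^sup>2 * (U * Q))"
    by (simp add: mult.assoc)
  hence "cong_fls N (frob p (U * F)) (U * Q)"
    by (rule cong_fls_cancel) (use int_coeffs_inverse_jfls in \<open>auto simp: power_inverse [symmetric]\<close>)
  with zQ show ?thesis by blast
qed

lemma theta_mult: "theta (F * G) = theta F * G + F * theta G"
  by (simp add: theta_def algebra_simps)

text \<open>The Rankin-Cohen bracket of E_4 and Delta has weight 18 and begins with 4 q, so it is 4
  E_6 Delta. The quotient rule for E_4^3/Delta turns it into the derivative of j.\<close>

lemma theta_jfls: "theta jfls = - (e4\<^sup>2 * e6 * inverse De)"
proof -
  define R where "R = 4 * (E4 * (fps_X * fps_deriv Delta)) - 12 * (Delta * (fps_X * fps_deriv E4))"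
  have "of_int 4 * e4 * theta De - of_int 12 * De * theta e4 = fps_to_fls R"
    unfolding R_def theta_fps_to_fls by (simp add: fls_times_fps_to_fls mult.assoc)
  hence "modular_series 18 (fps_to_fls R)" using modular_series_rankin_cohen_1[OF modular_series_E4 modular_series_Delta] by simp
  moreover have "modular_series 18 (fps_to_fls (fps_const 4 * (E6 * Delta)))"
    using modular_series_cmult[OF modular_series_mult[OF modular_series_E6 modular_series_Delta], of 4] by (simp add: fls_times_fps_to_fls)
  ultimately have "R = fps_const 4 * (E6 * Delta)"
  proof (rule fps_to_fls_modular_series_eq[where n = 2])
    fix i :: nat assume "i < 2"
    hence "i = 0 \<or> i = 1" by auto
    thus "fps_nth R i = fps_nth (fps_const 4 * (E6 * Delta)) i"
      by (auto simp: R_def fps_mult_nth_1 numeral_fps_const)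
  qed auto
  hence "4 * (E4 * (fps_X * fps_deriv Delta) - 3 * (Delta * (fps_X * fps_deriv E4))) = 4 * (E6 * Delta)"
    by (simp add: R_def numeral_fps_const algebra_simps)
  hence "E4 * (fps_X * fps_deriv Delta) - 3 * (Delta * (fps_X * fps_deriv E4)) = E6 * Delta"
    by (subst (asm) mult_left_cancel) simp_all
  from arg_cong[OF this, of fps_to_fls]
  have rc: "e4 * theta De - 3 * (De * theta e4) = e6 * De"
    by (simp only: theta_fps_to_fls) (simp add: fls_times_fps_to_fls)
  have jD: "jfls * De = e4 ^ 3" by (simp add: jfls_def)
  have "theta (jfls * De) = theta (e4 ^ 3)" by (simp only: jD)
  hence "theta jfls * De + jfls * theta De = 3 * e4\<^sup>2 * theta e4"
    by (simp add: theta_mult power3_eq_cube power2_eq_square algebra_simps)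
  hence "(theta jfls * De + jfls * theta De) * De = 3 * e4\<^sup>2 * theta e4 * De" by simp
  hence "theta jfls * De\<^sup>2 + e4 ^ 3 * theta De = 3 * e4\<^sup>2 * theta e4 * De"
    unfolding jD[symmetric] by (simp add: algebra_simps power2_eq_square)
  hence "theta jfls * De\<^sup>2 = - (e4\<^sup>2 * (e4 * theta De - 3 * (De * theta e4)))"
    by (simp add: algebra_simps power2_eq_square power3_eq_cube)
  also have "\<dots> = - (e4\<^sup>2 * e6 * De)" unfolding rc by (simp add: mult.assoc)
  finally have "(theta jfls * De) * De = (- (e4\<^sup>2 * e6)) * De"
    by (simp add: power2_eq_square mult.assoc)
  hence "theta jfls * De = - (e4\<^sup>2 * e6)"
    by (subst (asm) mult_right_cancel) simp_all
  hence "theta jfls * De * inverse De = - (e4\<^sup>2 * e6) * inverse De" by simp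
  thus ?thesis by (simp add: mult.assoc)
qed

lemma theta_power_Suc: "theta (F ^ Suc n) = of_nat (Suc n) * (F ^ n * theta F)"
proof (induction n)
  case (Suc n)
  have "theta (F ^ Suc (Suc n)) = theta (F * F ^ Suc n)" by simp
  also have "\<dots> = theta F * F ^ Suc n + F * (of_nat (Suc n) * (F ^ n * theta F))"
    by (simp only: theta_mult Suc)
  finally show ?case by (simp add: algebra_simps)
qed simp

text \<open>\<open>E\<^sub>1\<^sub>4 j\<^sup>s/\<Delta>\<close> is, up to a factor, the derivative of \<open>j\<^bsup>s+1\<^esup>\<close>, so its constant term vanishes.\<close>
lemma zj_pairing:
  assumes "zj F"
  shows "fls_nth (e4\<^sup>2 * e6 * inverse De * F) 0 = 0"
proof -
  have jpow: "fls_nth (e4\<^sup>2 * e6 * inverse De * jfls ^ s) 0 = 0" for s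
  proof -
    have "theta (jfls ^ Suc s) = - (of_nat (Suc s) * (e4\<^sup>2 * e6 * inverse De * jfls ^ s))"
      unfolding theta_power_Suc theta_jfls by (simp add: mult_ac)
    hence "fls_nth (- (of_nat (Suc s) * (e4\<^sup>2 * e6 * inverse De * jfls ^ s))) 0 = fls_nth (theta (jfls ^ Suc s)) 0"
      by (simp only:)
    hence "of_nat (Suc s) * fls_nth (e4\<^sup>2 * e6 * inverse De * jfls ^ s) 0 = 0"
      by (simp add: fls_of_nat del: of_nat_Suc power_Suc)
    thus ?thesis by (simp del: of_nat_Suc)
  qed
  \<comment> \<open>The power of j is kept general because each Horner step moves one factor j into
    it.\<close>
  have "fls_nth (e4\<^sup>2 * e6 * inverse De * jfls ^ s * F) 0 = 0" for s
    using assms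
  proof (induction arbitrary: s rule: zj.induct)
    case (zj_of_int c)
    show ?case using jpow[of s] by (simp add: fls_of_int)
  next
    case (zj_step F c)
    have "e4\<^sup>2 * e6 * inverse De * jfls ^ s * (of_int c + jfls * F) =
       e4\<^sup>2 * e6 * inverse De * jfls ^ s * fls_const (of_int c) + e4\<^sup>2 * e6 * inverse De * jfls ^ Suc s * F"
      by (simp add: algebra_simps fls_of_int)
    thus ?case using zj_step.IH[of "Suc s"] jpow[of s] by simp
  qed
  from this[of 0] show ?thesis by simp
qed

text \<open>As W is congruent to E_4^3 = j Delta modulo d, the series U j G is congruent to E_14
  G/Delta, whose constant term vanishes by \<open>zj_pairing\<close>. Since U begins with 1, the
  constant term 0 of U F is c plus that of U j G.\<close>

lemma constant_term_dvd:
  assumes U: "leading 0 U" and UW: "U * W = e4\<^sup>2 * e6" "cong_fls d W (e4 ^ 3)"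
    and F: "zj G" "F = of_int c + jfls * G" "fls_nth (U * F) 0 = 0"
  shows "d dvd c"
proof -
  have iU: "int_coeffs U" by (rule leading_int_coeffs[OF U])
  have iD: "int_coeffs (inverse De)" by (rule leading_int_coeffs[OF leading_inverse_Delta])
  have "int_coeffs (inverse De * (U * G))" by (intro int_coeffs_mult iU iD zj_int_coeffs F)
  from cong_fls_mult_left[OF this UW(2)]
  have "cong_fls d (e4\<^sup>2 * e6 * inverse De * G) (U * (jfls * G))"
    unfolding UW(1) [symmetric] by (simp add: jfls_def divide_inverse mult_ac)
  hence cong: "cong_fls d (U * (jfls * G)) (e4\<^sup>2 * e6 * inverse De * G)" by (rule cong_fls_sym)
  have "U * F = U * of_int c + U * (jfls * G)" by (simp add: F(2) algebra_simps)
  hence "fls_nth U 0 * of_int c + fls_nth (U * (jfls * G)) 0 = 0"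
    using F(3) by (simp add: fls_of_int)
  hence "fls_nth (U * (jfls * G)) 0 = of_int (- c)"
    using leading_nth(1)[OF U] by (simp add: add_eq_0_iff)
  from cong_fls_nth[OF cong this, of 0] zj_pairing[OF F(1)] show ?thesis by simp
qed

section \<open>Congruences for \<open>f(q\<^sup>p)\<close>\<close>

lemma cong_fls_cancel_unit:
  assumes "cong_fls N (fps_to_fls w * F) (fps_to_fls w * G)" "int_coeffs (fps_to_fls w)" "fps_nth w 0 = 1"
  shows "cong_fls N F G"
proof (rule cong_fls_cancel[OF assms(1)])
  show "int_coeffs (inverse (fps_to_fls w))"
    using int_coeffs_inverse_fps[OF assms(2,3)] by (simp add: inverse_fps_to_fls[OF assms(3)])
  show "fps_to_fls w \<noteq> 0" using assms(3) by auto
qed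

lemma cong_fls_cancel_X:
  assumes "cong_fls N (fps_to_fls u * F) (fps_to_fls u * G)" "int_coeffs (fps_to_fls u)"
    "fps_nth u 0 = 0" "fps_nth u (Suc 0) = 1"
  shows "cong_fls N F G"
proof (rule cong_fls_cancel[OF assms(1)])
  show "int_coeffs (inverse (fps_to_fls u))"
    by (rule leading_int_coeffs[OF leading_inverse]) fact+
  show "fps_to_fls u \<noteq> 0" using assms(4) by auto
qed

lemma frob_fps_to_fls: "p > 0 \<Longrightarrow> frob p (fps_to_fls f) = fps_to_fls (f oo fps_X ^ p)"
  by (simp add: fls_compose_power_fps_to_fls)

lemma square_eq_imp_eq:
  fixes f g :: "complex fps"
  assumes "f\<^sup>2 = g\<^sup>2" "fps_nth f 0 = fps_nth g 0" "fps_nth g 0 \<noteq> 0"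
  shows "f = g"
  using assms by (auto simp: power2_eq_iff)

lemma jfls_times_Delta: "jfls * De = e4 ^ 3"
  by (simp add: jfls_def)

lemma frob_jfls_times_Delta: "p > 0 \<Longrightarrow> frob p jfls * frob p De = frob p e4 ^ 3"
  by (simp flip: fls_compose_power_mult add: jfls_times_Delta)

lemma int_coeffs_frob_jfls: "int_coeffs (frob p jfls)"
  by (intro int_coeffs_compose_power leading_int_coeffs[OF leading_jfls])

lemma sigma_fps_compose_nth:
  assumes "p > 1"
  shows "fps_nth (sigma_fps k oo fps_X ^ p) 0 = 0" "fps_nth (sigma_fps k oo fps_X ^ p) (Suc 0) = 0"
    "int_coeffs (fps_to_fls (sigma_fps k oo fps_X ^ p))"
  using assms by (auto simp: fps_nth_compose_X_power int_coeffs_fps_to_fls sigma_fps_def)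

lemma cong_fls_multipleI:
  assumes "int_coeffs H" "F = G + of_int N * H"
  shows "cong_fls N F G"
  using assms by (intro cong_flsI[of H]) auto

text \<open>For h = w/u the parametrization gives j = (h + 256)^3/h^2, j(q^2) = (h + 16)^3/h,
  E_4(q^2)/E_4 = (h + 16)/(h + 256) and E_6(q^2)/E_6 = (h - 8)/(h - 512). Modulo 256 these are h,
  h^2 + 48 h, 1 + 16/h and 1 - 8/h.\<close>

lemma level_2_congruences:
  "cong_fls 256 (frob 2 jfls) (jfls * (of_int 48 + jfls * 1))"
  "cong_fls 256 (jfls * frob 2 e4) (e4 * (jfls + of_int 16))"
  "cong_fls 256 (jfls * frob 2 e6) (e6 * (jfls + of_int (- 8)))"
proof -
  define A where "A = sigma_fps 3 oo fps_X ^ 2"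
  define u w where "u = sigma_fps 3 - A" and "w = 1 - 16 * sigma_fps 3 + 256 * A"
  note par = level_2_parametrization[folded A_def, folded u_def w_def]
  define U W where "U = fps_to_fls u" and "W = fps_to_fls w"
  have A: "fps_nth A 0 = 0" "fps_nth A (Suc 0) = 0" "int_coeffs (fps_to_fls A)"
    unfolding A_def by (intro sigma_fps_compose_nth; simp)+
  have iS: "int_coeffs (fps_to_fls (sigma_fps 3))" by (simp add: int_coeffs_fps_to_fls sigma_fps_def)
  have iU: "int_coeffs U" using A iS unfolding U_def u_def fps_to_fls_minus by (intro int_coeffs_diff)
  have iW: "int_coeffs W" using A iS
    unfolding W_def w_def fps_to_fls_minus fps_to_fls_plus fls_times_fps_to_fls fps_to_fls_numeral fps_one_to_fls
    by (intro int_coeffs_add int_coeffs_diff int_coeffs_mult int_coeffs_numeral int_coeffs_1)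
  have u01: "fps_nth u 0 = 0" "fps_nth u (Suc 0) = 1"
    using A by (simp_all add: u_def sigma_fps_def divisor_sum_eval)
  have w0: "fps_nth w 0 = 1" using A by (simp add: w_def sigma_fps_def numeral_fps_const)
  have iJ: "int_coeffs jfls" by (rule leading_int_coeffs[OF leading_jfls])
  have cancel_W: "cong_fls 256 F G" if "cong_fls 256 (W * F) (W * G)" for F G
    using cong_fls_cancel_unit that iW w0 unfolding W_def by blast
  have cancel_U: "cong_fls 256 F G" if "cong_fls 256 (U * F) (U * G)" for F G
    using cong_fls_cancel_X that iU u01 unfolding U_def by blast
  have a: "e4 = W + 256 * U" unfolding par(1) U_def W_def by (simp add: fls_times_fps_to_fls)
  have b: "frob 2 e4 = W + 16 * U" unfolding U_def W_def
    by (simp add: frob_fps_to_fls par(2) fls_times_fps_to_fls)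
  have d: "De = U * W\<^sup>2" unfolding par(3) U_def W_def by (simp add: fls_times_fps_to_fls fps_to_fls_power)
  have d2: "frob 2 De = U\<^sup>2 * W" unfolding U_def W_def
    by (simp add: frob_fps_to_fls par(4) fls_times_fps_to_fls fps_to_fls_power)
  have aW: "cong_fls 256 e4 W" by (rule cong_fls_multipleI[OF iU]) (simp add: a)
  have ju: "cong_fls 256 (jfls * U) W"
  proof (rule cancel_W, rule cancel_W)
    have "W * (W * (jfls * U)) = e4 ^ 3"
      using jfls_times_Delta by (simp add: d power2_eq_square mult_ac)
    moreover have "cong_fls 256 (e4 ^ 3) (W ^ 3)" by (rule cong_fls_power[OF aW iW])
    ultimately show "cong_fls 256 (W * (W * (jfls * U))) (W * (W * W))"
      by (simp add: power3_eq_cube mult.assoc)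
  qed
  have iju: "int_coeffs (jfls * U)" using iJ iU by (rule int_coeffs_mult)
  show "cong_fls 256 (frob 2 jfls) (jfls * (of_int 48 + jfls * 1))"
  proof (rule cancel_U, rule cancel_U, rule cancel_W)
    have "W * (U * (U * frob 2 jfls)) = frob 2 e4 ^ 3"
      using frob_jfls_times_Delta[of 2] by (simp add: d2 power2_eq_square mult_ac)
    also have "cong_fls 256 \<dots> (W * (of_int 48 * (U * W) + W * W))"
    proof (rule cong_fls_multipleI)
      show "int_coeffs (3 * (W * (U * U)) + 16 * (U * (U * U)))"
        using iU iW by (intro int_coeffs_add int_coeffs_mult int_coeffs_numeral)
      show "frob 2 e4 ^ 3 = W * (of_int 48 * (U * W) + W * W) + of_int 256 * (3 * (W * (U * U)) + 16 * (U * (U * U)))"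
        unfolding b by (simp add: algebra_simps power3_eq_cube)
    qed
    also have "cong_fls 256 \<dots> (W * (of_int 48 * (U * (jfls * U)) + (jfls * U) * (jfls * U)))"
      using iW iU iju cong_fls_sym[OF ju]
      by (intro cong_fls_mult_left cong_fls_add cong_fls_mult[OF cong_fls_sym[OF ju] cong_fls_sym[OF ju]])
         (auto intro!: int_coeffs_of_int)
    also have "W * (of_int 48 * (U * (jfls * U)) + (jfls * U) * (jfls * U)) = W * (U * (U * (jfls * (of_int 48 + jfls * 1))))"
      by (simp add: algebra_simps)
    finally show "cong_fls 256 (W * (U * (U * frob 2 jfls))) (W * (U * (U * (jfls * (of_int 48 + jfls * 1)))))" .
  qed
  show "cong_fls 256 (jfls * frob 2 e4) (e4 * (jfls + of_int 16))"
  proof (rule cancel_U)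
    have "U * (jfls * frob 2 e4) = (W + 16 * U) * (jfls * U)" unfolding b by (simp add: mult_ac)
    also have "cong_fls 256 \<dots> ((W + 16 * U) * W)"
      using iW iU ju by (intro cong_fls_mult_left) auto
    also have "(W + 16 * U) * W = W * (W + 16 * U)" by (rule mult.commute)
    also have "cong_fls 256 \<dots> (e4 * (jfls * U + 16 * U))"
      using iW iU by (intro cong_fls_mult cong_fls_sym[OF aW] cong_fls_add cong_fls_sym[OF ju] int_coeffs_E4) auto
    also have "e4 * (jfls * U + 16 * U) = U * (e4 * (jfls + of_int 16))" by (simp add: algebra_simps)
    finally show "cong_fls 256 (U * (jfls * frob 2 e4)) (U * (e4 * (jfls + of_int 16)))" .
  qed
  \<comment> \<open>The parametrization determines only the square of E_6; the constant terms, all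
    equal to 1, fix the sign of the root.\<close>
  have "(E6 * (w - 8 * u))\<^sup>2 = ((E6 oo fps_X ^ 2) * (w - 512 * u))\<^sup>2"
  proof -
    have "E6\<^sup>2 = E4 ^ 3 - 1728 * Delta" by (simp add: Delta_mult_1728)
    also have "\<dots> = (w + 64 * u) * (w - 512 * u)\<^sup>2"
      unfolding par(1,3) by (simp add: algebra_simps power2_eq_square power3_eq_cube)
    finally have c: "E6\<^sup>2 = (w + 64 * u) * (w - 512 * u)\<^sup>2" .
    have "(E6 oo fps_X ^ 2)\<^sup>2 = (E4 oo fps_X ^ 2) ^ 3 - 1728 * (Delta oo fps_X ^ 2)"
      using arg_cong[OF Delta_mult_1728, of "\<lambda>f. f oo fps_X ^ 2"]
      by (simp add: fps_compose_mult_distrib fps_compose_sub_distrib numeral_fps_const flip: fps_compose_power)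
    also have "\<dots> = (w + 64 * u) * (w - 8 * u)\<^sup>2"
      unfolding par(2,4) by (simp add: algebra_simps power2_eq_square power3_eq_cube)
    finally have d: "(E6 oo fps_X ^ 2)\<^sup>2 = (w + 64 * u) * (w - 8 * u)\<^sup>2" .
    show ?thesis unfolding power_mult_distrib c d by (simp add: mult_ac)
  qed
  hence "E6 * (w - 8 * u) = (E6 oo fps_X ^ 2) * (w - 512 * u)"
    by (rule square_eq_imp_eq) (simp_all add: w0 u01 numeral_fps_const fps_nth_compose_X_power)
  from arg_cong[OF this, of fps_to_fls]
  have e: "e6 * (W - 8 * U) = frob 2 e6 * (W - 512 * U)"
    by (simp add: frob_fps_to_fls fls_times_fps_to_fls U_def W_def)
  show "cong_fls 256 (jfls * frob 2 e6) (e6 * (jfls + of_int (- 8)))"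
  proof (rule cancel_U)
    have i6: "int_coeffs (frob 2 e6)" by (intro int_coeffs_compose_power int_coeffs_E6)
    have "U * (jfls * frob 2 e6) = frob 2 e6 * (jfls * U)" by (simp add: mult_ac)
    also have "cong_fls 256 \<dots> (frob 2 e6 * W)" by (intro cong_fls_mult_left i6 ju)
    also have "cong_fls 256 (frob 2 e6 * W) (e6 * (W - 8 * U))"
    proof (rule cong_fls_multipleI)
      show "int_coeffs (2 * (frob 2 e6 * U))" using iU i6 by (intro int_coeffs_mult int_coeffs_numeral)
      show "frob 2 e6 * W = e6 * (W - 8 * U) + of_int 256 * (2 * (frob 2 e6 * U))"
        unfolding e by (simp add: algebra_simps)
    qed
    also have "cong_fls 256 (e6 * (W - 8 * U)) (e6 * (jfls * U + (- (8 * U))))"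
      using cong_fls_add[OF cong_fls_sym[OF ju] cong_fls_refl, of "- (8 * U)"]
      by (intro cong_fls_mult_left int_coeffs_E6) simp
    also have "e6 * (jfls * U + (- (8 * U))) = U * (e6 * (jfls + of_int (- 8)))" by (simp add: algebra_simps)
    finally show "cong_fls 256 (U * (jfls * frob 2 e6)) (U * (e6 * (jfls + of_int (- 8))))" .
  qed
qed

text \<open>For h = w/u one has j = (h + 27)(h + 243)^3/h^3, j(q^3) = (h + 27)(h + 3)^3/h and
  E_4(q^3)/E_4 = (h + 3)/(h + 243). Modulo 27 these are h, h^3 + 9 h^2 and 1 + 3/h.\<close>

lemma level_3_congruences:
  "cong_fls 27 (frob 3 jfls) (jfls * (of_int 0 + jfls * (of_int 9 + jfls * 1)))"
  "cong_fls 27 (jfls * frob 3 e4) (e4 * (jfls + of_int 3))"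
  "cong_fls 27 (jfls * frob 3 e6) (e6 * (jfls + of_int 18))"
proof -
  define A where "A = sigma_fps 3 oo fps_X ^ 3"
  define u w where "u = sigma_fps 3 - A" and "w = 1 - 3 * sigma_fps 3 + 243 * A"
  note par = level_3_parametrization[folded A_def, folded u_def w_def]
  define U W where "U = fps_to_fls u" and "W = fps_to_fls w"
  have A: "fps_nth A 0 = 0" "fps_nth A (Suc 0) = 0" "int_coeffs (fps_to_fls A)"
    unfolding A_def by (intro sigma_fps_compose_nth; simp)+
  have iS: "int_coeffs (fps_to_fls (sigma_fps 3))" by (simp add: int_coeffs_fps_to_fls sigma_fps_def)
  have iU: "int_coeffs U" using A iS unfolding U_def u_def fps_to_fls_minus by (intro int_coeffs_diff)
  have iW: "int_coeffs W" using A iS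
    unfolding W_def w_def fps_to_fls_minus fps_to_fls_plus fls_times_fps_to_fls fps_to_fls_numeral fps_one_to_fls
    by (intro int_coeffs_add int_coeffs_diff int_coeffs_mult int_coeffs_numeral int_coeffs_1)
  have u01: "fps_nth u 0 = 0" "fps_nth u (Suc 0) = 1"
    using A by (simp_all add: u_def sigma_fps_def divisor_sum_eval)
  have w0: "fps_nth w 0 = 1" using A by (simp add: w_def sigma_fps_def numeral_fps_const)
  have iJ: "int_coeffs jfls" by (rule leading_int_coeffs[OF leading_jfls])
  have cancel_W: "cong_fls 27 F G" if "cong_fls 27 (W * F) (W * G)" for F G
    using cong_fls_cancel_unit that iW w0 unfolding W_def by blast
  have cancel_U: "cong_fls 27 F G" if "cong_fls 27 (U * F) (U * G)" for F G
    using cong_fls_cancel_X that iU u01 unfolding U_def by blast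
  have a: "e4 = W + 243 * U" unfolding par(1) U_def W_def by (simp add: fls_times_fps_to_fls)
  have b: "frob 3 e4 = W + 3 * U" unfolding U_def W_def
    by (simp add: frob_fps_to_fls par(2) fls_times_fps_to_fls)
  have d: "De * (W + 27 * U) = U * W ^ 3"
    using arg_cong[OF par(3), of fps_to_fls] unfolding U_def W_def by (simp add: fls_times_fps_to_fls fps_to_fls_power)
  have d3: "frob 3 De * (W + 27 * U) = U ^ 3 * W"
    using arg_cong[OF par(4), of fps_to_fls] unfolding U_def W_def
    by (simp add: frob_fps_to_fls fls_times_fps_to_fls fps_to_fls_power)
  have aW: "cong_fls 27 e4 W" using iU
    by (intro cong_fls_multipleI[of "9 * U"]) (auto simp: a)
  have W27: "cong_fls 27 (W + 27 * U) W" by (rule cong_fls_multipleI[OF iU]) simp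
  have ju: "cong_fls 27 (jfls * U) W"
  proof (rule cancel_W, rule cancel_W, rule cancel_W)
    have "W * (W * (W * (jfls * U))) = jfls * (De * (W + 27 * U))"
      unfolding d by (simp add: power3_eq_cube mult_ac)
    also have "\<dots> = e4 ^ 3 * (W + 27 * U)" by (simp add: jfls_times_Delta flip: mult.assoc)
    also have "cong_fls 27 \<dots> (W ^ 3 * W)"
      using iU iW by (intro cong_fls_mult cong_fls_power aW W27) auto
    finally show "cong_fls 27 (W * (W * (W * (jfls * U)))) (W * (W * (W * W)))"
      by (simp add: power3_eq_cube mult.assoc)
  qed
  have iju: "int_coeffs (jfls * U)" using iJ iU by (rule int_coeffs_mult)
  show "cong_fls 27 (frob 3 jfls) (jfls * (of_int 0 + jfls * (of_int 9 + jfls * 1)))"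
  proof (rule cancel_U, rule cancel_U, rule cancel_U, rule cancel_W)
    have "W * (U * (U * (U * frob 3 jfls))) = frob 3 jfls * (frob 3 De * (W + 27 * U))"
      unfolding d3 by (simp add: power3_eq_cube mult_ac)
    also have "\<dots> = frob 3 e4 ^ 3 * (W + 27 * U)" by (simp add: frob_jfls_times_Delta flip: mult.assoc)
    also have "cong_fls 27 \<dots> ((of_int 9 * (U * (W * W)) + W * (W * W)) * W)"
    proof (rule cong_fls_mult[OF _ W27])
      show "cong_fls 27 (frob 3 e4 ^ 3) (of_int 9 * (U * (W * W)) + W * (W * W))"
      proof (rule cong_fls_multipleI)
        show "int_coeffs (W * (U * U) + U * (U * U))" using iU iW by auto
        show "frob 3 e4 ^ 3 = of_int 9 * (U * (W * W)) + W * (W * W) + of_int 27 * (W * (U * U) + U * (U * U))"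
          unfolding b by (simp add: algebra_simps power3_eq_cube)
      qed
      show "int_coeffs (W + 27 * U)" "int_coeffs (of_int 9 * (U * (W * W)) + W * (W * W))" using iU iW by auto
    qed
    also have "(of_int 9 * (U * (W * W)) + W * (W * W)) * W = W * (of_int 9 * (U * (W * W)) + W * (W * W))"
      by (rule mult.commute)
    also have "cong_fls 27 \<dots> (W * (of_int 9 * (U * ((jfls * U) * (jfls * U))) + (jfls * U) * ((jfls * U) * (jfls * U))))"
    proof -
      have 2: "cong_fls 27 (W * W) ((jfls * U) * (jfls * U))"
        using iW iju by (intro cong_fls_mult cong_fls_sym[OF ju])
      have 3: "cong_fls 27 (W * (W * W)) ((jfls * U) * ((jfls * U) * (jfls * U)))"
        using iW iju by (intro cong_fls_mult 2 cong_fls_sym[OF ju]) auto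
      show ?thesis using iW iU 2 3 by (intro cong_fls_mult_left cong_fls_add) auto
    qed
    also have "W * (of_int 9 * (U * ((jfls * U) * (jfls * U))) + (jfls * U) * ((jfls * U) * (jfls * U))) =
        W * (U * (U * (U * (jfls * (of_int 0 + jfls * (of_int 9 + jfls * 1))))))"
      by (simp add: algebra_simps)
    finally show "cong_fls 27 (W * (U * (U * (U * frob 3 jfls))))
       (W * (U * (U * (U * (jfls * (of_int 0 + jfls * (of_int 9 + jfls * 1)))))))" .
  qed
  show "cong_fls 27 (jfls * frob 3 e4) (e4 * (jfls + of_int 3))"
  proof (rule cancel_U)
    have "U * (jfls * frob 3 e4) = (W + 3 * U) * (jfls * U)" unfolding b by (simp add: mult_ac)
    also have "cong_fls 27 \<dots> ((W + 3 * U) * W)"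
      using iW iU ju by (intro cong_fls_mult_left) auto
    also have "(W + 3 * U) * W = W * (W + 3 * U)" by (rule mult.commute)
    also have "cong_fls 27 \<dots> (e4 * (jfls * U + 3 * U))"
      using iW iU by (intro cong_fls_mult cong_fls_sym[OF aW] cong_fls_add cong_fls_sym[OF ju] int_coeffs_E4) auto
    also have "e4 * (jfls * U + 3 * U) = U * (e4 * (jfls + of_int 3))" by (simp add: algebra_simps)
    finally show "cong_fls 27 (U * (jfls * frob 3 e4)) (U * (e4 * (jfls + of_int 3)))" .
  qed
  \<comment> \<open>\<open>r\<close> and \<open>s\<close> are square roots of E_6(q^3)^2 (w + 27 u)
    and of E_6^2 (w + 27 u). Modulo 27 they reduce to w^2 + 18 u w and w^2, whence E_6(q^3)/E_6 is 1
    + 18 u/w.\<close>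
  define r s where "r = w\<^sup>2 + 18 * (u * w) - 27 * u\<^sup>2" and "s = w\<^sup>2 - 486 * (u * w) - 19683 * u\<^sup>2"
  have "(E6 * r)\<^sup>2 * (w + 27 * u) = ((E6 oo fps_X ^ 3) * s)\<^sup>2 * (w + 27 * u)"
  proof -
    have "E6\<^sup>2 * (w + 27 * u) = E4 ^ 3 * (w + 27 * u) - 1728 * (Delta * (w + 27 * u))"
      by (simp add: Delta_mult_1728 left_diff_distrib flip: mult.assoc)
    also have "\<dots> = s\<^sup>2"
      unfolding par(3) unfolding par(1) s_def by (simp add: algebra_simps power2_eq_square power3_eq_cube)
    finally have c: "E6\<^sup>2 * (w + 27 * u) = s\<^sup>2" .
    have "(E6 oo fps_X ^ 3)\<^sup>2 = (E4 oo fps_X ^ 3) ^ 3 - 1728 * (Delta oo fps_X ^ 3)"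
      using arg_cong[OF Delta_mult_1728, of "\<lambda>f. f oo fps_X ^ 3"]
      by (simp add: fps_compose_mult_distrib fps_compose_sub_distrib numeral_fps_const flip: fps_compose_power)
    hence "(E6 oo fps_X ^ 3)\<^sup>2 * (w + 27 * u) = (E4 oo fps_X ^ 3) ^ 3 * (w + 27 * u) - 1728 * ((Delta oo fps_X ^ 3) * (w + 27 * u))"
      by (simp add: left_diff_distrib mult.assoc)
    also have "\<dots> = r\<^sup>2"
      unfolding par(4) unfolding par(2) r_def by (simp add: algebra_simps power2_eq_square power3_eq_cube)
    finally have d: "(E6 oo fps_X ^ 3)\<^sup>2 * (w + 27 * u) = r\<^sup>2" .
    have "(E6 * r)\<^sup>2 * (w + 27 * u) = (E6\<^sup>2 * (w + 27 * u)) * r\<^sup>2"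
      by (simp add: power_mult_distrib mult_ac)
    also have "\<dots> = ((E6 oo fps_X ^ 3)\<^sup>2 * (w + 27 * u)) * s\<^sup>2" unfolding c d by (rule mult.commute)
    also have "\<dots> = ((E6 oo fps_X ^ 3) * s)\<^sup>2 * (w + 27 * u)"
      by (simp add: power_mult_distrib mult_ac)
    finally show ?thesis .
  qed
  moreover have "fps_nth (w + 27 * u) 0 = 1" by (simp add: w0 u01 numeral_fps_const)
  hence "w + 27 * u \<noteq> 0" by force
  ultimately have "(E6 * r)\<^sup>2 = ((E6 oo fps_X ^ 3) * s)\<^sup>2" by simp
  hence "E6 * r = (E6 oo fps_X ^ 3) * s"
    by (rule square_eq_imp_eq)
       (simp_all add: r_def s_def w0 u01 numeral_fps_const fps_nth_compose_X_power fps_power_zeroth)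
  from arg_cong[OF this, of fps_to_fls]
  have e: "e6 * (W\<^sup>2 + 18 * (U * W) - 27 * U\<^sup>2) = frob 3 e6 * (W\<^sup>2 - 486 * (U * W) - 19683 * U\<^sup>2)"
    by (simp add: r_def s_def frob_fps_to_fls fls_times_fps_to_fls fps_to_fls_power U_def W_def)
  have i6: "int_coeffs (frob 3 e6)" by (intro int_coeffs_compose_power int_coeffs_E6)
  have e': "cong_fls 27 (frob 3 e6 * W) (e6 * (W + 18 * U))"
  proof (rule cancel_W, rule cong_fls_multipleI)
    show "int_coeffs (frob 3 e6 * (18 * (U * W) + 729 * (U * U)) - e6 * (U * U))"
      using iU iW i6 int_coeffs_E6
      by (intro int_coeffs_diff int_coeffs_add int_coeffs_mult int_coeffs_numeral)
    have "W * (frob 3 e6 * W) = frob 3 e6 * (W\<^sup>2 - 486 * (U * W) - 19683 * U\<^sup>2) + frob 3 e6 * (486 * (U * W) + 19683 * U\<^sup>2)"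
      by (simp add: algebra_simps power2_eq_square)
    thus "W * (frob 3 e6 * W) = W * (e6 * (W + 18 * U)) + of_int 27 * (frob 3 e6 * (18 * (U * W) + 729 * (U * U)) - e6 * (U * U))"
      unfolding e [symmetric] by (simp add: algebra_simps power2_eq_square)
  qed
  show "cong_fls 27 (jfls * frob 3 e6) (e6 * (jfls + of_int 18))"
  proof (rule cancel_U)
    have "U * (jfls * frob 3 e6) = frob 3 e6 * (jfls * U)" by (simp add: mult_ac)
    also have "cong_fls 27 \<dots> (frob 3 e6 * W)" by (intro cong_fls_mult_left i6 ju)
    also note e'
    also have "cong_fls 27 (e6 * (W + 18 * U)) (e6 * (jfls * U + 18 * U))"
      by (intro cong_fls_mult_left int_coeffs_E6 cong_fls_add cong_fls_sym[OF ju] cong_fls_refl)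
    also have "e6 * (jfls * U + 18 * U) = U * (e6 * (jfls + of_int 18))" by (simp add: algebra_simps)
    finally show "cong_fls 27 (U * (jfls * frob 3 e6)) (U * (e6 * (jfls + of_int 18)))" .
  qed
qed

lemma int_power_5_dvd: "(5 :: int) dvd c - c ^ 5"
proof -
  have "(c - c ^ 5) mod 5 = (c mod 5 - (c mod 5) ^ 5) mod 5"
    by (intro mod_diff_cong) (simp_all add: power_mod)
  moreover have "c mod 5 = 0 \<or> c mod 5 = 1 \<or> c mod 5 = 2 \<or> c mod 5 = 3 \<or> c mod 5 = 4"
    by presburger
  hence "(c mod 5 - (c mod 5) ^ 5) mod 5 = 0" by (elim disjE) simp_all
  ultimately show ?thesis by (simp add: mod_eq_0_iff_dvd)
qed

text \<open>Induction on the index of the coefficient: for f = c + X g the binomial formula leaves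
  c^5 + X^5 g^5 modulo 5, where c^5 is congruent to c and g is needed at a smaller index
  only.\<close>

lemma frobenius_5:
  assumes "int_coeffs (fps_to_fls f)"
  shows "cong_fls 5 (frob 5 (fps_to_fls f)) (fps_to_fls f ^ 5)"
proof -
  have "\<exists>k. fps_nth ((f oo fps_X ^ 5) - f ^ 5) n = of_int (5 * k)" if "int_coeffs (fps_to_fls f)" for f n
    using that
  proof (induction n arbitrary: f rule: less_induct)
    case (less n)
    define g where "g = fps_shift 1 f"
    have ig: "int_coeffs (fps_to_fls g)" using less.prems by (simp add: g_def int_coeffs_fps_to_fls)
    obtain c where c: "fps_nth f 0 = of_int c" using less.prems by (auto simp: int_coeffs_fps_to_fls elim: Ints_cases)
    have f: "f = of_int c + fps_X * g" by (rule fps_ext) (auto simp: g_def c fps_of_int [symmetric])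
    define h where "h = of_int c ^ 4 * (fps_X * g) + 2 * (of_int c ^ 3 * (fps_X * g)\<^sup>2) + 2 * (of_int c ^ 2 * (fps_X * g) ^ 3) + of_int c * (fps_X * g) ^ 4"
    have "int_coeffs (fps_to_fls h)"
      unfolding h_def fps_to_fls_plus fls_times_fps_to_fls fps_to_fls_power fps_to_fls_numeral fps_to_fls_of_int fps_X_to_fls
      by (intro int_coeffs_add int_coeffs_mult int_coeffs_power int_coeffs_numeral int_coeffs_of_int ig)
         (auto simp: int_coeffs_def)
    then obtain l where l: "fps_nth h n = of_int l" by (auto simp: int_coeffs_fps_to_fls elim: Ints_cases)
    have "(of_int c + fps_X * g) ^ 5 = of_int c ^ 5 + (fps_X * g) ^ 5 + 5 * h"
      unfolding h_def by (simp add: algebra_simps eval_nat_numeral)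
    hence f5: "f ^ 5 = of_int (c ^ 5) + fps_X ^ 5 * g ^ 5 + 5 * h"
      by (simp add: f power_mult_distrib)
    have fV: "f oo fps_X ^ 5 = of_int c + fps_X ^ 5 * (g oo fps_X ^ 5)"
      by (subst f) (simp add: fps_compose_add_distrib fps_compose_mult_distrib fps_of_int [symmetric])
    have eq: "(f oo fps_X ^ 5) - f ^ 5 = of_int (c - c ^ 5) + fps_X ^ 5 * ((g oo fps_X ^ 5) - g ^ 5) - 5 * h"
      unfolding f5 fV by (simp add: algebra_simps)
    obtain k1 where k1: "c - c ^ 5 = 5 * k1" using int_power_5_dvd[of c] by (auto elim: dvdE)
    obtain k2 where k2: "fps_nth (fps_X ^ 5 * ((g oo fps_X ^ 5) - g ^ 5)) n = of_int (5 * k2)"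
    proof (cases "n < 5")
      case True
      thus ?thesis using that[of 0] by (simp add: fps_X_power_mult_nth)
    next
      case False
      from less.IH[of "n - 5", OF _ ig] False obtain k where
        "fps_nth ((g oo fps_X ^ 5) - g ^ 5) (n - 5) = of_int (5 * k)" by auto
      thus ?thesis using that[of k] False by (simp add: fps_X_power_mult_nth)
    qed
    have "fps_nth (of_int (c - c ^ 5) :: complex fps) n = of_int (5 * (if n = 0 then k1 else 0))"
      unfolding k1 by (simp add: fps_of_int [symmetric])
    hence "fps_nth ((f oo fps_X ^ 5) - f ^ 5) n = of_int (5 * ((if n = 0 then k1 else 0) + k2 - l))"
      unfolding eq using k2 l by (simp add: numeral_fps_const algebra_simps)
    thus ?case by blast
  qed
  from this[OF assms] obtain k where k: "\<And>n. fps_nth ((f oo fps_X ^ 5) - f ^ 5) n = of_int (5 * k n)" by metis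
  define H where "H = Abs_fps (\<lambda>n. of_int (k n) :: complex)"
  have "(f oo fps_X ^ 5) - f ^ 5 = 5 * H"
    by (rule fps_ext, subst k) (simp add: H_def numeral_fps_const)
  from arg_cong[OF this, of fps_to_fls]
  have "frob 5 (fps_to_fls f) - fps_to_fls f ^ 5 = of_int 5 * fps_to_fls H"
    by (simp add: frob_fps_to_fls fls_times_fps_to_fls fps_to_fls_power)
  moreover have "int_coeffs (fps_to_fls H)" by (simp add: int_coeffs_fps_to_fls H_def)
  ultimately show ?thesis by (intro cong_flsI)
qed

section \<open>Eisenstein series modulo small numbers\<close>

lemma e4_cong_1: "N dvd 240 \<Longrightarrow> cong_fls N e4 1" and e6_cong_1: "N dvd 504 \<Longrightarrow> cong_fls N e6 1"
proof -
  have S: "int_coeffs (fps_to_fls (sigma_fps k))" for k by (simp add: int_coeffs_fps_to_fls sigma_fps_def)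
  have "cong_fls 240 e4 1"
    by (rule cong_fls_multipleI[OF S[of 3]]) (simp add: E4_def fls_times_fps_to_fls)
  thus "N dvd 240 \<Longrightarrow> cong_fls N e4 1" by (rule cong_fls_dvd)
  have "cong_fls 504 e6 1"
    by (rule cong_fls_multipleI[of "- fps_to_fls (sigma_fps 5)"]) (auto simp: E6_def fls_times_fps_to_fls S)
  thus "N dvd 504 \<Longrightarrow> cong_fls N e6 1" by (rule cong_fls_dvd)
qed

text \<open>From E_4 = 1 + 240 S the square gains a factor 2 over the modulus 16, and the cube a
  factor 3 over the modulus 3. The modulus 32 serves k = 10 with p = 2, the modulus 9 serves k = 8
  and 14 with p = 3.\<close>

lemma e4_power_cong_1: "cong_fls 32 (e4\<^sup>2) 1" "cong_fls 9 (e4 ^ 3) 1"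
proof -
  define S where "S = fps_to_fls (sigma_fps 3)"
  have S: "int_coeffs S" by (simp add: S_def int_coeffs_fps_to_fls sigma_fps_def)
  have e: "e4 = 1 + 240 * S" by (simp add: S_def E4_def fls_times_fps_to_fls)
  show "cong_fls 32 (e4\<^sup>2) 1"
  proof (rule cong_fls_multipleI)
    show "int_coeffs (15 * S + 1800 * S\<^sup>2)" using S by auto
    show "e4\<^sup>2 = 1 + of_int 32 * (15 * S + 1800 * S\<^sup>2)" by (simp add: e power2_eq_square algebra_simps)
  qed
  show "cong_fls 9 (e4 ^ 3) 1"
  proof (rule cong_fls_multipleI)
    show "int_coeffs (80 * S + 19200 * S\<^sup>2 + 1536000 * S ^ 3)" using S by auto
    show "e4 ^ 3 = 1 + of_int 9 * (80 * S + 19200 * S\<^sup>2 + 1536000 * S ^ 3)"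
      by (simp add: e power2_eq_square power3_eq_cube algebra_simps)
  qed
qed

text \<open>The last branch supplies weight 0, the partner of weight 14 in
  \<open>eis_mult\<close>.\<close>

definition eis :: "int \<Rightarrow> complex fls" where
  "eis k = (if k = 4 then e4 else if k = 6 then e6 else if k = 8 then e4\<^sup>2
            else if k = 10 then e4 * e6 else if k = 14 then e4\<^sup>2 * e6 else 1)"

lemma eis_mult: "k \<in> {4, 6, 8, 10, 14} \<Longrightarrow> eis k * eis (14 - k) = e4\<^sup>2 * e6"
  by (auto simp: eis_def power2_eq_square)

lemma modular_series_eis: "k \<in> {0, 4, 6, 8, 10, 14} \<Longrightarrow> modular_series k (eis k)"
  using modular_series_E4 modular_series_E6 modular_series_power[OF modular_series_E4, of 2] modular_series_mult[OF modular_series_E4 modular_series_E6] modular_series_1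
    modular_series_mult[OF modular_series_power[OF modular_series_E4, of 2] modular_series_E6]
  by (auto simp: eis_def)

lemma leading_eis: "leading 0 (eis k)"
  using leading_e4 leading_e6 leading_mult[OF leading_e4 leading_e6] leading_power[OF leading_e4, of 2]
    leading_mult[OF leading_power[OF leading_e4, of 2] leading_e6] leading_1
  by (auto simp: eis_def)

text \<open>The hypotheses say E_4(q^p) = E_4 (1 + r/j) and E_6(q^p) = E_6 (1 + s/j) modulo N;
  multiplying out gives the other weights. In weight 14 a term r^2 s/j^3 appears, which the extra
  divisibility removes.\<close>

lemma frob_eis_products:
  assumes p: "p > 0"
    and c4: "cong_fls N (jfls * frob p e4) (e4 * (jfls + of_int r))"
    and c6: "cong_fls N (jfls * frob p e6) (e6 * (jfls + of_int s))"
  shows "cong_fls N (jfls\<^sup>2 * frob p (eis 4)) (eis 4 * (jfls\<^sup>2 + of_int r * jfls + of_int 0))"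
    and "cong_fls N (jfls\<^sup>2 * frob p (eis 6)) (eis 6 * (jfls\<^sup>2 + of_int s * jfls + of_int 0))"
    and "cong_fls N (jfls\<^sup>2 * frob p (eis 8)) (eis 8 * (jfls\<^sup>2 + of_int (2 * r) * jfls + of_int (r\<^sup>2)))"
    and "cong_fls N (jfls\<^sup>2 * frob p (eis 10)) (eis 10 * (jfls\<^sup>2 + of_int (r + s) * jfls + of_int (r * s)))"
    and "N dvd r\<^sup>2 * s \<Longrightarrow> cong_fls N (jfls\<^sup>2 * frob p (eis 14)) (eis 14 * (jfls\<^sup>2 + of_int (2 * r + s) * jfls + of_int (r\<^sup>2 + 2 * r * s)))"
proof -
  have iJ: "int_coeffs jfls" by (rule leading_int_coeffs[OF leading_jfls])
  have i4: "int_coeffs (jfls * frob p e4)" and i6: "int_coeffs (jfls * frob p e6)"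
    by (intro int_coeffs_mult int_coeffs_compose_power iJ int_coeffs_E4 int_coeffs_E6)+
  have i4': "int_coeffs (e4 * (jfls + of_int r))"
    by (intro int_coeffs_mult int_coeffs_add int_coeffs_of_int iJ int_coeffs_E4)
  show "cong_fls N (jfls\<^sup>2 * frob p (eis 4)) (eis 4 * (jfls\<^sup>2 + of_int r * jfls + of_int 0))"
    using cong_fls_mult_left[OF iJ c4] by (simp add: eis_def power2_eq_square algebra_simps)
  show "cong_fls N (jfls\<^sup>2 * frob p (eis 6)) (eis 6 * (jfls\<^sup>2 + of_int s * jfls + of_int 0))"
    using cong_fls_mult_left[OF iJ c6] by (simp add: eis_def power2_eq_square algebra_simps)
  have c8: "cong_fls N ((jfls * frob p e4) * (jfls * frob p e4)) ((e4 * (jfls + of_int r)) * (e4 * (jfls + of_int r)))"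
    by (intro cong_fls_mult c4 i4 i4')
  show "cong_fls N (jfls\<^sup>2 * frob p (eis 8)) (eis 8 * (jfls\<^sup>2 + of_int (2 * r) * jfls + of_int (r\<^sup>2)))"
    using c8 by (simp add: eis_def power2_eq_square algebra_simps)
  have "cong_fls N ((jfls * frob p e4) * (jfls * frob p e6)) ((e4 * (jfls + of_int r)) * (e6 * (jfls + of_int s)))"
    by (intro cong_fls_mult c4 c6 i6 i4')
  thus "cong_fls N (jfls\<^sup>2 * frob p (eis 10)) (eis 10 * (jfls\<^sup>2 + of_int (r + s) * jfls + of_int (r * s)))"
    by (simp add: eis_def power2_eq_square algebra_simps)
  assume N: "N dvd r\<^sup>2 * s"
  have "cong_fls N (((jfls * frob p e4) * (jfls * frob p e4)) * (jfls * frob p e6))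
     (((e4 * (jfls + of_int r)) * (e4 * (jfls + of_int r))) * (e6 * (jfls + of_int s)))"
    by (intro cong_fls_mult c8 c6 i6 int_coeffs_mult i4')
  also have "((e4 * (jfls + of_int r)) * (e4 * (jfls + of_int r))) * (e6 * (jfls + of_int s)) =
     jfls * (eis 14 * (jfls\<^sup>2 + of_int (2 * r + s) * jfls + of_int (r\<^sup>2 + 2 * r * s))) + of_int (r\<^sup>2 * s) * eis 14"
    by (simp add: eis_def power2_eq_square algebra_simps)
  also have "cong_fls N \<dots> (jfls * (eis 14 * (jfls\<^sup>2 + of_int (2 * r + s) * jfls + of_int (r\<^sup>2 + 2 * r * s))))"
    by (intro cong_fls_add_multiple N leading_int_coeffs[OF leading_eis])
  also have "((jfls * frob p e4) * (jfls * frob p e4)) * (jfls * frob p e6) = jfls * (jfls\<^sup>2 * frob p (eis 14))"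
    by (simp add: eis_def power2_eq_square algebra_simps)
  finally show "cong_fls N (jfls\<^sup>2 * frob p (eis 14)) (eis 14 * (jfls\<^sup>2 + of_int (2 * r + s) * jfls + of_int (r\<^sup>2 + 2 * r * s)))"
    by (rule cong_fls_cancel) (use int_coeffs_inverse_jfls in auto)
qed

text \<open>Modulo 5, raising to the fifth power replaces the modular equation: j(q^5) is j^5 and
  E_6(q^5) is E_6 (E_6^2)^2. As E_4 is 1, the relation j E_6^2 = E_4^3 (j - 1728) makes j E_6^2
  congruent to j - 1728.\<close>

lemma level_5_congruences:
  "cong_fls 5 (frob 5 jfls) (jfls * (of_int 0 + jfls * jfls ^ 3))"
  "cong_fls 5 (jfls\<^sup>2 * frob 5 e6) (e6 * (jfls\<^sup>2 + of_int (- 3456) * jfls + of_int (1728\<^sup>2)))"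
  "cong_fls 5 (frob 5 e4) 1" "cong_fls 5 e4 1"
proof -
  have iJ: "int_coeffs jfls" by (rule leading_int_coeffs[OF leading_jfls])
  have iD: "int_coeffs (inverse De)" by (rule leading_int_coeffs[OF leading_inverse_Delta])
  show 1: "cong_fls 5 e4 1" by (rule e4_cong_1) simp
  from cong_fls_compose_power[OF this, of 5] show "cong_fls 5 (frob 5 e4) 1" by simp
  show "cong_fls 5 (frob 5 jfls) (jfls * (of_int 0 + jfls * jfls ^ 3))"
  proof (rule cong_fls_cancel)
    have "cong_fls 5 (frob 5 jfls * De ^ 5) (frob 5 jfls * frob 5 De)"
      by (intro cong_fls_mult_left int_coeffs_frob_jfls cong_fls_sym[OF frobenius_5] int_coeffs_Delta)
    also have "frob 5 jfls * frob 5 De = frob 5 e4 ^ 3" by (simp add: frob_jfls_times_Delta)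
    also have "cong_fls 5 (frob 5 e4 ^ 3) ((e4 ^ 5) ^ 3)"
      by (intro cong_fls_power frobenius_5 int_coeffs_E4 int_coeffs_power)
    also have "(e4 ^ 5) ^ 3 = (jfls * De) ^ 5" unfolding jfls_times_Delta by (simp flip: power_mult)
    also have "\<dots> = De ^ 5 * (jfls * (of_int 0 + jfls * jfls ^ 3))"
      by (simp add: power_mult_distrib eval_nat_numeral mult_ac)
    finally show "cong_fls 5 (De ^ 5 * frob 5 jfls) (De ^ 5 * (jfls * (of_int 0 + jfls * jfls ^ 3)))"
      by (simp only: mult.commute)
    show "int_coeffs (inverse (De ^ 5))" using iD by (simp add: int_coeffs_power flip: power_inverse)
  qed simp
  have e6sq: "jfls * e6\<^sup>2 = e4 ^ 3 * (jfls - 1728)"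
  proof -
    have e: "e6\<^sup>2 = e4 ^ 3 - 1728 * De"
      using arg_cong[OF Delta_mult_1728, of fps_to_fls] by (simp add: fls_times_fps_to_fls fps_to_fls_power)
    have "jfls * e6\<^sup>2 = jfls * e4 ^ 3 - 1728 * (jfls * De)" unfolding e by (simp add: algebra_simps)
    thus ?thesis unfolding jfls_times_Delta by (simp add: algebra_simps)
  qed
  have "cong_fls 5 (e4 ^ 3 * (jfls - 1728)) (1 ^ 3 * (jfls - 1728))"
    by (intro cong_fls_mult cong_fls_power 1 cong_fls_refl int_coeffs_diff iJ int_coeffs_numeral) auto
  hence c: "cong_fls 5 (jfls * e6\<^sup>2) (jfls - 1728)" by (simp add: e6sq)
  have "cong_fls 5 (jfls\<^sup>2 * frob 5 e6) (jfls\<^sup>2 * e6 ^ 5)"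
    by (intro cong_fls_mult_left frobenius_5 int_coeffs_E6 int_coeffs_power iJ)
  also have "jfls\<^sup>2 * e6 ^ 5 = e6 * (jfls * e6\<^sup>2)\<^sup>2" by (simp add: eval_nat_numeral mult_ac)
  also have "cong_fls 5 \<dots> (e6 * (jfls - 1728)\<^sup>2)"
    by (intro cong_fls_mult_left cong_fls_power c int_coeffs_E6 int_coeffs_diff iJ int_coeffs_numeral)
  also have "e6 * (jfls - 1728)\<^sup>2 = e6 * (jfls\<^sup>2 + of_int (- 3456) * jfls + of_int (1728\<^sup>2))"
    by (simp add: power2_eq_square algebra_simps)
  finally show "cong_fls 5 (jfls\<^sup>2 * frob 5 e6) (e6 * (jfls\<^sup>2 + of_int (- 3456) * jfls + of_int (1728\<^sup>2)))" .
qed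

text \<open>The hypotheses of \<open>frob_form\<close> and \<open>constant_term_dvd\<close> for \<open>U = E\<^sub>k\<close> and \<open>N\<close>.\<close>
definition frob_data :: "int \<Rightarrow> nat \<Rightarrow> int \<Rightarrow> bool" where
  "frob_data k p N \<longleftrightarrow> (\<exists>\<alpha> \<beta> d \<kappa> K2. zj K2 \<and>
     cong_fls N (frob p jfls) (jfls * (of_int \<kappa> + jfls * K2)) \<and>
     cong_fls N (jfls\<^sup>2 * frob p (eis k)) (eis k * (jfls\<^sup>2 + of_int \<alpha> * jfls + of_int \<beta>)) \<and>
     N dvd \<alpha> * d \<and> N dvd \<beta> * d \<and> N dvd \<beta> * \<kappa> \<and> cong_fls d (eis (14 - k)) (e4 ^ 3))"

lemma frob_dataI:
  assumes "zj K2" "cong_fls M (frob p jfls) (jfls * (of_int \<kappa> + jfls * K2))"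
    "cong_fls M (jfls\<^sup>2 * frob p (eis k)) (eis k * (jfls\<^sup>2 + of_int \<alpha> * jfls + of_int \<beta>))"
    "cong_fls d (eis (14 - k)) (e4 ^ 3)"
    "N dvd M" "N dvd \<alpha> * d" "N dvd \<beta> * d" "N dvd \<beta> * \<kappa>"
  shows "frob_data k p N"
  unfolding frob_data_def using assms(1,4,6-8) cong_fls_dvd[OF assms(2,5)] cong_fls_dvd[OF assms(3,5)] by blast

lemma cong_e4_cube:
  assumes "d \<in> {3, 5, 8, 16}"
  shows "cong_fls d 1 (e4 ^ 3)"
proof -
  have "cong_fls d (e4 ^ 3) (1 ^ 3)" using assms by (intro cong_fls_power e4_cong_1) auto
  thus ?thesis by (simp add: cong_fls_sym)
qed

text \<open>With r = 16, s = -8 and kappa = 48, the triple (alpha, beta, d) is (16, 0, 8), (-8, 0,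
  16), (32, 256, 8), (8, -128, 32), (24, 0, 16) for k = 4, 6, 8, 10, 14. The products alpha d
  contain exactly 2^7, 2^7, 2^8, 2^8, 2^7.\<close>

lemma frob_data_2:
  assumes "k \<in> {4, 6, 8, 10, 14}"
  shows "frob_data k 2 (2 ^ eps k 2)"
proof -
  note j = level_2_congruences(1)
  have zj1: "zj 1" by (rule zj_1)
  have iE: "int_coeffs e4" "int_coeffs e6" by (rule int_coeffs_E4 int_coeffs_E6)+
  consider "k = 4" | "k = 6" | "k = 8" | "k = 10" | "k = 14" using assms by auto
  thus ?thesis
  proof cases
    case 1
    have "cong_fls 8 (e4 * e6) (1 * 1)" by (intro cong_fls_mult e4_cong_1 e6_cong_1 iE) auto
    hence c: "cong_fls 8 (e4 * e6) (e4 ^ 3)" using cong_fls_trans[OF _ cong_e4_cube[of 8]] by simp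
    show ?thesis unfolding 1
      by (rule frob_dataI[OF zj1 j frob_eis_products(1)[OF _ level_2_congruences(2,3)], where d = 8])
         (use c in \<open>simp_all add: eis_def eps_def\<close>)
  next
    case 2
    have "cong_fls 16 (e4\<^sup>2) (1\<^sup>2)" by (intro cong_fls_power e4_cong_1) auto
    hence c: "cong_fls 16 (e4\<^sup>2) (e4 ^ 3)" using cong_fls_trans[OF _ cong_e4_cube[of 16]] by simp
    show ?thesis unfolding 2
      by (rule frob_dataI[OF zj1 j frob_eis_products(2)[OF _ level_2_congruences(2,3)], where d = 16])
         (use c in \<open>simp_all add: eis_def eps_def\<close>)
  next
    case 3
    have c: "cong_fls 8 e6 (e4 ^ 3)" using cong_fls_trans[OF e6_cong_1 cong_e4_cube[of 8]] by simp
    show ?thesis unfolding 3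
      by (rule frob_dataI[OF zj1 j frob_eis_products(3)[OF _ level_2_congruences(2,3)], where d = 8])
         (use c in \<open>simp_all add: eis_def eps_def\<close>)
  next
    case 4
    have "cong_fls 32 (e4 * e4\<^sup>2) (e4 * 1)" by (intro cong_fls_mult_left e4_power_cong_1 iE)
    hence "cong_fls 32 (e4 ^ 3) e4" by (simp add: power2_eq_square power3_eq_cube mult.assoc)
    hence c: "cong_fls 32 e4 (e4 ^ 3)" by (rule cong_fls_sym)
    show ?thesis unfolding 4
    proof (rule frob_dataI[OF zj1 j frob_eis_products(4)[OF _ level_2_congruences(2,3)], where d = 32])
      show "cong_fls 32 (eis (14 - 10)) (e4 ^ 3)" using c by (simp only: eis_def) simp
    qed (simp_all add: eps_def)
  next
    case 5
    have "cong_fls 128 (frob 2 jfls) (jfls * (of_int 48 + jfls * 1))"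
      by (rule cong_fls_dvd[OF j]) simp
    moreover have "cong_fls 128 (jfls\<^sup>2 * frob 2 (eis 14)) (eis 14 * (jfls\<^sup>2 + of_int 24 * jfls + of_int 0))"
      using frob_eis_products(5)[OF _ level_2_congruences(2,3)[THEN cong_fls_dvd[where M = 128]]] by simp
    moreover have "cong_fls 16 (eis (14 - 14)) (e4 ^ 3)" using cong_e4_cube[of 16] by (simp add: eis_def)
    ultimately show ?thesis unfolding 5
      by (rule frob_dataI[OF zj1]) (simp_all add: eis_def eps_def)
  qed
qed

text \<open>With r = 3, s = 18 and kappa = 0, the triple (alpha, beta, d) is (3, 0, 3), (18, 0, 3),
  (6, 9, 9), (21, 54, 3), (24, 117, 9) for k = 4, 6, 8, 10, 14. The products alpha d contain exactly
  3^2, 3^3, 3^3, 3^2, 3^3.\<close>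

lemma frob_data_3:
  assumes "k \<in> {4, 6, 8, 10, 14}"
  shows "frob_data k 3 (3 ^ eps k 3)"
proof -
  note j = level_3_congruences(1)
  have zjK: "zj (of_int 9 + jfls * 1)" by (intro zj_step zj_1)
  have iE: "int_coeffs e4" "int_coeffs e6" by (rule int_coeffs_E4 int_coeffs_E6)+
  have cube: "cong_fls 9 1 (e4 ^ 3)" by (rule cong_fls_sym[OF e4_power_cong_1(2)])
  consider "k = 4" | "k = 6" | "k = 8" | "k = 10" | "k = 14" using assms by auto
  thus ?thesis
  proof cases
    case 1
    have "cong_fls 3 (e4 * e6) (1 * 1)" by (intro cong_fls_mult e4_cong_1 e6_cong_1 iE) auto
    hence c: "cong_fls 3 (e4 * e6) (e4 ^ 3)" using cong_fls_trans[OF _ cong_e4_cube[of 3]] by simp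
    show ?thesis unfolding 1
      by (rule frob_dataI[OF zjK j frob_eis_products(1)[OF _ level_3_congruences(2,3)], where d = 3])
         (use c in \<open>simp_all add: eis_def eps_def\<close>)
  next
    case 2
    have "cong_fls 3 (e4\<^sup>2) (1\<^sup>2)" by (intro cong_fls_power e4_cong_1) auto
    hence c: "cong_fls 3 (e4\<^sup>2) (e4 ^ 3)" using cong_fls_trans[OF _ cong_e4_cube[of 3]] by simp
    show ?thesis unfolding 2
      by (rule frob_dataI[OF zjK j frob_eis_products(2)[OF _ level_3_congruences(2,3)], where d = 3])
         (use c in \<open>simp_all add: eis_def eps_def\<close>)
  next
    case 3
    have c: "cong_fls 9 e6 (e4 ^ 3)" using cong_fls_trans[OF e6_cong_1 cube] by simp
    show ?thesis unfolding 3
      by (rule frob_dataI[OF zjK j frob_eis_products(3)[OF _ level_3_congruences(2,3)], where d = 9])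
         (use c in \<open>simp_all add: eis_def eps_def\<close>)
  next
    case 4
    have c: "cong_fls 3 e4 (e4 ^ 3)" using cong_fls_trans[OF e4_cong_1 cong_e4_cube[of 3]] by simp
    show ?thesis unfolding 4
      by (rule frob_dataI[OF zjK j frob_eis_products(4)[OF _ level_3_congruences(2,3)], where d = 3])
         (use c in \<open>simp_all add: eis_def eps_def\<close>)
  next
    case 5
    note c = cube
    show ?thesis unfolding 5
      by (rule frob_dataI[OF zjK j frob_eis_products(5)[OF _ level_3_congruences(2,3)], where d = 9])
         (use c in \<open>simp_all add: eis_def eps_def\<close>)
  qed
qed

text \<open>E_4 is 1 modulo 5, so weights 4 and 8 have alpha = beta = 0 and d = 1 will do. In the
  weights with a factor E_6, d = 5 suffices because kappa = 0.\<close>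

lemma frob_data_5:
  assumes "k \<in> {4, 6, 8, 10, 14}"
  shows "frob_data k 5 (5 ^ eps k 5)"
proof -
  note j = level_5_congruences(1)
  have zjK: "zj (jfls ^ 3)" by (rule zj_j_power)
  have iJ: "int_coeffs jfls" by (rule leading_int_coeffs[OF leading_jfls])
  have c4: "cong_fls 5 (frob 5 e4 ^ n) (e4 ^ n)" for n
    by (intro cong_fls_power int_coeffs_E4 cong_fls_trans[OF level_5_congruences(3) cong_fls_sym[OF level_5_congruences(4)]])
  have "cong_fls 5 (jfls\<^sup>2 * frob 5 e4 ^ n) (e4 ^ n * (jfls\<^sup>2 + of_int 0 * jfls + of_int 0))" for n
    using cong_fls_mult_left[OF int_coeffs_power[OF iJ] c4, of 2 n] by (simp add: mult.commute)
  note E48 = this[of 1] this[of 2]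
  have E6: "cong_fls 5 (jfls\<^sup>2 * (frob 5 e4 ^ n * frob 5 e6)) (e4 ^ n * e6 * (jfls\<^sup>2 + of_int (- 3456) * jfls + of_int (1728\<^sup>2)))" for n
  proof -
    have "cong_fls 5 (frob 5 e4 ^ n * (jfls\<^sup>2 * frob 5 e6)) (e4 ^ n * (e6 * (jfls\<^sup>2 + of_int (- 3456) * jfls + of_int (1728\<^sup>2))))"
      by (intro cong_fls_mult c4 level_5_congruences int_coeffs_mult int_coeffs_power int_coeffs_compose_power
            int_coeffs_E4 int_coeffs_E6 iJ)
    thus ?thesis by (simp add: mult_ac)
  qed
  note E6s = E6[of 0] E6[of 1] E6[of 2]
  have triv: "cong_fls 1 F G" if "int_coeffs F" "int_coeffs G" for F G
    by (rule cong_flsI[of "F - G"]) (use that in auto)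
  consider "k = 4 \<or> k = 8" | "k = 6" | "k = 10" | "k = 14" using assms by auto
  thus ?thesis
  proof cases
    case 1
    have "cong_fls 1 (eis (14 - k)) (e4 ^ 3)"
      by (intro triv leading_int_coeffs[OF leading_eis] int_coeffs_power int_coeffs_E4)
    thus ?thesis
      by (rule frob_dataI[OF zjK j, where d = 1 and \<alpha> = 0 and \<beta> = 0, rotated])
         (use 1 E48 in \<open>auto simp: eis_def eps_def\<close>)
  next
    case 2
    have "cong_fls 5 (e4\<^sup>2) (1\<^sup>2)" by (intro cong_fls_power e4_cong_1) auto
    hence c: "cong_fls 5 (e4\<^sup>2) (e4 ^ 3)" using cong_fls_trans[OF _ cong_e4_cube[of 5]] by simp
    show ?thesis unfolding 2
      by (rule frob_dataI[OF zjK j, where d = 5 and \<alpha> = "- 3456" and \<beta> = "1728\<^sup>2"])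
         (use c E6s(1) in \<open>simp_all add: eis_def eps_def\<close>)
  next
    case 3
    have c: "cong_fls 5 e4 (e4 ^ 3)" using cong_fls_trans[OF e4_cong_1 cong_e4_cube[of 5]] by simp
    show ?thesis unfolding 3
      by (rule frob_dataI[OF zjK j, where d = 5 and \<alpha> = "- 3456" and \<beta> = "1728\<^sup>2"])
         (use c E6s(2) in \<open>simp_all add: eis_def eps_def\<close>)
  next
    case 4
    note c = cong_e4_cube[of 5]
    show ?thesis unfolding 4
      by (rule frob_dataI[OF zjK j, where d = 5 and \<alpha> = "- 3456" and \<beta> = "1728\<^sup>2"])
         (use c E6s(3) in \<open>simp_all add: eis_def eps_def\<close>)
  qed
qed

section \<open>The coefficients \<open>a\<^sub>k(m,n)\<close>\<close>

text \<open>The function \<open>g\<close> of a q-expansion is known to be holomorphic near 0 only.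
  Around any q0 of the punctured disc it is f composed with a local branch \<open>L\<close> of log q
  / (2 pi i).\<close>

lemma holomorphic_of_compose_qq:
  assumes f: "f holomorphic_on {\<tau>. Im \<tau> > 0}" and g: "\<And>\<tau>. Im \<tau> > 0 \<Longrightarrow> g (qq \<tau>) = f \<tau>"
  shows "g holomorphic_on punctured_disc"
proof -
  have "g field_differentiable (at q0)" if q0: "q0 \<in> punctured_disc" for q0
  proof -
    obtain \<tau>0 where \<tau>0: "Im \<tau>0 > 0" "qq \<tau>0 = q0" using punctured_disc_qq[OF q0] by blast
    have q0nz: "q0 \<noteq> 0" using q0 by (simp add: punctured_disc_def)
    define L where "L = (\<lambda>q. \<tau>0 + Ln (q / q0) / (2 * of_real pi * \<i>))"
    define S where "S = punctured_disc \<inter> {q. q / q0 \<in> - \<real>\<^sub>\<le>\<^sub>0}"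
    have "open ((\<lambda>q. q / q0) -` (- \<real>\<^sub>\<le>\<^sub>0))"
      using q0nz by (intro continuous_open_vimage continuous_intros) auto
    hence opn: "open S" unfolding S_def by (intro open_Int open_punctured_disc) (simp add: vimage_def)
    have qL: "qq (L q) = q" if "q \<in> S" for q
    proof -
      have nz: "q \<noteq> 0" using that by (auto simp: S_def punctured_disc_def)
      have "2 * of_real pi * \<i> * L q = 2 * of_real pi * \<i> * \<tau>0 + Ln (q / q0)"
        by (simp add: L_def ring_distribs)
      hence "qq (L q) = qq \<tau>0 * exp (Ln (q / q0))" by (simp add: qq_def exp_add)
      also have "\<dots> = q" using nz q0nz \<tau>0 by simp
      finally show ?thesis .
    qed
    have ImL: "Im (L q) > 0" if "q \<in> S" for q
    proof -
      have "norm (qq (L q)) < 1" using qL[OF that] that by (simp add: S_def punctured_disc_def)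
      thus ?thesis by (simp add: norm_qq zero_less_mult_iff)
    qed
    have "L holomorphic_on S" unfolding L_def using q0nz by (intro holomorphic_intros) (auto simp: S_def)
    hence "f \<circ> L holomorphic_on S" using ImL by (intro holomorphic_on_compose_gen[OF _ f]) auto
    hence "g holomorphic_on S"
      by (rule holomorphic_transform) (use g[OF ImL] qL in auto)
    moreover have "q0 \<in> S" using q0 q0nz by (auto simp: S_def)
    ultimately show ?thesis using opn by (auto simp: holomorphic_on_def at_within_open[OF _ opn])
  qed
  thus ?thesis by (auto simp: holomorphic_on_def intro: field_differentiable_at_within)
qed

lemma has_q_expansion_altdef:
  "has_q_expansion f F \<longleftrightarrow> (\<exists>g. g has_laurent_expansion F \<and> (\<forall>\<tau>. Im \<tau> > 0 \<longrightarrow> f \<tau> = g (qq \<tau>)))"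
  by (auto simp: has_q_expansion_def upper_half_plane_def qq_def)

lemma has_q_expansion_unique:
  assumes "has_q_expansion f F" "has_q_expansion f G"
  shows "F = G"
proof -
  obtain g where g: "g has_laurent_expansion F" "\<And>\<tau>. Im \<tau> > 0 \<Longrightarrow> f \<tau> = g (qq \<tau>)"
    using assms(1) unfolding has_q_expansion_altdef by auto
  obtain h where h: "h has_laurent_expansion G" "\<And>\<tau>. Im \<tau> > 0 \<Longrightarrow> f \<tau> = h (qq \<tau>)"
    using assms(2) unfolding has_q_expansion_altdef by auto
  have "eventually (\<lambda>q. q \<in> ball 0 1 - {0}) (at (0 :: complex))" by (intro eventually_at_in_open) auto
  hence "eventually (\<lambda>q. g q = h q) (at 0)"
  proof eventually_elim
    case (elim q)
    hence "q \<in> punctured_disc" by (simp add: punctured_disc_def)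
    then obtain \<tau> where "Im \<tau> > 0" "qq \<tau> = q" by (rule punctured_disc_qq)
    thus ?case using g(2)[of \<tau>] h(2)[of \<tau>] by simp
  qed
  hence "h has_laurent_expansion F" using g(1) by (subst (asm) has_laurent_expansion_cong) auto
  thus ?thesis using h(1) by (rule has_laurent_expansion_unique)
qed

lemma q_expansion_eq: "has_q_expansion f F \<Longrightarrow> q_expansion f = F"
  unfolding q_expansion_def using has_q_expansion_unique by blast

lemma form_modular_in_q:
  assumes f: "f \<in> weakly_holomorphic_forms k"
    and g: "\<And>\<tau>. Im \<tau> > 0 \<Longrightarrow> f \<tau> = g (qq \<tau>)"
  shows "modular_in_q k g"
  unfolding modular_in_q_def
proof (intro conjI allI impI)
  show "g holomorphic_on punctured_disc"
    by (rule holomorphic_of_compose_qq[of f])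
       (use f g in \<open>auto simp: weakly_holomorphic_forms_def upper_half_plane_def\<close>)
  fix \<tau> :: complex assume \<tau>: "Im \<tau> > 0"
  have det: "0 * 0 - (- 1) * 1 = (1 :: int)" by simp
  have "\<forall>a b c d :: int. a * d - b * c = 1 \<longrightarrow> (\<forall>\<tau>\<in>upper_half_plane.
          f ((of_int a * \<tau> + of_int b) / (of_int c * \<tau> + of_int d)) = (of_int c * \<tau> + of_int d) powi k * f \<tau>)"
    using f unfolding weakly_holomorphic_forms_def by blast
  from this[rule_format, OF det, of \<tau>] \<tau>
  have "f ((of_int 0 * \<tau> + of_int (- 1)) / (of_int 1 * \<tau> + of_int 0)) = (of_int 1 * \<tau> + of_int 0) powi k * f \<tau>"
    by (simp only: upper_half_plane_def mem_Collect_eq)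
  hence "f (- 1 / \<tau>) = \<tau> powi k * f \<tau>" by simp
  thus "g (qq (- 1 / \<tau>)) = \<tau> powi k * g (qq \<tau>)"
    using g[OF \<tau>] g[OF minus_inverse_upper[OF \<tau>]] by simp
qed

lemma modular_series_imp_form:
  assumes "modular_series k F" "even k"
  obtains f where "f \<in> weakly_holomorphic_forms k" "has_q_expansion f F"
proof -
  from assms obtain \<phi> where \<phi>: "modular_in_q k \<phi>" "\<phi> has_laurent_expansion F" by (auto simp: modular_series_def)
  define f where "f = (\<lambda>\<tau>. if Im \<tau> > 0 then \<phi> (qq \<tau>) else 0)"
  have exp: "has_q_expansion f F"
    unfolding has_q_expansion_altdef using \<phi>(2) by (intro exI[of _ \<phi>]) (simp add: f_def)
  have "\<phi> \<circ> qq holomorphic_on {\<tau>. Im \<tau> > 0}"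
    by (rule holomorphic_on_compose_gen[OF holomorphic_qq modular_in_q_holomorphic[OF \<phi>(1)]])
       (auto intro: qq_in_punctured_disc)
  hence holo: "f holomorphic_on {\<tau>. Im \<tau> > 0}" by (rule holomorphic_transform) (simp add: f_def)
  have "f ((of_int a * \<tau> + of_int b) / (of_int c * \<tau> + of_int d)) = (of_int c * \<tau> + of_int d) powi k * f \<tau>"
    if det: "a * d - b * c = 1" and \<tau>: "Im \<tau> > 0" for a b c d :: int and \<tau>
  proof -
    have "of_int c * \<tau> + of_int d \<noteq> 0"
    proof
      assume "of_int c * \<tau> + of_int d = 0"
      hence "Im (of_int c * \<tau> + of_int d) = 0" "Re (of_int c * \<tau> + of_int d) = 0" by simp_all
      hence "c = 0" "d = 0" using \<tau> by auto
      thus False using det by simp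
    qed
    moreover have "Im ((of_int a * \<tau> + of_int b) / (of_int c * \<tau> + of_int d)) =
        of_int (a * d - b * c) * Im \<tau> / (norm (of_int c * \<tau> + of_int d))\<^sup>2"
      by (simp add: Im_divide cmod_power2 algebra_simps)
    ultimately have "Im ((of_int a * \<tau> + of_int b) / (of_int c * \<tau> + of_int d)) > 0"
      using \<tau> unfolding det by simp
    thus ?thesis using modular_in_q_SL2[OF \<phi>(1) assms(2) det \<tau>] \<tau> by (simp add: f_def)
  qed
  hence "f \<in> weakly_holomorphic_forms k"
    unfolding weakly_holomorphic_forms_def upper_half_plane_def using holo exp
    by (auto simp: f_def)
  with exp show ?thesis by (rule that[rotated])
qed

lemma form_unique:
  assumes k: "k \<in> {4, 6, 8, 10, 14}"
    and f: "f \<in> weakly_holomorphic_forms k" "has_q_expansion f F"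
    and f': "f' \<in> weakly_holomorphic_forms k" "has_q_expansion f' F'"
    and eq: "\<And>i. i \<le> 0 \<Longrightarrow> fls_nth F i = fls_nth F' i"
  shows "f = f'"
proof -
  obtain g where g: "g has_laurent_expansion F" "\<And>\<tau>. Im \<tau> > 0 \<Longrightarrow> f \<tau> = g (qq \<tau>)"
    using f(2) unfolding has_q_expansion_altdef by auto
  obtain g' where g': "g' has_laurent_expansion F'" "\<And>\<tau>. Im \<tau> > 0 \<Longrightarrow> f' \<tau> = g' (qq \<tau>)"
    using f'(2) unfolding has_q_expansion_altdef by auto
  have m: "modular_in_q k g" "modular_in_q k g'"
    using form_modular_in_q[OF f(1) g(2)] form_modular_in_q[OF f'(1) g'(2)] by blast+
  have "F - F' = 0"
    by (rule modular_series_cusp_eq_0[OF modular_series_diff[OF modular_seriesI modular_seriesI] k]) (use m g g' eq in auto)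
  hence lau: "(\<lambda>q. g q - g' q) has_laurent_expansion 0"
    using has_laurent_expansion_diff[OF g(1) g'(1)] by simp
  have "g q - g' q = 0" if "q \<in> punctured_disc" for q
    by (rule has_laurent_expansion_0_analytic_continuation[OF lau, of "ball 0 1"])
       (use m[THEN modular_in_q_holomorphic] that in \<open>auto simp: punctured_disc_def intro!: holomorphic_intros\<close>)
  hence "f \<tau> = f' \<tau>" if "Im \<tau> > 0" for \<tau>
    using g(2)[OF that] g'(2)[OF that] qq_in_punctured_disc[OF that] by simp
  moreover have "f \<tau> = f' \<tau>" if "\<not> Im \<tau> > 0" for \<tau>
    using f(1) f'(1) that by (simp add: weakly_holomorphic_forms_def upper_half_plane_def)
  ultimately show ?thesis by blast
qed

lemma ell_eq_0:
  assumes "k \<in> {4, 6, 8, 10, 14}"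
  shows "ell k = 0"
  unfolding ell_def
proof (rule the_equality)
  show "k - 12 * 0 \<in> {0, 4, 6, 8, 10, 14}" using assms by auto
  show "l = 0" if "k - 12 * l \<in> {0, 4, 6, 8, 10, 14}" for l
    using assms that by (auto; presburger)
qed

text \<open>Resolves the definite descriptions: the given series provides the form,
  \<open>form_unique\<close> its uniqueness, and integrality the integer behind the
  coefficient.\<close>

lemma coeff_a_eq:
  assumes k: "k \<in> {4, 6, 8, 10, 14}" and m: "m > 0" and n: "n > 0"
    and F: "modular_series k F" "int_coeffs F" "\<And>i. i \<le> 0 \<Longrightarrow> fls_nth F i = (if i = - m then 1 else 0)"
  shows "of_int (coeff_a k m n) = fls_nth F n"
proof -
  have "even k" using k by auto
  then obtain f where f: "f \<in> weakly_holomorphic_forms k" "has_q_expansion f F"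
    using modular_series_imp_form[OF F(1)] by blast
  have "basis_form k m = f"
    unfolding basis_form_def ell_eq_0[OF k]
  proof (rule the_equality)
    show "f \<in> weakly_holomorphic_forms k \<and> (\<forall>n\<le>0. fls_nth (q_expansion f) n = (if n = - m then 1 else 0))"
      using f F(3) by (simp add: q_expansion_eq[OF f(2)])
    fix f' assume f': "f' \<in> weakly_holomorphic_forms k \<and> (\<forall>n\<le>0. fls_nth (q_expansion f') n = (if n = - m then 1 else 0))"
    then obtain F' where F': "has_q_expansion f' F'" by (auto simp: weakly_holomorphic_forms_def)
    show "f' = f"
      by (rule form_unique[OF k _ F' f]) (use f' F(3) in \<open>auto simp: q_expansion_eq[OF F']\<close>)
  qed
  moreover obtain c where c: "fls_nth F n = of_int c" using int_coeffs_nth[OF F(2)] by (auto elim: Ints_cases)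
  ultimately have "coeff_a k m n = (THE c. of_int c = fls_nth F n)"
    using m n by (simp add: coeff_a_def ell_eq_0[OF k] q_expansion_eq[OF f(2)])
  also have "\<dots> = c" unfolding c by (rule the_equality) auto
  finally show ?thesis by (simp add: c)
qed

lemma zj_form:
  assumes k: "k \<in> {4, 6, 8, 10, 14}"
  obtains F where "zj F" "\<And>i. i \<le> 0 \<Longrightarrow> fls_nth (eis k * F) i = (if i = - int m then 1 else 0)"
    "\<And>n. m > 0 \<Longrightarrow> n > 0 \<Longrightarrow> of_int (coeff_a k (int m) n) = fls_nth (eis k * F) n"
proof -
  obtain F where F: "zj F" "\<And>i. i \<le> 0 \<Longrightarrow> fls_nth (eis k * F) i = (if i = - int m then 1 else 0)"
    using zj_basis[OF leading_eis, of m] by auto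
  have "modular_series k (eis k * F)" using modular_series_mult[OF modular_series_eis zj_modular_series[OF F(1)]] k by auto
  moreover have "int_coeffs (eis k * F)"
    by (intro int_coeffs_mult leading_int_coeffs[OF leading_eis] zj_int_coeffs F)
  ultimately show ?thesis using coeff_a_eq[OF k] F by (intro that[of F]) auto
qed

text \<open>
  Modulo \<open>N\<close> the series \<open>f\<^bsub>k,m\<^esub>(q\<^sup>p)\<close> lies in \<open>E\<^sub>k \<int>[j]\<close>, where elements are determined by their
  principal part and constant term; hence it equals \<open>f\<^bsub>k,pm\<^esub>\<close>.
\<close>
lemma coeff_a_frob:
  assumes k: "k \<in> {4, 6, 8, 10, 14}" and data: "frob_data k p N" and p: "p > 0" and m: "m > 0" and n: "n > 0"
  shows "N dvd coeff_a k (int (p * m)) n - (if int p dvd n then coeff_a k (int m) (n div int p) else 0)"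
proof -
  obtain F where F: "zj F" "\<And>i. i \<le> 0 \<Longrightarrow> fls_nth (eis k * F) i = (if i = - int m then 1 else 0)"
    "\<And>n. n > 0 \<Longrightarrow> of_int (coeff_a k (int m) n) = fls_nth (eis k * F) n"
    using zj_form[OF k, of m] m by metis
  obtain F' where F': "zj F'" "\<And>i. i \<le> 0 \<Longrightarrow> fls_nth (eis k * F') i = (if i = - int (p * m) then 1 else 0)"
    "\<And>n. n > 0 \<Longrightarrow> of_int (coeff_a k (int (p * m)) n) = fls_nth (eis k * F') n"
    using zj_form[OF k, of "p * m"] m p by (metis nat_0_less_mult_iff)
  obtain \<alpha> \<beta> d \<kappa> K2 where dat: "zj K2"
    "cong_fls N (frob p jfls) (jfls * (of_int \<kappa> + jfls * K2))"
    "cong_fls N (jfls\<^sup>2 * frob p (eis k)) (eis k * (jfls\<^sup>2 + of_int \<alpha> * jfls + of_int \<beta>))"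
    "N dvd \<alpha> * d" "N dvd \<beta> * d" "N dvd \<beta> * \<kappa>" "cong_fls d (eis (14 - k)) (e4 ^ 3)"
    using data unfolding frob_data_def by blast
  obtain c G where G: "zj G" "F = of_int c + jfls * G" using zj_decompose[OF F(1)] by metis
  \<comment> \<open>The constant term of the form vanishes because m > 0.\<close>
  have "d dvd c"
    by (rule constant_term_dvd[OF leading_eis eis_mult[OF k] dat(7) G]) (use F(2)[of 0] m in simp)
  from frob_form[OF p leading_eis dat(1-6) G(1) this G(2)] obtain Q where
    Q: "zj Q" "cong_fls N (frob p (eis k * F)) (eis k * Q)" by blast
  have frob_nth: "fls_nth (frob p (eis k * F)) i = (if int p dvd i then fls_nth (eis k * F) (i div int p) else 0)" for i
    using p by (simp only: fls_nth_compose_power)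
  have iE: "int_coeffs (eis k)" by (rule leading_int_coeffs[OF leading_eis])
  have "cong_fls N (Q - F') 0"
  proof (rule zj_divisible[OF leading_eis zj_diff[OF Q(1) F'(1)]])
    fix i :: int assume i: "i \<le> 0"
    from Q(2) obtain H where H: "int_coeffs H" "frob p (eis k * F) - eis k * Q = of_int N * H"
      by (auto simp: cong_fls_def)
    obtain h where h: "fls_nth H i = of_int h" using int_coeffs_nth[OF H(1)] by (auto elim: Ints_cases)
    have "fls_nth (frob p (eis k * F)) i = fls_nth (eis k * F') i"
    proof (cases "int p dvd i")
      case True
      then obtain j where j: "i = int p * j" by auto
      hence "j \<le> 0" using i p by (simp add: mult_le_0_iff)
      moreover have "i = - int (p * m) \<longleftrightarrow> int p * j = int p * (- int m)" by (simp add: j)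
      hence "i = - int (p * m) \<longleftrightarrow> j = - int m" using p by (simp only: mult_cancel_left) simp
      moreover have "i div int p = j" using p by (simp add: j)
      ultimately show ?thesis unfolding frob_nth using True F(2)[of j] F'(2)[OF i] by simp
    next
      case False
      hence "i \<noteq> - int (p * m)" by auto
      thus ?thesis unfolding frob_nth using False F'(2)[OF i] by simp
    qed
    moreover have "fls_nth (frob p (eis k * F)) i - fls_nth (eis k * Q) i = of_int N * of_int h"
      using arg_cong[OF H(2), of "\<lambda>F. fls_nth F i"] by (simp only: fls_minus_nth nth_of_int_mult h)
    ultimately have "fls_nth (eis k * (Q - F')) i = of_int (N * (- h))"
      by (simp add: right_diff_distrib algebra_simps)
    thus "\<exists>l. fls_nth (eis k * (Q - F')) i = of_int (N * l)" by blast
  qed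
  hence "cong_fls N (eis k * (Q - F') + eis k * F') (eis k * 0 + eis k * F')"
    by (intro cong_fls_add cong_fls_mult_left iE cong_fls_refl)
  hence "cong_fls N (eis k * Q) (eis k * F')" by (simp add: algebra_simps)
  with Q(2) have "cong_fls N (frob p (eis k * F)) (eis k * F')" by (rule cong_fls_trans)
  hence cong: "cong_fls N (eis k * F') (frob p (eis k * F))" by (rule cong_fls_sym)
  have "n div int p > 0" if "int p dvd n" using that n p by (auto simp: zero_less_mult_iff elim!: dvdE)
  hence "fls_nth (frob p (eis k * F)) n = of_int (if int p dvd n then coeff_a k (int m) (n div int p) else 0)"
    unfolding frob_nth using F(3) by simp
  from cong_fls_nth[OF cong F'(3)[OF n, symmetric] this] show ?thesis .
qed

section \<open>Duality and the symmetry of the coefficients\<close>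

lemma modular_series_inverse_Delta_eis:
  assumes "k \<in> {4, 6, 8, 10, 14}"
  shows "modular_series (2 - k) (eis (14 - k) * inverse De)"
proof -
  have "14 - k \<in> {0, 4, 6, 8, 10, 14}" using assms by auto
  from modular_series_mult[OF modular_series_eis[OF this] modular_series_inverse_Delta] show ?thesis by simp
qed

lemma theta_power_nth: "fls_nth ((theta ^^ r) F) i = of_int i ^ r * fls_nth F i"
  by (induction r) (auto simp: mult_ac)

text \<open>
  Duality and Bol's identity: for \<open>g = q\<^bsup>-n\<^esup> + O(1)\<close> of weight \<open>2 - k\<close>, the constant term of
  \<open>f\<^bsub>k,m\<^esub> g\<close> vanishes and \<open>\<theta>\<^bsup>k-1\<^esup> g = - n\<^bsup>k-1\<^esup> f\<^bsub>k,n\<^esub>\<close>.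
\<close>
lemma coeff_a_symmetric:
  assumes k: "k \<in> {4, 6, 8, 10, 14}" and m: "m > 0" and n: "n > 0"
  shows "int m ^ nat (k - 1) * coeff_a k (int m) (int n) = int n ^ nat (k - 1) * coeff_a k (int n) (int m)"
proof -
  define r where "r = nat (k - 1)"
  have r: "odd r" "int r = k - 1" "r > 0" using k by (auto simp: r_def)
  obtain F where F: "zj F" "\<And>i. i \<le> 0 \<Longrightarrow> fls_nth (eis k * F) i = (if i = - int m then 1 else 0)"
    "\<And>i. i > 0 \<Longrightarrow> of_int (coeff_a k (int m) i) = fls_nth (eis k * F) i"
    using zj_form[OF k, of m] m by metis
  obtain F' where F': "zj F'" "\<And>i. i \<le> 0 \<Longrightarrow> fls_nth (eis k * F') i = (if i = - int n then 1 else 0)"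
    "\<And>i. i > 0 \<Longrightarrow> of_int (coeff_a k (int n) i) = fls_nth (eis k * F') i"
    using zj_form[OF k, of n] n by metis
  define W where "W = eis (14 - k) * inverse De"
  have "leading 1 W" unfolding W_def using leading_mult[OF leading_eis leading_inverse_Delta] by simp
  from zj_basis[OF this, of n] n obtain G where G: "zj G"
    "\<And>i. i \<le> - 1 \<Longrightarrow> fls_nth (W * G) i = (if i = - int n then 1 else 0)" by auto
  have "modular_series (2 - k) (W * G)"
    using modular_series_mult[OF modular_series_inverse_Delta_eis[OF k] zj_modular_series[OF G(1)]] by (simp add: W_def)
  hence "modular_series (1 - int r) (W * G)" using r by simp
  from modular_series_bol[OF this] have bol: "modular_series k ((theta ^^ r) (W * G))" using r by simp
  have "modular_series k (eis k * F')" using modular_series_mult[OF modular_series_eis zj_modular_series[OF F'(1)]] k by auto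
  from modular_series_add[OF bol modular_series_cmult[OF this, of "of_nat n ^ r"]]
  \<comment> \<open>The exponent r = k - 1 is odd, so the principal part q^(-n) acquires the factor
    -n^r. The constant term that the choice of \<open>G\<close> leaves free is annihilated by
    \<open>theta\<close>.\<close>
  have "(theta ^^ r) (W * G) + fls_const (of_nat n ^ r) * (eis k * F') = 0"
  proof (rule modular_series_cusp_eq_0[OF _ k])
    fix i :: int assume i: "i \<le> 0"
    show "fls_nth ((theta ^^ r) (W * G) + fls_const (of_nat n ^ r) * (eis k * F')) i = 0"
    proof (cases "i = 0")
      case True
      thus ?thesis using r n F'(2)[of 0] by (simp add: theta_power_nth)
    next
      case False
      thus ?thesis using i F'(2)[OF i] G(2)[of i] r by (simp add: theta_power_nth)
    qed
  qed
  hence "fls_nth ((theta ^^ r) (W * G) + fls_const (of_nat n ^ r) * (eis k * F')) (int m) = 0" by simp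
  hence 1: "of_nat m ^ r * fls_nth (W * G) (int m) = - (of_nat n ^ r * fls_nth (eis k * F') (int m))"
    by (simp add: theta_power_nth add_eq_0_iff2)
  have 2: "fls_nth (W * G) (int m) + fls_nth (eis k * F) (int n) = 0"
  proof -
    \<comment> \<open>\<open>A\<close> and \<open>B\<close> are the two series without their
      principal parts. \<open>A\<close> has no constant term, so A B contributes nothing at exponent
      0, whatever the constant term of \<open>B\<close>.\<close>
    define A B where "A = eis k * F - fls_X_inv ^ m" and "B = W * G - fls_X_inv ^ n"
    have A: "fls_nth A i = 0" if "i \<le> 0" for i
      using F(2)[OF that] by (simp add: A_def)
    have B: "fls_nth B i = 0" if "i < 0" for i
      using G(2)[of i] that by (simp add: B_def)
    obtain a where a: "A = fps_to_fls a" by (rule fls_as_fps_nonneg[of A]) (use A in auto)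
    obtain b where b: "B = fps_to_fls b" by (rule fls_as_fps_nonneg[of B]) (use B in auto)
    have a0: "fps_nth a 0 = 0" using A[of 0] by (simp add: a)
    have eq: "(eis k * F) * (W * G) = fls_X_inv ^ (m + n) + fls_X_inv ^ m * B + fls_X_inv ^ n * A + A * B"
      by (simp add: A_def B_def algebra_simps power_add)
    have "(eis k * F) * (W * G) = e4\<^sup>2 * e6 * inverse De * (F * G)"
      unfolding eis_mult[OF k, symmetric] W_def by (simp add: mult_ac)
    hence "fls_nth ((eis k * F) * (W * G)) 0 = 0"
      by (simp only: zj_pairing[OF zj_mult[OF F(1) G(1)]])
    hence "fls_nth B (int m) + fls_nth A (int n) + fls_nth (A * B) 0 = 0"
      unfolding eq using m n by (simp add: fls_X_inv_power_times_conv_shift)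
    moreover have "fls_nth (A * B) 0 = 0" by (simp add: a b a0 flip: fls_times_fps_to_fls)
    ultimately show ?thesis using m n by (simp add: A_def B_def)
  qed
  have "of_nat m ^ r * fls_nth (eis k * F) (int n) = of_nat n ^ r * fls_nth (eis k * F') (int m)"
    using 1 2 by (simp add: add_eq_0_iff2 add_eq_0_iff)
  hence "(of_int (int m ^ r * coeff_a k (int m) (int n)) :: complex) = of_int (int n ^ r * coeff_a k (int n) (int m))"
    using F(3)[of "int n"] F'(3)[of "int m"] m n by simp
  thus ?thesis unfolding r_def by (simp only: of_int_eq_iff)
qed

text \<open>Common factors p are removed from m and n by \<open>coeff_a_frob\<close>. Since m
  contains more of them, p still divides m when it no longer divides n, and then f_(k,m/p)(q^p) has
  no term q^n.\<close>

lemma coeff_a_dvd: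
  assumes k: "k \<in> {4, 6, 8, 10, 14}" and data: "frob_data k p N" and p: "prime p"
    and m: "m > 0" and n: "n > 0" and mult: "multiplicity (int p) (int n) < multiplicity (int p) (int m)"
  shows "N dvd coeff_a k (int m) (int n)"
  using m n mult
proof (induction n arbitrary: m rule: less_induct)
  case (less n)
  have p1: "p > 1" by (rule prime_gt_1_nat[OF p])
  have p0: "p > 0" "int p \<noteq> 0" using p1 by simp_all
  have p2: "\<not> is_unit (int p)" using p1 by (simp add: zdvd1_eq)
  have "int p dvd int m" using less.prems(3) not_dvd_imp_multiplicity_0[of "int p" "int m"] by linarith
  then obtain m' where m': "m = p * m'" by (auto simp: int_dvd_int_iff elim!: dvdE)
  have m'0: "m' > 0" using less.prems m' by (auto intro!: Nat.gr0I)
  have frob: "N dvd coeff_a k (int m) (int n) - (if int p dvd int n then coeff_a k (int m') (int n div int p) else 0)"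
    using coeff_a_frob[OF k data p0(1) m'0, of "int n"] less.prems by (simp only: m' of_nat_0_less_iff)
  show ?case
  proof (cases "p dvd n")
    case False
    hence "\<not> int p dvd int n" by (simp add: int_dvd_int_iff)
    thus ?thesis using frob by simp
  next
    case True
    then obtain n' where n': "n = p * n'" by (auto elim!: dvdE)
    have n'0: "n' > 0" using less.prems n' by (auto intro!: Nat.gr0I)
    have "n' < n" using n' n'0 prime_gt_1_nat[OF p] by simp
    moreover have "multiplicity (int p) (int n') < multiplicity (int p) (int m')"
      using less.prems(3) m'0 n'0 p0 p2 by (simp add: m' n' multiplicity_times_same)
    ultimately have "N dvd coeff_a k (int m') (int n')" using m'0 n'0 by (intro less.IH)
    moreover have "N dvd coeff_a k (int m) (int n) - coeff_a k (int m') (int n')"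
      using frob p0 by (simp add: n')
    ultimately show ?thesis by (metis diff_add_cancel dvd_add)
  qed
qed

theorem theorem1p3:
  fixes k p m n :: int
  assumes "k \<in> {4, 6, 8, 10, 14}"
    and "p \<in> {2, 3, 5}"
    and "m > 0" and "n > 0"
  shows "(vp p m > vp p n \<longrightarrow> vp p (coeff_a k m n) \<ge> enat (eps k p)) \<and>
         (vp p n > vp p m \<longrightarrow>
            vp p (coeff_a k m n) \<ge> (vp p n - vp p m) * enat (nat (k - 1)) + enat (eps k p))"
proof -
  define r where "r = nat (k - 1)"
  have prime: "prime p" using assms(2) by auto
  hence p: "p \<noteq> 0" "\<not> is_unit p" "prime_elem p" by auto
  have dvd: "p ^ eps k p dvd coeff_a k m n"
    if "m > 0" "n > 0" "multiplicity p n < multiplicity p m" for m n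
  proof -
    have "frob_data k (nat p) (p ^ eps k p)"
      using assms(2) frob_data_2[OF assms(1)] frob_data_3[OF assms(1)] frob_data_5[OF assms(1)] by auto
    moreover have "prime (nat p)" using prime by simp
    ultimately have "p ^ eps k p dvd coeff_a k (int (nat m)) (int (nat n))"
      using that assms(2) by (intro coeff_a_dvd[OF assms(1)]) auto
    thus ?thesis using that by simp
  qed
  show ?thesis
  proof (intro conjI impI)
    assume "vp p m > vp p n"
    hence "p ^ eps k p dvd coeff_a k m n"
      using assms(3,4) by (intro dvd) (auto simp: vp_def)
    thus "vp p (coeff_a k m n) \<ge> enat (eps k p)"
      using p by (auto simp: vp_def intro!: multiplicity_geI)
  next
    assume "vp p n > vp p m"
    hence lt: "multiplicity p m < multiplicity p n" using assms(3,4) by (auto simp: vp_def)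
    hence div: "p ^ eps k p dvd coeff_a k n m" using assms(3,4) by (intro dvd)
    \<comment> \<open>Comparing v_p on both sides derives this case from the other one with m and n
      exchanged; the powers of n and m account for the gain (k - 1)(v_p(n) - v_p(m)).\<close>
    have sym: "m ^ r * coeff_a k m n = n ^ r * coeff_a k n m"
      using coeff_a_symmetric[OF assms(1), of "nat m" "nat n"] assms(3,4) by (simp add: r_def)
    show "vp p (coeff_a k m n) \<ge> (vp p n - vp p m) * enat (nat (k - 1)) + enat (eps k p)"
    proof (cases "coeff_a k m n = 0")
      case True
      thus ?thesis by (simp add: vp_def)
    next
      case False
      hence nz: "coeff_a k n m \<noteq> 0" using sym assms(3,4) by auto
      have "multiplicity p (m ^ r * coeff_a k m n) = r * multiplicity p m + multiplicity p (coeff_a k m n)"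
        using False assms(3) p by (subst prime_elem_multiplicity_mult_distrib) (auto simp: prime_elem_multiplicity_power_distrib)
      moreover have "multiplicity p (n ^ r * coeff_a k n m) = r * multiplicity p n + multiplicity p (coeff_a k n m)"
        using nz assms(4) p by (subst prime_elem_multiplicity_mult_distrib) (auto simp: prime_elem_multiplicity_power_distrib)
      moreover have "eps k p \<le> multiplicity p (coeff_a k n m)"
        using div nz p by (intro multiplicity_geI) auto
      ultimately have "r * multiplicity p n + eps k p \<le> r * multiplicity p m + multiplicity p (coeff_a k m n)"
        using sym by simp
      moreover have "r * multiplicity p n = r * multiplicity p m + (multiplicity p n - multiplicity p m) * r"
        using lt by (simp add: algebra_simps diff_mult_distrib2)
      ultimately have "(multiplicity p n - multiplicity p m) * r + eps k p \<le> multiplicity p (coeff_a k m n)"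
        by linarith
      thus ?thesis using assms(3,4) False by (simp add: vp_def r_def)
    qed
  qed
qed

end
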